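(* Let $(G,\rho)$ be a non-crossing framework in the plane, with $G$ $2$-connected, and let $\omega$ be a self-stress of $(G,\rho)$ that is non-zero on every edge. If the reciprocal framework $(G^*,\rho^* )$ determined by $\omega$ is also non-crossing, then the signs of $\omega$ satisfy the following face conditions: (1) the complement of the exterior face of $(G,\rho)$ is a strictly convex polygon whose boundary cycle has no sign changes; (2) every internal (bounded) face of $(G,\rho)$ is of one of the following kinds: (a) a pseudo-triangle with exactly two sign changes, both occurring at corners; (b) a pseudo-triangle with exactly four sign changes, exactly three of them occurring at corners; (c) a pseudo-quadrangle with exactly four sign changes, all occurring at corners.
   Context: Framework: a finite simple graph $G=(V,E)$ with a map $\rho:V\to\mathbb{R}^2$, $\rho(i)=p_i$, edges drawn as straight segments. It is non-crossing if vertices are distinct points and two edge segments meet at most in a common endpoint (a vertex never lies in the interior of an edge). Vertices with two flat angles (angles equal to $\pi$) are not allowed in frameworks. Angles: a convex angle is one that is $\le\pi$ (flat angles count as convex); a reflex angle is one that is $>\pi$. A pseudo-triangle (resp. pseudo-quadrangle) is a simple polygon with exactly three (resp. four) convex interior angles; the vertices at these are its corners. Self-stress: $\omega:E\to\mathbb{R}$ with $\sum_{j:ij\in E}\omega_{ij}(p_i-p_j)=0$ for every $i\in V$. A sign change along the boundary cycle of a face is a vertex of that cycle at which the two consecutive boundary edges have stresses of opposite signs. Reciprocal: $G^*$ is the dual plane graph of the non-crossing drawing $(G,\rho)$ (one vertex per face, including the outer one; one edge $e^*$ per edge $e$). The reciprocal $(G^*,\rho^* )$ of $(G,\rho)$ determined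 by $\omega$ is the framework, unique up to translation, such that for every directed edge $i\to j$ with face $L$ on its left and $R$ on its right, $\rho^*(L)-\rho^*(R)=\omega_{ij}(p_j-p_i)$. The reciprocal is called non-crossing if $(G^*,\rho^* )$ is a non-crossing framework and its embedding is dual to that of $(G,\rho)$: face cycles of $(G,\rho)$ become vertex cycles (cyclic orders of edges around vertices) of $(G^*,\rho^* )$ and vertex cycles become face cycles, either all with the same orientation or all with reversed orientation (orientation of the outer face being considered from outside). *)

theory Defs
  imports "HOL-Analysis.Analysis"
begin

text \<open>The plane is the type \<^typ>\<open>complex\<close>. A graph is given by a vertex set and a set of
  two-element edges.\<close>

section \<open>Graphs\<close>

definition simple_graph :: "'v set \<Rightarrow> 'v set set \<Rightarrow> bool" where
  "simple_graph V E \<longleftrightarrow> finite V \<and> (\<forall>e\<in>E. e \<subseteq> V \<and> card e = 2)"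

definition graph_connected :: "'v set \<Rightarrow> 'v set set \<Rightarrow> bool" where
  "graph_connected V E \<longleftrightarrow>
     V \<noteq> {} \<and> (\<forall>u\<in>V. \<forall>v\<in>V. (u, v) \<in> {(x, y). x \<in> V \<and> y \<in> V \<and> {x, y} \<in> E}\<^sup>*)"

text \<open>Edges with an endpoint outside the first argument of \<^const>\<open>graph_connected\<close> are ignored
  there, so the second conjunct below speaks about the graph with \<open>S\<close> deleted.\<close>

definition two_connected :: "'v set \<Rightarrow> 'v set set \<Rightarrow> bool" where
  "two_connected V E \<longleftrightarrow>
     card V > 2 \<and> (\<forall>S. S \<subseteq> V \<and> card S < 2 \<longrightarrow> graph_connected (V - S) E)"

section \<open>Angles and rotation at a vertex\<close>

text \<open>The angle swept when turning counterclockwise from direction \<open>a\<close> to direction \<open>b\<close>, with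
  values in \<open>(0, 2\<pi>]\<close>: equal directions give a full turn, so that in \<open>ccw_next\<close> an edge is its
  own successor only at a vertex of degree one.\<close>

definition ccw_angle :: "complex \<Rightarrow> complex \<Rightarrow> real" where
  "ccw_angle a b = (if Arg2pi (b / a) = 0 then 2 * pi else Arg2pi (b / a))"

definition ccw_next :: "'v set set \<Rightarrow> ('v \<Rightarrow> complex) \<Rightarrow> 'v \<Rightarrow> 'v \<Rightarrow> 'v" where
  "ccw_next E \<rho> v w = arg_min (\<lambda>u. ccw_angle (\<rho> w - \<rho> v) (\<rho> u - \<rho> v)) (\<lambda>u. {v, u} \<in> E)"

definition vertex_angle :: "'v set set \<Rightarrow> ('v \<Rightarrow> complex) \<Rightarrow> 'v \<Rightarrow> 'v \<Rightarrow> real" where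
  "vertex_angle E \<rho> v w = ccw_angle (\<rho> w - \<rho> v) (\<rho> (ccw_next E \<rho> v w) - \<rho> v)"

section \<open>Non-crossing frameworks\<close>

definition edge_segment :: "('v \<Rightarrow> complex) \<Rightarrow> 'v set \<Rightarrow> complex set" where
  "edge_segment \<rho> e = convex hull (\<rho> ` e)"

definition noncrossing_framework :: "'v set \<Rightarrow> 'v set set \<Rightarrow> ('v \<Rightarrow> complex) \<Rightarrow> bool" where
  "noncrossing_framework V E \<rho> \<longleftrightarrow>
     simple_graph V E \<and>
     inj_on \<rho> V \<and>
     (\<forall>e\<in>E. \<forall>f\<in>E. e \<noteq> f \<longrightarrow> edge_segment \<rho> e \<inter> edge_segment \<rho> f \<subseteq> \<rho> ` (e \<inter> f)) \<and>
     (\<forall>v\<in>V. \<forall>e\<in>E. v \<notin> e \<longrightarrow> \<rho> v \<notin> edge_segment \<rho> e) \<and>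
     (\<forall>v\<in>V. card {w. {v, w} \<in> E \<and> vertex_angle E \<rho> v w = pi} < 2)"

definition self_stress ::
  "'v set \<Rightarrow> 'v set set \<Rightarrow> ('v \<Rightarrow> complex) \<Rightarrow> ('v set \<Rightarrow> real) \<Rightarrow> bool" where
  "self_stress V E \<rho> \<omega> \<longleftrightarrow>
     (\<forall>i\<in>V. (\<Sum>j | {i, j} \<in> E. \<omega> {i, j} *\<^sub>R (\<rho> i - \<rho> j)) = 0)"

section \<open>Faces\<close>

definition drawing :: "'v set \<Rightarrow> 'v set set \<Rightarrow> ('v \<Rightarrow> complex) \<Rightarrow> complex set" where
  "drawing V E \<rho> = \<rho> ` V \<union> (\<Union>e\<in>E. edge_segment \<rho> e)"

definition faces :: "'v set \<Rightarrow> 'v set set \<Rightarrow> ('v \<Rightarrow> complex) \<Rightarrow> complex set set" where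
  "faces V E \<rho> = components (- drawing V E \<rho>)"

text \<open>\<open>F\<close> lies on the left of the directed segment from \<open>a\<close> to \<open>b\<close>, tested next to its midpoint
  (multiplication by \<^term>\<open>\<i>\<close> is the left quarter turn). No edge or vertex of a non-crossing
  framework meets the relative interior of another edge, so for its faces any other interior
  point of the segment gives the same result.\<close>

definition on_left :: "complex \<Rightarrow> complex \<Rightarrow> complex set \<Rightarrow> bool" where
  "on_left a b F \<longleftrightarrow>
     (\<forall>\<^sub>F t in at_right (0::real). midpoint a b + of_real t * \<i> * (b - a) \<in> F)"

text \<open>The face on the right of \<open>i \<rightarrow> j\<close> is \<open>left_face V E \<rho> j i\<close>.\<close>

definition left_face ::
  "'v set \<Rightarrow> 'v set set \<Rightarrow> ('v \<Rightarrow> complex) \<Rightarrow> 'v \<Rightarrow> 'v \<Rightarrow> complex set" where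
  "left_face V E \<rho> i j = (THE F. F \<in> faces V E \<rho> \<and> on_left (\<rho> i) (\<rho> j) F)"

text \<open>Cyclic orders of edges are represented by their successor relations. Vertex cycles run
  counterclockwise. A face cycle is traversed with the face on the left; for the outer face this
  is the counterclockwise orientation as seen from outside.\<close>

definition vertex_cycle ::
  "'v set set \<Rightarrow> ('v \<Rightarrow> complex) \<Rightarrow> 'v \<Rightarrow> ('v set \<times> 'v set) set" where
  "vertex_cycle E \<rho> v = {({v, w}, {v, ccw_next E \<rho> v w}) | w. {v, w} \<in> E}"

definition face_cycle ::
  "'v set \<Rightarrow> 'v set set \<Rightarrow> ('v \<Rightarrow> complex) \<Rightarrow> complex set \<Rightarrow> ('v set \<times> 'v set) set" where
  "face_cycle V E \<rho> F = {({i, j}, {j, k}) | i j k.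
     {i, j} \<in> E \<and> {j, k} \<in> E \<and> left_face V E \<rho> i j = F \<and> ccw_next E \<rho> j k = i}"

section \<open>Reciprocals\<close>

text \<open>The dual graph has vertex set \<^term>\<open>faces V E \<rho>\<close>; the edge dual to \<open>e\<close> joins the two faces
  incident to \<open>e\<close>.\<close>

definition dual_edge ::
  "'v set \<Rightarrow> 'v set set \<Rightarrow> ('v \<Rightarrow> complex) \<Rightarrow> 'v set \<Rightarrow> complex set set" where
  "dual_edge V E \<rho> e = {left_face V E \<rho> i j | i j. e = {i, j}}"

definition reciprocal ::
  "'v set \<Rightarrow> 'v set set \<Rightarrow> ('v \<Rightarrow> complex) \<Rightarrow> ('v set \<Rightarrow> real) \<Rightarrow> (complex set \<Rightarrow> complex) \<Rightarrow> bool"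
  where
  "reciprocal V E \<rho> \<omega> \<rho>' \<longleftrightarrow>
     (\<forall>i j. {i, j} \<in> E \<longrightarrow>
        \<rho>' (left_face V E \<rho> i j) - \<rho>' (left_face V E \<rho> j i) = \<omega> {i, j} *\<^sub>R (\<rho> j - \<rho> i))"

definition dual_embedding_same ::
  "'v set \<Rightarrow> 'v set set \<Rightarrow> ('v \<Rightarrow> complex) \<Rightarrow> (complex set \<Rightarrow> complex) \<Rightarrow> bool" where
  "dual_embedding_same V E \<rho> \<rho>' \<longleftrightarrow>
     (let d = dual_edge V E \<rho>; V' = faces V E \<rho>; E' = d ` E in
       (\<forall>F\<in>V'. map_prod d d ` face_cycle V E \<rho> F = vertex_cycle E' \<rho>' F) \<and>
       (\<forall>v\<in>V. \<exists>F'\<in>faces V' E' \<rho>'. map_prod d d ` vertex_cycle E \<rho> v = face_cycle V' E' \<rho>' F'))"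

definition dual_embedding_reversed ::
  "'v set \<Rightarrow> 'v set set \<Rightarrow> ('v \<Rightarrow> complex) \<Rightarrow> (complex set \<Rightarrow> complex) \<Rightarrow> bool" where
  "dual_embedding_reversed V E \<rho> \<rho>' \<longleftrightarrow>
     (let d = dual_edge V E \<rho>; V' = faces V E \<rho>; E' = d ` E in
       (\<forall>F\<in>V'. map_prod d d ` face_cycle V E \<rho> F = (vertex_cycle E' \<rho>' F)\<inverse>) \<and>
       (\<forall>v\<in>V. \<exists>F'\<in>faces V' E' \<rho>'.
          map_prod d d ` vertex_cycle E \<rho> v = (face_cycle V' E' \<rho>' F')\<inverse>))"

text \<open>Injectivity of \<^const>\<open>dual_edge\<close> says that the dual graph, which has one edge per edge of
  \<open>E\<close>, has no parallel edges; loops are excluded by \<^const>\<open>simple_graph\<close>.\<close>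

definition noncrossing_reciprocal ::
  "'v set \<Rightarrow> 'v set set \<Rightarrow> ('v \<Rightarrow> complex) \<Rightarrow> (complex set \<Rightarrow> complex) \<Rightarrow> bool" where
  "noncrossing_reciprocal V E \<rho> \<rho>' \<longleftrightarrow>
     inj_on (dual_edge V E \<rho>) E \<and>
     noncrossing_framework (faces V E \<rho>) (dual_edge V E \<rho> ` E) \<rho>' \<and>
     (dual_embedding_same V E \<rho> \<rho>' \<or> dual_embedding_reversed V E \<rho> \<rho>')"

section \<open>Polygons\<close>

text \<open>Closed polygons are lists of points, closed up cyclically.\<close>

definition cyc_succ :: "'a list \<Rightarrow> nat \<Rightarrow> 'a" where
  "cyc_succ xs i = xs ! (Suc i mod length xs)"

definition cyc_pred :: "'a list \<Rightarrow> nat \<Rightarrow> 'a" where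
  "cyc_pred xs i = xs ! ((i + length xs - 1) mod length xs)"

definition polygon_boundary :: "complex list \<Rightarrow> complex set" where
  "polygon_boundary ps = (\<Union>i<length ps. closed_segment (ps ! i) (cyc_succ ps i))"

definition polygon_interior :: "complex list \<Rightarrow> complex set" where
  "polygon_interior ps = inside (polygon_boundary ps)"

definition polygon_region :: "complex list \<Rightarrow> complex set" where
  "polygon_region ps = polygon_boundary ps \<union> polygon_interior ps"

definition simple_polygon :: "complex list \<Rightarrow> bool" where
  "simple_polygon ps \<longleftrightarrow> length ps \<ge> 3 \<and> distinct ps \<and>
     (\<forall>i<length ps. \<forall>j<length ps. i \<noteq> j \<longrightarrow>
        closed_segment (ps ! i) (cyc_succ ps i) \<inter> closed_segment (ps ! j) (cyc_succ ps j)
          \<subseteq> {ps ! i, cyc_succ ps i} \<inter> {ps ! j, cyc_succ ps j})"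

definition ccw_polygon :: "complex list \<Rightarrow> bool" where
  "ccw_polygon ps \<longleftrightarrow> simple_polygon ps \<and>
     (\<forall>i<length ps. on_left (ps ! i) (cyc_succ ps i) (polygon_interior ps))"

text \<open>This is the interior angle only if the polygon is listed counterclockwise.\<close>

definition interior_angle :: "complex list \<Rightarrow> nat \<Rightarrow> real" where
  "interior_angle ps i = ccw_angle (cyc_succ ps i - ps ! i) (cyc_pred ps i - ps ! i)"

definition corners :: "complex list \<Rightarrow> nat set" where
  "corners ps = {i. i < length ps \<and> interior_angle ps i \<le> pi}"

definition pseudo_polygon :: "nat \<Rightarrow> complex list \<Rightarrow> bool" where
  "pseudo_polygon k ps \<longleftrightarrow> ccw_polygon ps \<and> card (corners ps) = k"

definition strictly_convex_polygon :: "complex list \<Rightarrow> bool" where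
  "strictly_convex_polygon ps \<longleftrightarrow> ccw_polygon ps \<and> convex (polygon_region ps) \<and>
     (\<forall>i<length ps. interior_angle ps i < pi)"

section \<open>Face boundaries and sign changes\<close>

text \<open>\<open>vs\<close> lists the boundary cycle of \<open>F\<close>, traversed with \<open>F\<close> on the left.\<close>

definition boundary_cycle ::
  "'v set \<Rightarrow> 'v set set \<Rightarrow> ('v \<Rightarrow> complex) \<Rightarrow> complex set \<Rightarrow> 'v list \<Rightarrow> bool" where
  "boundary_cycle V E \<rho> F vs \<longleftrightarrow> length vs \<ge> 3 \<and> distinct vs \<and>
     {(i, j). {i, j} \<in> E \<and> left_face V E \<rho> i j = F} = {(vs ! n, cyc_succ vs n) | n. n < length vs}"

definition sign_changes :: "('v set \<Rightarrow> real) \<Rightarrow> 'v list \<Rightarrow> nat set" where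
  "sign_changes \<omega> vs =
     {n. n < length vs \<and> \<omega> {cyc_pred vs n, vs ! n} * \<omega> {vs ! n, cyc_succ vs n} < 0}"

text \<open>The boundary cycle of the exterior face is clockwise around its complement, hence the
  reversal.\<close>

definition exterior_face_condition ::
  "'v set \<Rightarrow> 'v set set \<Rightarrow> ('v \<Rightarrow> complex) \<Rightarrow> ('v set \<Rightarrow> real) \<Rightarrow> complex set \<Rightarrow> bool" where
  "exterior_face_condition V E \<rho> \<omega> F \<longleftrightarrow>
     (\<exists>vs. boundary_cycle V E \<rho> F (rev vs) \<and>
        strictly_convex_polygon (map \<rho> vs) \<and> - F = polygon_region (map \<rho> vs) \<and>
        sign_changes \<omega> vs = {})"

definition interior_face_condition ::
  "'v set \<Rightarrow> 'v set set \<Rightarrow> ('v \<Rightarrow> complex) \<Rightarrow> ('v set \<Rightarrow> real) \<Rightarrow> complex set \<Rightarrow> bool" where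
  "interior_face_condition V E \<rho> \<omega> F \<longleftrightarrow>
     (\<exists>vs. boundary_cycle V E \<rho> F vs \<and> F = polygon_interior (map \<rho> vs) \<and>
        (let ps = map \<rho> vs; S = sign_changes \<omega> vs in
          pseudo_polygon 3 ps \<and> card S = 2 \<and> S \<subseteq> corners ps \<or>
          pseudo_polygon 3 ps \<and> card S = 4 \<and> card (S \<inter> corners ps) = 3 \<or>
          pseudo_polygon 4 ps \<and> card S = 4 \<and> S \<subseteq> corners ps))"

end

theory Submission
  imports Defs
begin

text \<open>
  The proof compares the angles of a face with the angles at its reciprocal vertex. Let the
  boundary of a face be traversed with the face on its left, let \<open>d\<^sub>k\<close> be the direction and
  \<open>\<omega>\<^sub>k\<close> the stress of its \<open>k\<close>-th edge. The edges at the reciprocal vertex have the directions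
  \<open>- \<omega>\<^sub>k d\<^sub>k\<close>. Non-crossing with dual embedding means that these directions appear in cyclic order
  around the vertex, so the turns from each to the next add up to exactly \<open>2 * pi\<close>. The
  orientation of the order is the same for all faces.

  Suppose first that the orientation is reversed. Then a face angle \<open>\<alpha>\<close> contributes \<open>\<alpha>\<close> at a sign
  change, \<open>\<alpha> + pi\<close> at a corner without sign change, and \<open>\<alpha> - pi\<close> at a reflex vertex without sign
  change (\<open>reversed_angle\<close>). The angles of an \<open>n\<close>-gon add up to \<open>(n - 2) * pi\<close>, and to
  \<open>(n + 2) * pi\<close> when measured from outside. With \<open>c\<^sub>0\<close>, \<open>r\<^sub>0\<close> the numbers of corners and
  reflex vertices without sign change and \<open>c\<^sub>1\<close>, \<open>r\<^sub>1\<close> those with sign change, this gives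
  \<open>2 c\<^sub>0 + c\<^sub>1 + r\<^sub>1 = 4\<close> for a bounded face. As a polygon has at least three corners,
  \<open>(c\<^sub>0, c\<^sub>1, r\<^sub>1)\<close> is \<open>(1, 2, 0)\<close>, \<open>(0, 3, 1)\<close> or \<open>(0, 4, 0)\<close>: the three kinds of the
  theorem. For the outer face one gets \<open>2 c\<^sub>0 + c\<^sub>1 + r\<^sub>1 = 0\<close>, so all its angles are reflex and
  there is no sign change.

  With equal orientation the same count would leave no sign changes in bounded faces
  (\<open>no_sign_change_same\<close>). But at an extreme vertex of the framework equilibrium needs both signs,
  so the sign changes at least twice around that vertex, and only one of its angles lies in the outer
  face (\<open>not_same\<close>).

  The count needs that faces are simple polygons. That the boundary of a face is a single closed
  walk is inherited from the reciprocal, where the edges at a vertex form one cycle (\<open>face_walk\<close>). That the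
  walk repeats no vertex is where 2-connectivity enters: two angles of a face at one vertex would be
  separated by a cycle through that vertex (\<open>one_angle_per_face\<close>, from the Jordan curve theorem).
  The face is then the inside or the outside of its boundary polygon
  (\<open>face_component_of_boundary\<close>). The angle sum is derived from Hopf's theorem on the turning of
  simple closed curves (\<open>turning_sum\<close>), which also yields the convexity of a polygon without reflex
  angles (\<open>convex_region\<close>).
\<close>

section \<open>Counterclockwise angles\<close>

lemma ccw_angle_range: "0 < ccw_angle a b" "ccw_angle a b \<le> 2 * pi"
  using Arg2pi[of "b / a"] by (auto simp: ccw_angle_def less_eq_real_def)

lemma ccw_angle_polar:
  assumes "a \<noteq> 0" "b \<noteq> 0"
  obtains r where "0 < r" "b = of_real r * cis (ccw_angle a b) * a"
proof
  show "0 < norm (b / a)" using assms by simp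
  have "cis (ccw_angle a b) = cis (Arg2pi (b / a))"
    by (simp add: ccw_angle_def complex_eq_iff)
  then show "b = of_real (norm (b / a)) * cis (ccw_angle a b) * a"
    using Arg2pi_eq[of "b / a"] assms by (simp add: cis_conv_exp field_simps)
qed

lemma ccw_angle_unique:
  assumes "a \<noteq> 0" "0 < r" "0 < \<phi>" "\<phi> \<le> 2 * pi" "b = of_real r * cis \<phi> * a"
  shows "ccw_angle a b = \<phi>"
proof (cases "\<phi> = 2 * pi")
  case True
  then have "cis \<phi> = 1" by (simp add: complex_eq_iff)
  then have "b / a = of_real r" using assms by simp
  then have "Arg2pi (b / a) = 0" using assms by (simp add: Arg2pi_of_real)
  then show ?thesis using True by (simp add: ccw_angle_def)
next
  case False
  then have "Arg2pi (b / a) = \<phi>" using assms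
    by (intro Arg2pi_unique[of r]) (auto simp: cis_conv_exp)
  then show ?thesis using assms by (simp add: ccw_angle_def)
qed

lemma ccw_angle_diff:
  assumes "a \<noteq> 0" "b \<noteq> 0" "c \<noteq> 0" "ccw_angle a b < ccw_angle a c"
  shows "ccw_angle b c = ccw_angle a c - ccw_angle a b"
proof -
  obtain r where r: "0 < r" "b = of_real r * cis (ccw_angle a b) * a"
    using ccw_angle_polar assms by blast
  obtain s where s: "0 < s" "c = of_real s * cis (ccw_angle a c) * a"
    using ccw_angle_polar assms by blast
  have "c = of_real (s / r) * cis (ccw_angle a c - ccw_angle a b) * b"
    using r(1) by (subst s(2), subst r(2)) (simp add: cis_mult mult.assoc mult.left_commute flip: cis_divide)
  moreover have "0 < s / r" using r s by simp
  ultimately show ?thesis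
    using assms ccw_angle_range[of a b] ccw_angle_range[of a c] by (intro ccw_angle_unique[of b "s / r"]) auto
qed

lemma ccw_angle_eq_ray:
  assumes "a \<noteq> 0" "b \<noteq> 0" "c \<noteq> 0" "ccw_angle a b = ccw_angle a c"
  obtains r where "0 < r" "c = of_real r * b"
proof -
  obtain r where r: "0 < r" "b = of_real r * cis (ccw_angle a b) * a"
    using ccw_angle_polar assms by blast
  obtain s where s: "0 < s" "c = of_real s * cis (ccw_angle a c) * a"
    using ccw_angle_polar assms by blast
  have "c = of_real (s / r) * b"
    using r(1) by (subst s(2), subst r(2)) (simp add: assms)
  then show ?thesis using that[of "s / r"] r s by simp
qed

lemma ccw_angle_scale:
  assumes "0 < r" "0 < s"
  shows "ccw_angle (of_real r * a) (of_real s * b) = ccw_angle a b"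
proof -
  have "of_real s * b / (of_real r * a) = of_real (s / r) * (b / a)" by simp
  then have "Arg2pi (of_real s * b / (of_real r * a)) = Arg2pi (b / a)"
    using assms by (metis Arg2pi_times_of_real divide_pos_pos)
  then show ?thesis by (simp add: ccw_angle_def)
qed

lemma ccw_angle_minus_minus: "ccw_angle (- a) (- b) = ccw_angle a b"
  by (simp add: ccw_angle_def)

lemma ccw_angle_self: "a \<noteq> 0 \<Longrightarrow> ccw_angle a a = 2 * pi"
  by (simp add: ccw_angle_def Arg2pi_of_real[of 1, simplified])

lemma ccw_angle_minus_right:
  assumes "a \<noteq> 0" "b \<noteq> 0"
  shows "ccw_angle a (- b) = (if ccw_angle a b \<le> pi then ccw_angle a b + pi else ccw_angle a b - pi)"
proof -
  obtain r where r: "0 < r" "b = of_real r * cis (ccw_angle a b) * a"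
    using ccw_angle_polar assms by blast
  have "cis (ccw_angle a b + pi) = - cis (ccw_angle a b)" "cis (ccw_angle a b - pi) = - cis (ccw_angle a b)"
    by (simp_all add: complex_eq_iff)
  then have "- b = of_real r * cis (ccw_angle a b + pi) * a" "- b = of_real r * cis (ccw_angle a b - pi) * a"
    using r(2) by simp_all
  then show ?thesis
    using ccw_angle_unique[of a r "ccw_angle a b + pi" "- b"]
      ccw_angle_unique[of a r "ccw_angle a b - pi" "- b"] r assms ccw_angle_range[of a b] by auto
qed

lemma ccw_angle_swap:
  assumes "a \<noteq> 0" "b \<noteq> 0" "ccw_angle a b < 2 * pi"
  shows "ccw_angle b a = 2 * pi - ccw_angle a b"
  using ccw_angle_diff[of a b a] ccw_angle_self[of a] assms by auto

lemma ccw_angle_full_ray: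
  assumes "a \<noteq> 0" "b \<noteq> 0" "ccw_angle a b = 2 * pi"
  obtains r where "0 < r" "b = of_real r * a"
  using ccw_angle_eq_ray[of a a b] assms by (auto simp: ccw_angle_self)

section \<open>The cyclic order of the edges at a vertex\<close>

lemma cyc_succ_lt: "Suc i < length xs \<Longrightarrow> cyc_succ xs i = xs ! Suc i"
  by (simp add: cyc_succ_def)

lemma cyc_succ_last: "Suc i = length xs \<Longrightarrow> cyc_succ xs i = xs ! 0"
  by (simp add: cyc_succ_def)

text \<open>Sorted by their angle from a reference edge, the edges are listed in rotation order: the next edge
after each is its successor in the list, and the angle sum telescopes.\<close>

lemma ccw_next_list:
  fixes E :: "'v set set" and \<rho> :: "'v \<Rightarrow> complex" and v :: 'v
  defines "\<delta> \<equiv> \<lambda>v u. \<rho> u - \<rho> v"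
  defines "N \<equiv> {u. {v, u} \<in> E}"
  assumes fin: "finite N" and nonempty: "N \<noteq> {}"
    and nz: "\<And>u. u \<in> N \<Longrightarrow> \<delta> v u \<noteq> 0"
    and rays: "\<And>u w r. u \<in> N \<Longrightarrow> w \<in> N \<Longrightarrow> 0 < r \<Longrightarrow> \<delta> v w = of_real r * \<delta> v u \<Longrightarrow> u = w"
  obtains ws where "distinct ws" "set ws = N"
    "\<forall>i<length ws. ccw_next E \<rho> v (ws ! i) = cyc_succ ws i"
    "(\<Sum>w\<in>N. vertex_angle E \<rho> v w) = 2 * pi"
proof -
  obtain w0 where w0: "w0 \<in> N" using nonempty by blast
  define \<theta> where "\<theta> u = ccw_angle (\<delta> v w0) (\<delta> v u)" for u
  have inj_angle: "inj_on (\<lambda>u. ccw_angle (\<delta> v w) (\<delta> v u)) N" if "w \<in> N" for w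
  proof (rule inj_onI)
    fix x y assume "x \<in> N" "y \<in> N" "ccw_angle (\<delta> v w) (\<delta> v x) = ccw_angle (\<delta> v w) (\<delta> v y)"
    then show "x = y" using ccw_angle_eq_ray[of "\<delta> v w" "\<delta> v x" "\<delta> v y"] nz rays that by metis
  qed
  have inj\<theta>: "inj_on \<theta> N" using inj_angle[OF w0] by (simp add: inj_on_def \<theta>_def)
  define ts where "ts = sorted_list_of_set (\<theta> ` N)"
  define ws where "ws = map (inv_into N \<theta>) ts"
  have set_ts: "set ts = \<theta> ` N" "sorted_wrt (<) ts" "distinct ts" using fin by (simp_all add: ts_def)
  have set_ws: "set ws = N"
    by (simp add: ws_def set_ts image_comp) (use inj\<theta> in \<open>auto simp: inv_into_f_f\<close>)
  have \<theta>ws: "\<theta> (ws ! i) = ts ! i" if "i < length ts" for i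
    using that set_ts(1) nth_mem[OF that] by (simp add: ws_def f_inv_into_f)
  have dist: "distinct ws"
    using set_ts inj_on_inv_into[of "\<theta> ` N" \<theta> N] by (simp add: ws_def distinct_map)
  have len: "length ws = length ts" by (simp add: ws_def)
  have tpos: "0 < ts ! i" if "i < length ts" for i
    using \<theta>ws[OF that] ccw_angle_range by (metis \<theta>_def)
  have mono: "ts ! i < ts ! j" if "i < j" "j < length ts" for i j
    using set_ts(2) that by (simp add: sorted_wrt_iff_nth_less)
  have mem: "ws ! i \<in> N" if "i < length ts" for i using that set_ws len nth_mem by metis
  \<comment> \<open>The reference edge itself gets the largest angle, a full turn, so it comes last.\<close>
  obtain l where l: "l < length ws" "ws ! l = w0" using w0 set_ws by (metis in_set_conv_nth)
  have tl: "ts ! l = 2 * pi" using \<theta>ws[of l] l len nz[OF w0] by (simp add: \<theta>_def ccw_angle_self)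
  have last: "Suc l = length ts"
  proof (rule ccontr)
    assume "Suc l \<noteq> length ts"
    then have "Suc l < length ts" using l len by simp
    then show False using mono[of l "Suc l"] tl \<theta>ws[of "Suc l"] ccw_angle_range[of "\<delta> v w0"]
      by (metis \<theta>_def lessI not_less)
  qed
  have ang: "ccw_angle (\<delta> v (ws ! i)) (\<delta> v (ws ! j)) =
      (if i < j then ts ! j - ts ! i else 2 * pi - (ts ! i - ts ! j))"
    if ij: "i < length ts" "j < length ts" for i j
  proof -
    consider "i < j" | "i = j" | "j < i" by linarith
    then show ?thesis
    proof cases
      case 1
      then show ?thesis
        using ccw_angle_diff[of "\<delta> v w0" "\<delta> v (ws ! i)" "\<delta> v (ws ! j)"] mono[OF 1] \<theta>ws ij nz mem w0
        by (simp add: \<theta>_def)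
    next
      case 2
      then show ?thesis using nz mem ij by (simp add: ccw_angle_self)
    next
      case 3
      have "ccw_angle (\<delta> v (ws ! j)) (\<delta> v (ws ! i)) = ts ! i - ts ! j"
        using ccw_angle_diff[of "\<delta> v w0" "\<delta> v (ws ! j)" "\<delta> v (ws ! i)"] mono[OF 3] \<theta>ws ij nz mem w0
        by (simp add: \<theta>_def)
      moreover have "ts ! i \<le> 2 * pi" using \<theta>ws[OF ij(1)] ccw_angle_range by (metis \<theta>_def)
      moreover have "0 < ts ! j" using tpos ij by simp
      ultimately show ?thesis
        using 3 ccw_angle_swap[of "\<delta> v (ws ! j)" "\<delta> v (ws ! i)"] nz mem ij by simp
    qed
  qed
  have step: "ccw_angle (\<delta> v (ws ! i)) (\<delta> v (cyc_succ ws i)) =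
      (if Suc i < length ts then ts ! Suc i - ts ! i else ts ! 0)"
    if i: "i < length ts" for i
  proof (cases "Suc i < length ts")
    case True
    then show ?thesis using ang[OF i True] len by (simp add: cyc_succ_lt)
  next
    case False
    then have "i = l" "Suc i = length ts" using i last by auto
    moreover have "ts \<noteq> []" using i by auto
    ultimately show ?thesis using ang[of i 0] i tl len by (auto simp: cyc_succ_last)
  qed
  have min: "ccw_angle (\<delta> v (ws ! i)) (\<delta> v (cyc_succ ws i)) \<le> ccw_angle (\<delta> v (ws ! i)) (\<delta> v u)"
    if i: "i < length ts" and u: "u \<in> N" for i u
  proof -
    obtain j where j: "j < length ts" "u = ws ! j" using u set_ws len by (metis in_set_conv_nth)
    have mono': "ts ! a \<le> ts ! b" if "a \<le> b" "b < length ts" for a b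
      using mono[of a b] that by (cases "a = b") auto
    show ?thesis
    proof (cases "Suc i < length ts")
      case True
      then have "ts ! Suc i \<le> 2 * pi" using mono'[of "Suc i" l] last tl by simp
      then show ?thesis using step[OF i] ang[OF i j(1)] True mono'[of "Suc i" j] j tpos[of j] by auto
    next
      case False
      then have "i = l" using i last by auto
      then show ?thesis using step[OF i] ang[OF i j(1)] False tl mono'[of 0 j] j last by auto
    qed
  qed
  have next_eq: "ccw_next E \<rho> v (ws ! i) = cyc_succ ws i" if i: "i < length ts" for i
  proof -
    have m: "cyc_succ ws i \<in> N" unfolding cyc_succ_def using i len mem by (metis mod_less_divisor gr_implies_not0 neq0_conv)
    show ?thesis unfolding ccw_next_def
    proof (rule arg_min_inj_eq)
      show "inj_on (\<lambda>u. ccw_angle (\<rho> (ws ! i) - \<rho> v) (\<rho> u - \<rho> v)) {u. {v, u} \<in> E}"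
        using inj_angle[OF mem[OF i]] by (simp add: N_def \<delta>_def)
    qed (use m min[OF i] in \<open>auto simp: N_def \<delta>_def\<close>)
  qed
  have "(\<Sum>w\<in>N. vertex_angle E \<rho> v w) = (\<Sum>i<length ts. vertex_angle E \<rho> v (ws ! i))"
    using sum.reindex_bij_betw[OF bij_betw_nth[OF dist refl refl], of "vertex_angle E \<rho> v"] set_ws len
    by (simp add: lessThan_atLeast0)
  also have "\<dots> = (\<Sum>i<Suc l. if Suc i < Suc l then ts ! Suc i - ts ! i else ts ! 0)"
    unfolding last by (rule sum.cong) (auto simp: vertex_angle_def next_eq \<delta>_def step[unfolded \<delta>_def] last)
  also have "\<dots> = (\<Sum>i<l. ts ! Suc i - ts ! i) + ts ! 0" by simp
  also have "\<dots> = 2 * pi" by (simp add: sum_lessThan_telescope tl)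
  finally show ?thesis using that[OF dist set_ws] next_eq len by simp
qed

section \<open>Faces of a straight-line drawing\<close>

text \<open>The distance of \<open>z\<close> from the line through \<open>a\<close> and \<open>b\<close>, positive on the left of \<open>a \<rightarrow> b\<close>, in
units of \<^term>\<open>norm (b - a)\<close>.\<close>

definition side :: "complex \<Rightarrow> complex \<Rightarrow> complex \<Rightarrow> real" where
  "side a b z = Im ((z - a) / (b - a))"

lemma side_add: "a \<noteq> b \<Longrightarrow> side a b (x + of_real t * \<i> * (b - a)) = side a b x + t"
  by (simp add: side_def add_divide_distrib diff_divide_distrib)

lemma side_segment: "x \<in> closed_segment a b \<Longrightarrow> a \<noteq> b \<Longrightarrow> side a b x = 0"
proof -
  assume "x \<in> closed_segment a b" "a \<noteq> b"
  then obtain u where "x = (1 - u) *\<^sub>R a + u *\<^sub>R b" unfolding closed_segment_def by blast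
  then have "x - a = of_real u * (b - a)" by (simp add: scaleR_conv_of_real algebra_simps)
  then show ?thesis using \<open>a \<noteq> b\<close> by (simp add: side_def)
qed

lemma side_swap: "a \<noteq> b \<Longrightarrow> side b a z = - side a b z"
proof -
  assume "a \<noteq> b"
  then have "(z - b) / (a - b) = 1 - (z - a) / (b - a)" by (simp add: field_simps)
  then show ?thesis by (simp add: side_def)
qed

lemma convex_side: "convex {z. 0 < side a b z}"
proof -
  define c where "c = inverse (b - a)"
  have "side a b z = inner (Complex (Im c) (Re c)) z - Im (a * c)" for z
    by (simp add: side_def c_def divide_inverse inner_complex_def algebra_simps)
  then have "{z. 0 < side a b z} = {z. inner (Complex (Im c) (Re c)) z > Im (a * c)}" by auto
  then show ?thesis by (simp only: convex_halfspace_gt)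
qed

lemma open_meets_off_line:
  assumes "open G" "G \<noteq> {}" "a \<noteq> b"
  obtains x where "x \<in> G" "side a b x \<noteq> 0"
proof -
  obtain y where y: "y \<in> G" using assms by blast
  have "((\<lambda>t. y + of_real t * \<i> * (b - a)) \<longlongrightarrow> y + of_real 0 * \<i> * (b - a)) (at_right (0::real))"
    by (intro tendsto_intros)
  then have "\<forall>\<^sub>F t in at_right (0::real). y + of_real t * \<i> * (b - a) \<in> G"
    using y \<open>open G\<close> by (intro topological_tendstoD) auto
  moreover have "\<forall>\<^sub>F t in at_right (0::real). 0 < t" by (simp add: eventually_at_right_less)
  ultimately have "\<forall>\<^sub>F t in at_right (0::real). 0 < t \<and> y + of_real t * \<i> * (b - a) \<in> G"
    by eventually_elim simp
  then obtain t where t: "0 < t" "y + of_real t * \<i> * (b - a) \<in> G"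
    using eventually_happens'[of "at_right (0::real)"] by force
  then show ?thesis using that[OF y] that[OF t(2)] side_add[OF assms(3), of y t] by linarith
qed

lemma on_left_mono: "on_left a b F \<Longrightarrow> F \<subseteq> K \<Longrightarrow> on_left a b K"
  unfolding on_left_def by (auto elim: eventually_mono)

text \<open>These conditions pass to every subgraph, whereas a bound on the flat angles would not: deleting edges merges
angles. So they hold for a framework, for each of its cycles and for any simple polygon, and local
facts about faces and sides proved here apply to all three.\<close>

locale plane_drawing =
  fixes V :: "'v set" and E :: "'v set set" and \<rho> :: "'v \<Rightarrow> complex"
  assumes simple: "simple_graph V E"
    and inj: "inj_on \<rho> V"
    and cross: "\<And>e f. e \<in> E \<Longrightarrow> f \<in> E \<Longrightarrow> e \<noteq> f \<Longrightarrow>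
      edge_segment \<rho> e \<inter> edge_segment \<rho> f \<subseteq> \<rho> ` (e \<inter> f)"
    and vert: "\<And>v e. v \<in> V \<Longrightarrow> e \<in> E \<Longrightarrow> v \<notin> e \<Longrightarrow> \<rho> v \<notin> edge_segment \<rho> e"
begin

lemma edgeD:
  assumes "{a, b} \<in> E"
  shows "a \<in> V" "b \<in> V" "a \<noteq> b" "\<rho> a \<noteq> \<rho> b" "edge_segment \<rho> {a, b} = closed_segment (\<rho> a) (\<rho> b)"
proof -
  have "{a, b} \<subseteq> V" "card {a, b} = 2" using assms simple by (auto simp: simple_graph_def)
  then show *: "a \<in> V" "b \<in> V" "a \<noteq> b" by auto
  then show "\<rho> a \<noteq> \<rho> b" using inj by (auto dest: inj_onD)
  show "edge_segment \<rho> {a, b} = closed_segment (\<rho> a) (\<rho> b)"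
    by (simp add: edge_segment_def segment_convex_hull)
qed

lemma finite_V: "finite V" using simple by (simp add: simple_graph_def)

lemma finite_E: "finite E"
proof (rule finite_subset)
  show "E \<subseteq> Pow V" using simple by (auto simp: simple_graph_def)
qed (simp add: finite_V)

lemma finite_nbrs: "finite {u. {v, u} \<in> E}"
  by (rule finite_subset[OF _ finite_V]) (use edgeD in auto)

lemma edge_subset: "e \<in> E \<Longrightarrow> e \<subseteq> V"
  using simple by (auto simp: simple_graph_def)

lemma compact_edge: "e \<in> E \<Longrightarrow> compact (edge_segment \<rho> e)"
  unfolding edge_segment_def using edge_subset finite_V
  by (intro finite_imp_compact_convex_hull finite_imageI) (auto intro: finite_subset)

lemma compact_drawing: "compact (drawing V E \<rho>)"
  unfolding drawing_def
  by (intro compact_Un compact_UN finite_imp_compact[of "\<rho> ` _"] finite_imageI finite_V finite_E) (auto simp: compact_edge)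

lemma edge_in_drawing: "{a, b} \<in> E \<Longrightarrow> closed_segment (\<rho> a) (\<rho> b) \<subseteq> drawing V E \<rho>"
  using edgeD(5) by (auto simp: drawing_def)

lemma open_face: "F \<in> faces V E \<rho> \<Longrightarrow> open F"
  unfolding faces_def using compact_drawing by (meson compact_imp_closed open_Compl open_components)

lemma face_disjoint: "F \<in> faces V E \<rho> \<Longrightarrow> F \<inter> drawing V E \<rho> = {}"
  unfolding faces_def using in_components_subset by blast

lemma face_absorbs:
  assumes "F \<in> faces V E \<rho>" "connected Q" "Q \<inter> drawing V E \<rho> = {}" "Q \<inter> F \<noteq> {}"
  shows "Q \<subseteq> F"
  using components_maximal[of F "- drawing V E \<rho>" Q] assms unfolding faces_def by blast

lemma face_eq: "F \<in> faces V E \<rho> \<Longrightarrow> G \<in> faces V E \<rho> \<Longrightarrow> F \<inter> G \<noteq> {} \<Longrightarrow> F = G"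
  unfolding faces_def by (metis components_eq)

text \<open>Two edges leaving a vertex in the same direction would share an initial piece.\<close>

lemma distinct_rays:
  assumes "{v, u} \<in> E" "{v, w} \<in> E" "0 < r" "\<rho> w - \<rho> v = of_real r * (\<rho> u - \<rho> v)"
  shows "u = w"
proof (rule ccontr)
  assume "u \<noteq> w"
  then have ne: "{v, u} \<noteq> {v, w}" by (auto simp: doubleton_eq_iff)
  define s where "s = min 1 (1 / r)"
  have s: "0 < s" "s \<le> 1" "0 < r * s" "r * s \<le> 1" using assms(3) by (auto simp: s_def min_def field_simps)
  have w: "\<rho> w = \<rho> v + of_real r * (\<rho> u - \<rho> v)" using assms(4) by (simp add: algebra_simps)
  define z where "z = \<rho> v + of_real (r * s) * (\<rho> u - \<rho> v)"
  have "z = (1 - r * s) *\<^sub>R \<rho> v + (r * s) *\<^sub>R \<rho> u" "z = (1 - s) *\<^sub>R \<rho> v + s *\<^sub>R \<rho> w"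
    by (simp_all add: z_def w scaleR_conv_of_real algebra_simps)
  then have "z \<in> closed_segment (\<rho> v) (\<rho> u)" "z \<in> closed_segment (\<rho> v) (\<rho> w)"
    using s less_imp_le[OF s(1)] less_imp_le[OF s(3)] unfolding closed_segment_def by blast+
  then have "z \<in> \<rho> ` ({v, u} \<inter> {v, w})"
    using cross[OF assms(1,2) ne] edgeD[OF assms(1)] edgeD[OF assms(2)] by blast
  then have "z = \<rho> v" using \<open>u \<noteq> w\<close> edgeD[OF assms(1)] edgeD[OF assms(2)] by auto
  then show False using s edgeD(4)[OF assms(1)] by (auto simp: z_def)
qed

lemma rotation_list:
  assumes "{u. {v, u} \<in> E} \<noteq> {}"
  obtains ws where "distinct ws" "set ws = {u. {v, u} \<in> E}"
    "\<forall>i<length ws. ccw_next E \<rho> v (ws ! i) = cyc_succ ws i"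
    "(\<Sum>w\<in>{u. {v, u} \<in> E}. vertex_angle E \<rho> v w) = 2 * pi"
proof (rule ccw_next_list[of v E \<rho>])
  show "finite {u. {v, u} \<in> E}" by (rule finite_nbrs)
  show "{u. {v, u} \<in> E} \<noteq> {}" by fact
  show "\<And>u. u \<in> {u. {v, u} \<in> E} \<Longrightarrow> \<rho> u - \<rho> v \<noteq> 0" using edgeD by fastforce
  show "\<And>u w r. u \<in> {u. {v, u} \<in> E} \<Longrightarrow> w \<in> {u. {v, u} \<in> E} \<Longrightarrow> 0 < r \<Longrightarrow>
           \<rho> w - \<rho> v = complex_of_real r * (\<rho> u - \<rho> v) \<Longrightarrow> u = w"
    using distinct_rays by blast
qed (use that in blast)

text \<open>The segment between two interior points of an edge has positive distance from all other edges and
vertices. Its left half-neighbourhood is convex, thus it connects the left sides at both points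
within one face.\<close>

lemma left_strip:
  assumes E: "{a, b} \<in> E" and x: "x \<in> open_segment (\<rho> a) (\<rho> b)" and y: "y \<in> open_segment (\<rho> a) (\<rho> b)"
  obtains Q \<delta> where "0 < \<delta>" "convex Q" "Q \<inter> drawing V E \<rho> = {}"
    "ball x \<delta> \<inter> {z. 0 < side (\<rho> a) (\<rho> b) z} \<subseteq> Q"
    "ball y \<delta> \<inter> {z. 0 < side (\<rho> a) (\<rho> b) z} \<subseteq> Q"
    "ball x \<delta> \<inter> drawing V E \<rho> \<subseteq> closed_segment (\<rho> a) (\<rho> b)"
proof -
  define R where "R = \<rho> ` (V - {a, b}) \<union> (\<Union>e\<in>E - {{a, b}}. edge_segment \<rho> e)"
  have draw: "drawing V E \<rho> \<subseteq> R \<union> closed_segment (\<rho> a) (\<rho> b)"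
    using edgeD[OF E] by (auto simp: drawing_def R_def)
  have "compact R" unfolding R_def
    by (intro compact_Un compact_UN finite_imp_compact[of "\<rho> ` _"] finite_imageI finite_Diff finite_V finite_E) (auto simp: compact_edge)
  have sub: "closed_segment x y \<subseteq> open_segment (\<rho> a) (\<rho> b)"
    using x y convex_open_segment closed_segment_subset by blast
  have R: "closed_segment x y \<inter> R = {}"
  proof -
    have "open_segment (\<rho> a) (\<rho> b) \<inter> R = {}"
    proof (rule ccontr)
      assume "open_segment (\<rho> a) (\<rho> b) \<inter> R \<noteq> {}"
      then obtain z where z: "z \<in> closed_segment (\<rho> a) (\<rho> b)" "z \<noteq> \<rho> a" "z \<noteq> \<rho> b" "z \<in> R"
        by (auto simp: open_segment_def)
      show False
      proof (cases "z \<in> \<rho> ` (V - {a, b})")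
        case True
        then show False using vert[OF _ E] z edgeD(5)[OF E] by auto
      next
        case False
        then obtain e where e: "e \<in> E" "e \<noteq> {a, b}" "z \<in> edge_segment \<rho> e" using z by (auto simp: R_def)
        then have "z \<in> \<rho> ` (e \<inter> {a, b})" using cross[OF e(1) E e(2)] z edgeD(5)[OF E] by blast
        then show False using z by auto
      qed
    qed
    then show ?thesis using sub by blast
  qed
  obtain \<delta> where \<delta>: "0 < \<delta>" "\<forall>p\<in>closed_segment x y. \<forall>q\<in>R. \<delta> \<le> dist p q"
    using separate_compact_closed[of "closed_segment x y" R] R \<open>compact R\<close> compact_imp_closed by auto
  define T where "T = (\<Union>p\<in>closed_segment x y. \<Union>q\<in>ball 0 \<delta>. {p + q})"
  define Q where "Q = T \<inter> {z. 0 < side (\<rho> a) (\<rho> b) z}"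
  have T: "convex T" unfolding T_def by (intro convex_sums) auto
  have TR: "T \<inter> R = {}"
  proof (rule ccontr)
    assume "T \<inter> R \<noteq> {}"
    then obtain p q where "p \<in> closed_segment x y" "q \<in> ball 0 \<delta>" "p + q \<in> R" by (auto simp: T_def)
    then show False using \<delta>(2) by (force simp: dist_norm)
  qed
  have ballT: "ball c \<delta> \<subseteq> T" if "c \<in> {x, y}" for c
  proof
    fix z assume "z \<in> ball c \<delta>"
    then have "z - c \<in> ball 0 \<delta>" "z = c + (z - c)" by (auto simp: dist_norm norm_minus_commute)
    then show "z \<in> T" using that unfolding T_def by blast
  qed
  have ab: "\<rho> a \<noteq> \<rho> b" using edgeD[OF E] by simp
  show ?thesis
  proof
    show "convex Q" unfolding Q_def using T convex_side by (intro convex_Int) auto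
    show "Q \<inter> drawing V E \<rho> = {}"
      using draw TR side_segment[OF _ ab] unfolding Q_def by fastforce
    show "ball x \<delta> \<inter> {z. 0 < side (\<rho> a) (\<rho> b) z} \<subseteq> Q"
      "ball y \<delta> \<inter> {z. 0 < side (\<rho> a) (\<rho> b) z} \<subseteq> Q"
      using ballT by (auto simp: Q_def)
    show "ball x \<delta> \<inter> drawing V E \<rho> \<subseteq> closed_segment (\<rho> a) (\<rho> b)"
      using ballT[of x] draw TR by blast
  qed (use \<delta> in simp)
qed

lemma eventually_left:
  assumes "\<rho> a \<noteq> \<rho> b" "x \<in> closed_segment (\<rho> a) (\<rho> b)" "0 < \<delta>"
  shows "\<forall>\<^sub>F t in at_right (0::real). x + of_real t * \<i> * (\<rho> b - \<rho> a) \<in> ball x \<delta> \<inter> {z. 0 < side (\<rho> a) (\<rho> b) z}"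
proof -
  have "((\<lambda>t. x + of_real t * \<i> * (\<rho> b - \<rho> a)) \<longlongrightarrow> x + of_real 0 * \<i> * (\<rho> b - \<rho> a)) (at_right (0::real))"
    by (intro tendsto_intros)
  then have "\<forall>\<^sub>F t in at_right (0::real). x + of_real t * \<i> * (\<rho> b - \<rho> a) \<in> ball x \<delta>"
    using \<open>0 < \<delta>\<close> by (intro topological_tendstoD) auto
  moreover have "\<forall>\<^sub>F t in at_right (0::real). 0 < t" by (simp add: eventually_at_right_less)
  ultimately show ?thesis
    by eventually_elim (simp add: side_add side_segment assms)
qed

lemma midpoint_open: "{a, b} \<in> E \<Longrightarrow> midpoint (\<rho> a) (\<rho> b) \<in> open_segment (\<rho> a) (\<rho> b)"
  using edgeD by (simp add: midpoint_in_open_segment)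

text \<open>Existence comes from the strip to the left of the midpoint, uniqueness from the disjointness of
different faces.\<close>

lemma left_face:
  assumes E: "{a, b} \<in> E"
  shows "left_face V E \<rho> a b \<in> faces V E \<rho>" "on_left (\<rho> a) (\<rho> b) (left_face V E \<rho> a b)"
    and left_face_unique: "F \<in> faces V E \<rho> \<Longrightarrow> on_left (\<rho> a) (\<rho> b) F \<Longrightarrow> left_face V E \<rho> a b = F"
proof -
  let ?m = "midpoint (\<rho> a) (\<rho> b)"
  have m: "?m \<in> open_segment (\<rho> a) (\<rho> b)" using midpoint_open[OF E] .
  have ab: "\<rho> a \<noteq> \<rho> b" using edgeD[OF E] by simp
  obtain Q \<delta> where Q: "0 < \<delta>" "convex Q" "Q \<inter> drawing V E \<rho> = {}"
    "ball ?m \<delta> \<inter> {z. 0 < side (\<rho> a) (\<rho> b) z} \<subseteq> Q"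
    by (rule left_strip[OF E m m])
  have ev: "\<forall>\<^sub>F t in at_right (0::real). ?m + of_real t * \<i> * (\<rho> b - \<rho> a) \<in> Q"
    using eventually_left[OF ab _ Q(1), of ?m] by (rule eventually_mono) (use Q m in \<open>auto simp: open_segment_def\<close>)
  have "Q \<noteq> {}" using eventually_happens'[OF _ ev] by auto
  then obtain F where F: "F \<in> faces V E \<rho>" "Q \<subseteq> F"
    using exists_component_superset[of Q "- drawing V E \<rho>"] Q convex_connected unfolding faces_def
    by (metis Compl_disjoint2 disjoint_eq_subset_Compl subset_empty)
  have left: "on_left (\<rho> a) (\<rho> b) F"
    unfolding on_left_def using ev by (rule eventually_mono) (use F in auto)
  have uniq: "G = F" if "G \<in> faces V E \<rho>" "on_left (\<rho> a) (\<rho> b) G" for G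
  proof -
    have "\<forall>\<^sub>F t in at_right (0::real). ?m + of_real t * \<i> * (\<rho> b - \<rho> a) \<in> F \<inter> G"
      using left that(2) unfolding on_left_def by eventually_elim simp
    then have "F \<inter> G \<noteq> {}" using eventually_happens'[of "at_right (0::real)"] by force
    then show ?thesis using face_eq F that by blast
  qed
  have eq: "left_face V E \<rho> a b = F"
    unfolding left_face_def 
  proof (rule the_equality)
    show "F \<in> faces V E \<rho> \<and> on_left (\<rho> a) (\<rho> b) F" using F(1) left by blast
    show "\<And>G. G \<in> faces V E \<rho> \<and> on_left (\<rho> a) (\<rho> b) G \<Longrightarrow> G = F" using uniq by blast
  qed
  show "left_face V E \<rho> a b \<in> faces V E \<rho>" "on_left (\<rho> a) (\<rho> b) (left_face V E \<rho> a b)"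
    using eq F left by auto
  show "left_face V E \<rho> a b = F'" if "F' \<in> faces V E \<rho>" "on_left (\<rho> a) (\<rho> b) F'" for F'
    using uniq[OF that] eq by simp
qed

text \<open>The left face is defined at the midpoint of an edge; by the strip it is also the left face at every
other interior point.\<close>

lemma half_disc:
  assumes E: "{a, b} \<in> E" and x: "x \<in> open_segment (\<rho> a) (\<rho> b)"
  obtains r where "0 < r" "ball x r \<inter> drawing V E \<rho> \<subseteq> closed_segment (\<rho> a) (\<rho> b)"
    "ball x r \<inter> {z. 0 < side (\<rho> a) (\<rho> b) z} \<subseteq> left_face V E \<rho> a b"
proof -
  let ?m = "midpoint (\<rho> a) (\<rho> b)"
  have m: "?m \<in> open_segment (\<rho> a) (\<rho> b)" using midpoint_open[OF E] .
  have ab: "\<rho> a \<noteq> \<rho> b" using edgeD[OF E] by simp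
  obtain Q \<delta> where Q: "0 < \<delta>" "convex Q" "Q \<inter> drawing V E \<rho> = {}"
    "ball x \<delta> \<inter> {z. 0 < side (\<rho> a) (\<rho> b) z} \<subseteq> Q"
    "ball ?m \<delta> \<inter> {z. 0 < side (\<rho> a) (\<rho> b) z} \<subseteq> Q"
    "ball x \<delta> \<inter> drawing V E \<rho> \<subseteq> closed_segment (\<rho> a) (\<rho> b)"
    by (rule left_strip[OF E x m])
  have "\<forall>\<^sub>F t in at_right (0::real). ?m + of_real t * \<i> * (\<rho> b - \<rho> a) \<in> Q"
    using eventually_left[OF ab _ Q(1), of ?m] by (rule eventually_mono) (use Q(5) m in \<open>auto simp: open_segment_def\<close>)
  then have "\<forall>\<^sub>F t in at_right (0::real). ?m + of_real t * \<i> * (\<rho> b - \<rho> a) \<in> Q \<inter> left_face V E \<rho> a b"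
    using left_face(2)[OF E] unfolding on_left_def by eventually_elim simp
  then have "Q \<inter> left_face V E \<rho> a b \<noteq> {}" using eventually_happens'[of "at_right (0::real)"] by force
  then have "Q \<subseteq> left_face V E \<rho> a b"
    using face_absorbs[OF left_face(1)[OF E] convex_connected[OF Q(2)] Q(3)] by simp
  then have "\<And>z. z \<in> ball x \<delta> \<Longrightarrow> 0 < side (\<rho> a) (\<rho> b) z \<Longrightarrow> z \<in> left_face V E \<rho> a b"
    using Q(4) by blast
  then show ?thesis using that[OF Q(1) Q(6)] by blast
qed

lemma ccw_next_min:
  assumes "{v, w} \<in> E"
  shows "{v, ccw_next E \<rho> v w} \<in> E"
    and "{v, u} \<in> E \<Longrightarrow> vertex_angle E \<rho> v w \<le> ccw_angle (\<rho> w - \<rho> v) (\<rho> u - \<rho> v)"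
proof -
  have "\<exists>x. is_arg_min (\<lambda>u. ccw_angle (\<rho> w - \<rho> v) (\<rho> u - \<rho> v)) (\<lambda>u. u \<in> {u. {v, u} \<in> E}) x"
    using assms finite_nbrs by (intro ex_is_arg_min_if_finite) auto
  then have "\<exists>x. is_arg_min (\<lambda>u. ccw_angle (\<rho> w - \<rho> v) (\<rho> u - \<rho> v)) (\<lambda>u. {v, u} \<in> E) x" by simp
  then have "is_arg_min (\<lambda>u. ccw_angle (\<rho> w - \<rho> v) (\<rho> u - \<rho> v)) (\<lambda>u. {v, u} \<in> E) (ccw_next E \<rho> v w)"
    unfolding ccw_next_def arg_min_def by (rule someI_ex)
  then show "{v, ccw_next E \<rho> v w} \<in> E"
    and "{v, u} \<in> E \<Longrightarrow> vertex_angle E \<rho> v w \<le> ccw_angle (\<rho> w - \<rho> v) (\<rho> u - \<rho> v)"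
    unfolding is_arg_min_def vertex_angle_def by (auto simp: not_less)
qed

text \<open>The open sector between two consecutive edges at a vertex is connected and, close to the vertex,
avoids the drawing. It contains points to the left of its first edge and points to the right of its
second edge, which is how a face continues around a corner.\<close>

lemma sector:
  assumes E: "{v, w} \<in> E"
  defines "\<theta> \<equiv> vertex_angle E \<rho> v w"
  obtains r where "0 < r"
    "\<forall>s \<phi>. 0 < s \<and> s < r \<and> 0 < \<phi> \<and> \<phi> < \<theta> \<longrightarrow>
      \<rho> v + of_real s * cis \<phi> * (\<rho> w - \<rho> v) \<in> left_face V E \<rho> v w"
    "left_face V E \<rho> (ccw_next E \<rho> v w) v = left_face V E \<rho> v w"
proof -
  define u where "u = ccw_next E \<rho> v w"
  have uE: "{v, u} \<in> E" using ccw_next_min(1)[OF E] by (simp add: u_def)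
  then have uE': "{u, v} \<in> E" by (simp add: insert_commute)
  have wv: "\<rho> w - \<rho> v \<noteq> 0" "\<rho> v \<noteq> \<rho> w" and uv: "\<rho> u - \<rho> v \<noteq> 0" "\<rho> u \<noteq> \<rho> v"
    using edgeD(4)[OF E] edgeD(4)[OF uE] by auto
  have \<theta>: "\<theta> = ccw_angle (\<rho> w - \<rho> v) (\<rho> u - \<rho> v)" by (simp add: \<theta>_def vertex_angle_def u_def)
  have \<theta>r: "0 < \<theta>" "\<theta> \<le> 2 * pi" using ccw_angle_range by (auto simp: \<theta>)
  define R where "R = \<rho> ` (V - {v}) \<union> (\<Union>e\<in>{e \<in> E. v \<notin> e}. edge_segment \<rho> e)"
  have "compact R" unfolding R_def
    by (intro compact_Un compact_UN finite_imp_compact[of "\<rho> ` _"] finite_imageI finite_Diff finite_V)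
      (use finite_E in \<open>auto simp: compact_edge\<close>)
  moreover have "\<rho> v \<notin> R"
    using vert edgeD(1)[OF E] inj by (auto simp: R_def dest: inj_onD)
  ultimately obtain \<delta> where \<delta>: "0 < \<delta>" "\<forall>q\<in>R. \<delta> \<le> dist (\<rho> v) q"
    using separate_point_closed[of R "\<rho> v"] compact_imp_closed[of R] by metis
  define r where "r = \<delta> / norm (\<rho> w - \<rho> v)"
  have r: "0 < r" using \<delta> wv by (simp add: r_def)
  define pt where "pt = (\<lambda>(s, \<phi>). \<rho> v + of_real s * cis \<phi> * (\<rho> w - \<rho> v))"
  define S where "S = pt ` ({0<..<r} \<times> {0<..<\<theta>})"
  have "connected S" unfolding S_def
  proof (rule connected_continuous_image)
    show "continuous_on ({0<..<r} \<times> {0<..<\<theta>}) pt"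
      unfolding pt_def case_prod_unfold by (intro continuous_intros)
    show "connected ({0<..<r} \<times> {0<..<\<theta>})"
      by (intro convex_connected convex_Times) auto
  qed
  have disj: "S \<inter> drawing V E \<rho> = {}"
  proof (rule ccontr)
    assume "S \<inter> drawing V E \<rho> \<noteq> {}"
    then obtain s \<phi> where s: "0 < s" "s < r" "0 < \<phi>" "\<phi> < \<theta>" and z: "pt (s, \<phi>) \<in> drawing V E \<rho>"
      by (auto simp: S_def)
    have "dist (\<rho> v) (pt (s, \<phi>)) = s * norm (\<rho> w - \<rho> v)" using s by (simp add: pt_def dist_norm norm_mult)
    also have "\<dots> < \<delta>" using s wv by (simp add: r_def pos_less_divide_eq)
    finally have "pt (s, \<phi>) \<notin> R" using \<delta> by force
    moreover have nv: "pt (s, \<phi>) \<noteq> \<rho> v" using s wv by (simp add: pt_def)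
    ultimately obtain e where e: "e \<in> E" "v \<in> e" "pt (s, \<phi>) \<in> edge_segment \<rho> e"
      using z by (auto simp: drawing_def R_def)
    have "card e = 2" using e simple by (auto simp: simple_graph_def)
    then obtain x where x: "e = {v, x}" using e(2) by (auto simp: card_2_iff)
    have xE: "{v, x} \<in> E" using e x by simp
    have "pt (s, \<phi>) \<in> closed_segment (\<rho> v) (\<rho> x)" using e x edgeD(5)[OF xE] by simp
    then obtain t where t: "0 \<le> t" "t \<le> 1" "pt (s, \<phi>) = (1 - t) *\<^sub>R \<rho> v + t *\<^sub>R \<rho> x"
      unfolding closed_segment_def by blast
    then have tx: "of_real s * cis \<phi> * (\<rho> w - \<rho> v) = of_real t * (\<rho> x - \<rho> v)"
      by (simp add: pt_def scaleR_conv_of_real algebra_simps)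
    have "t \<noteq> 0" using t(3) nv by auto
    then have "\<rho> x - \<rho> v = of_real (s / t) * cis \<phi> * (\<rho> w - \<rho> v)"
      using tx by (simp add: field_simps)
    then have "ccw_angle (\<rho> w - \<rho> v) (\<rho> x - \<rho> v) = \<phi>"
      using s \<theta>r t \<open>t \<noteq> 0\<close> wv by (intro ccw_angle_unique[of _ "s / t"]) auto
    then show False using ccw_next_min(2)[OF E xE] s by (simp add: \<theta>_def)
  qed
  have Arg_small: "((\<lambda>t. Arg (of_real s0 + \<i> * of_real t)) \<longlongrightarrow> 0) (at_right (0::real))" if "0 < s0" for s0 :: real
  proof -
    have "((\<lambda>t. of_real s0 + \<i> * of_real t) \<longlongrightarrow> of_real s0 + \<i> * of_real 0) (at_right (0::real))"
      by (intro tendsto_intros)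
    moreover have "isCont Arg (of_real s0)" using that by (intro continuous_at_Arg) (auto simp: complex_nonpos_Reals_iff)
    ultimately have "((\<lambda>t. Arg (of_real s0 + \<i> * of_real t)) \<longlongrightarrow> Arg (of_real s0)) (at_right (0::real))"
      by (intro isCont_tendsto_compose[of _ Arg]) auto
    then show ?thesis using that by (simp add: Arg_of_real)
  qed
  have norm_lim: "((\<lambda>t. norm (of_real s0 + \<i> * of_real t :: complex)) \<longlongrightarrow> \<bar>s0\<bar>) (at_right (0::real))" for s0 :: real
    by (rule tendsto_eq_intros refl | simp)+
  have small: "\<forall>\<^sub>F t in at_right (0::real). 0 < t \<and> norm (of_real s0 + \<i> * of_real t :: complex) < c \<and>
       0 < Arg (of_real s0 + \<i> * of_real t) \<and> Arg (of_real s0 + \<i> * of_real t) < \<theta>"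
    if "0 < s0" "s0 < c" for s0 c :: real
  proof -
    have "\<forall>\<^sub>F t in at_right (0::real). norm (of_real s0 + \<i> * of_real t :: complex) < c"
      using order_tendstoD(2)[OF norm_lim, of s0 c] that by simp
    moreover have "\<forall>\<^sub>F t in at_right (0::real). Arg (of_real s0 + \<i> * of_real t) < \<theta>"
      using order_tendstoD(2)[OF Arg_small] that \<theta>r by simp
    moreover have "\<forall>\<^sub>F t in at_right (0::real). 0 < t" by (simp add: eventually_at_right_less)
    ultimately show ?thesis
    proof eventually_elim
      case (elim t)
      then show ?case using Arg_lt_pi[of "of_real s0 + \<i> * of_real t"] by simp
    qed
  qed
  have polar: "of_real s0 + \<i> * of_real t = of_real (norm (of_real s0 + \<i> * of_real t :: complex)) * cis (Arg (of_real s0 + \<i> * of_real t))" for s0 t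
    by (metis rcis_cmod_Arg rcis_def)
  have SF: "S \<subseteq> left_face V E \<rho> v w"
  proof -
    define s0 where "s0 = min (r / 2) (1 / 2)"
    have s0: "0 < s0" "s0 < r" "s0 < 1" using r by (auto simp: s0_def min_def)
    define x where "x = \<rho> v + of_real s0 * (\<rho> w - \<rho> v)"
    have "x = (1 - s0) *\<^sub>R \<rho> v + s0 *\<^sub>R \<rho> w" by (simp add: x_def scaleR_conv_of_real algebra_simps)
    then have x: "x \<in> open_segment (\<rho> v) (\<rho> w)" using s0 wv by (auto simp: in_segment)
    then have xc: "x \<in> closed_segment (\<rho> v) (\<rho> w)" by (simp add: open_segment_def)
    obtain q where q: "0 < q" "ball x q \<inter> drawing V E \<rho> \<subseteq> closed_segment (\<rho> v) (\<rho> w)"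
      "ball x q \<inter> {z. 0 < side (\<rho> v) (\<rho> w) z} \<subseteq> left_face V E \<rho> v w"
      by (rule half_disc[OF E x])
    have "\<forall>\<^sub>F t in at_right (0::real). x + of_real t * \<i> * (\<rho> w - \<rho> v) \<in> S \<inter> left_face V E \<rho> v w"
      using small[OF s0(1,2)] eventually_left[OF wv(2) xc q(1)]
    proof eventually_elim
      case (elim t)
      have "x + of_real t * \<i> * (\<rho> w - \<rho> v) = \<rho> v + (of_real s0 + \<i> * of_real t) * (\<rho> w - \<rho> v)"
        by (simp add: x_def algebra_simps)
      also have "\<dots> = pt (norm (of_real s0 + \<i> * of_real t :: complex), Arg (of_real s0 + \<i> * of_real t))"
        by (subst polar) (simp add: pt_def)
      also have "\<dots> \<in> S" unfolding S_def
        by (rule imageI) (use elim s0 in \<open>auto simp: zero_less_norm_iff complex_eq_iff\<close>)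
      finally show ?case using elim q(3) by blast
    qed
    then have "S \<inter> left_face V E \<rho> v w \<noteq> {}" using eventually_happens'[of "at_right (0::real)"] by force
    then show ?thesis using face_absorbs[OF left_face(1)[OF E] \<open>connected S\<close> disj] by simp
  qed
  have "S \<inter> left_face V E \<rho> u v \<noteq> {}"
  proof -
    obtain c where c: "0 < c" "\<rho> u - \<rho> v = of_real c * cis \<theta> * (\<rho> w - \<rho> v)"
      using ccw_angle_polar[OF wv(1) uv(1)] \<theta> by metis
    define s0 where "s0 = min (r / (2 * c)) (1 / 2)"
    have s0: "0 < s0" "s0 < r / c" "s0 < 1" using r c by (auto simp: s0_def min_def field_simps)
    define x where "x = \<rho> v + of_real s0 * (\<rho> u - \<rho> v)"
    have "x = (1 - s0) *\<^sub>R \<rho> v + s0 *\<^sub>R \<rho> u" by (simp add: x_def scaleR_conv_of_real algebra_simps)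
    then have "x \<in> open_segment (\<rho> v) (\<rho> u)" using s0 uv by (auto simp: in_segment)
    then have x: "x \<in> open_segment (\<rho> u) (\<rho> v)" by (simp add: open_segment_commute)
    then have xc: "x \<in> closed_segment (\<rho> u) (\<rho> v)" by (simp add: open_segment_def)
    obtain q where q: "0 < q" "ball x q \<inter> drawing V E \<rho> \<subseteq> closed_segment (\<rho> u) (\<rho> v)"
      "ball x q \<inter> {z. 0 < side (\<rho> u) (\<rho> v) z} \<subseteq> left_face V E \<rho> u v"
      by (rule half_disc[OF uE' x])
    have "\<forall>\<^sub>F t in at_right (0::real). x + of_real t * \<i> * (\<rho> v - \<rho> u) \<in> S \<inter> left_face V E \<rho> u v"
      using small[OF s0(1,2)] eventually_left[OF uv(2) xc q(1)]
    proof eventually_elim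
      case (elim t)
      let ?n = "norm (of_real s0 + \<i> * of_real t :: complex)" and ?A = "Arg (of_real s0 + \<i> * of_real t)"
      have "of_real s0 - \<i> * of_real t = cnj (of_real s0 + \<i> * of_real t)" by simp
      also have "\<dots> = of_real ?n * cis (- ?A)" by (subst polar) (simp add: cis_cnj)
      finally have pol: "of_real s0 - \<i> * of_real t = of_real ?n * cis (- ?A)" .
      have "x + of_real t * \<i> * (\<rho> v - \<rho> u) = \<rho> v + (of_real s0 - \<i> * of_real t) * (\<rho> u - \<rho> v)"
        by (simp add: x_def algebra_simps)
      also have "\<dots> = \<rho> v + of_real (?n * c) * (cis (- ?A) * cis \<theta>) * (\<rho> w - \<rho> v)"
        unfolding pol c(2) by (simp add: mult_ac)
      also have "\<dots> = pt (?n * c, \<theta> - ?A)"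
        by (simp add: pt_def cis_mult)
      also have "\<dots> \<in> S" unfolding S_def
        by (rule imageI) (use elim s0 c in \<open>auto simp: zero_less_norm_iff complex_eq_iff pos_less_divide_eq\<close>)
      finally show ?case using elim q(3) by blast
    qed
    then show ?thesis using eventually_happens'[of "at_right (0::real)"] by force
  qed
  then have "left_face V E \<rho> u v = left_face V E \<rho> v w"
    using SF face_eq left_face(1)[OF E] left_face(1)[OF uE'] by blast
  moreover have "\<rho> v + of_real s * cis \<phi> * (\<rho> w - \<rho> v) \<in> left_face V E \<rho> v w"
    if "0 < s" "s < r" "0 < \<phi>" "\<phi> < \<theta>" for s \<phi>
    using SF that by (force simp: S_def pt_def)
  ultimately show ?thesis using that[OF r] by (simp add: u_def)
qed

lemma corner: "{v, w} \<in> E \<Longrightarrow> left_face V E \<rho> (ccw_next E \<rho> v w) v = left_face V E \<rho> v w"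
  using sector by blast

text \<open>The frontier of a face consists of points of edges that have the face on one of their sides, apart
from vertices perhaps. Removing finitely many points does not disconnect an open connected set in
the plane, so vertices cannot hide a larger component.\<close>

lemma face_component_of_boundary:
  assumes F: "F \<in> faces V E \<rho>"
    and deg: "\<And>v. v \<in> V \<Longrightarrow> \<exists>w. {v, w} \<in> E"
  defines "W \<equiv> \<Union>{closed_segment (\<rho> a) (\<rho> b) | a b. {a, b} \<in> E \<and> left_face V E \<rho> a b = F}"
  shows "F \<in> components (- W)"
proof -
  have "F \<noteq> {}" "connected F" "F \<subseteq> - drawing V E \<rho>"
    using F in_components_nonempty[of F] in_components_connected[of F] in_components_subset[of F "- drawing V E \<rho>"]
    by (auto simp: faces_def)
  have Wd: "W \<subseteq> drawing V E \<rho>" using edge_in_drawing by (force simp: W_def)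
  obtain C where C: "C \<in> components (- W)" "F \<subseteq> C"
    using exists_component_superset[of F "- W"] \<open>F \<noteq> {}\<close> \<open>connected F\<close> \<open>F \<subseteq> - drawing V E \<rho>\<close> Wd by blast
  have "W = (\<Union>e\<in>{{a, b} | a b. {a, b} \<in> E \<and> left_face V E \<rho> a b = F}. edge_segment \<rho> e)"
    unfolding W_def using edgeD(5) by blast
  moreover have "finite {{a, b} | a b. {a, b} \<in> E \<and> left_face V E \<rho> a b = F}"
    by (rule finite_subset[OF _ finite_E]) auto
  ultimately have "compact W" using compact_edge by (auto intro!: compact_UN)
  then have "open C" using C(1) by (meson compact_imp_closed open_Compl open_components)
  have CW: "C \<inter> W = {}" using C(1) in_components_subset by blast
  let ?C = "C - \<rho> ` V"
  have conC: "connected ?C"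
    using \<open>open C\<close> in_components_connected[OF C(1)] finite_V by (intro connected_open_delete_finite) auto
  have FC: "F \<subseteq> ?C" using C(2) \<open>F \<subseteq> - drawing V E \<rho>\<close> by (auto simp: drawing_def)
  have "?C \<subseteq> F"
  proof (rule ccontr)
    assume "\<not> ?C \<subseteq> F"
    then have "?C \<inter> frontier F \<noteq> {}"
      using connected_Int_frontier[OF conC, of F] FC \<open>F \<noteq> {}\<close> by blast
    then obtain z where z: "z \<in> C" "z \<notin> \<rho> ` V" "z \<in> frontier F" by blast
    have "z \<in> drawing V E \<rho>"
      using frontier_of_components_closed_complement[of "drawing V E \<rho>" F] compact_drawing F z(3)
      by (auto simp: faces_def compact_imp_closed)
    then obtain e where e: "e \<in> E" "z \<in> edge_segment \<rho> e" using z by (auto simp: drawing_def)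
    have "card e = 2" using e simple by (auto simp: simple_graph_def)
    then obtain a b where ab: "e = {a, b}" by (auto simp: card_2_iff)
    have E: "{a, b} \<in> E" "{b, a} \<in> E" using e ab by (auto simp: insert_commute)
    have zo: "z \<in> open_segment (\<rho> a) (\<rho> b)" "z \<in> open_segment (\<rho> b) (\<rho> a)"
      using e ab edgeD[OF E(1)] z by (auto simp: open_segment_def closed_segment_commute)
    obtain r1 where r1: "0 < r1" "ball z r1 \<inter> drawing V E \<rho> \<subseteq> closed_segment (\<rho> a) (\<rho> b)"
        "ball z r1 \<inter> {z. 0 < side (\<rho> a) (\<rho> b) z} \<subseteq> left_face V E \<rho> a b"
      by (rule half_disc[OF E(1) zo(1)])
    obtain r2 where r2: "0 < r2" "ball z r2 \<inter> drawing V E \<rho> \<subseteq> closed_segment (\<rho> b) (\<rho> a)"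
        "ball z r2 \<inter> {z. 0 < side (\<rho> b) (\<rho> a) z} \<subseteq> left_face V E \<rho> b a"
      by (rule half_disc[OF E(2) zo(2)])
    have "z \<in> closure F" using z(3) by (simp add: frontier_def)
    moreover have "z \<in> ball z (min r1 r2)" using r1(1) r2(1) by simp
    ultimately have "F \<inter> ball z (min r1 r2) \<noteq> {}"
      using open_Int_closure_eq_empty[of "ball z (min r1 r2)" F] by blast
    moreover have "open (F \<inter> ball z (min r1 r2))" using open_face[OF F] by auto
    ultimately obtain x where x: "x \<in> F" "x \<in> ball z (min r1 r2)" "side (\<rho> a) (\<rho> b) x \<noteq> 0"
      using open_meets_off_line[of "F \<inter> ball z (min r1 r2)" "\<rho> a" "\<rho> b"] edgeD(4)[OF E(1)] by blast
    have "left_face V E \<rho> a b \<inter> F \<noteq> {} \<or> left_face V E \<rho> b a \<inter> F \<noteq> {}"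
    proof (cases "0 < side (\<rho> a) (\<rho> b) x")
      case True
      then show ?thesis using r1(3) x by auto
    next
      case False
      then have "0 < side (\<rho> b) (\<rho> a) x" using x(3) side_swap[OF edgeD(4)[OF E(1)], of x] by linarith
      then show ?thesis using r2(3) x by auto
    qed
    then have "left_face V E \<rho> a b = F \<or> left_face V E \<rho> b a = F"
      using face_eq[OF left_face(1)[OF E(1)] F] face_eq[OF left_face(1)[OF E(2)] F] by argo
    moreover have "z \<in> closed_segment (\<rho> a) (\<rho> b)" "z \<in> closed_segment (\<rho> b) (\<rho> a)"
      using zo by (auto simp: open_segment_def)
    ultimately have "z \<in> W" unfolding W_def using E by blast
    then show False using z CW by blast
  qed
  then have FC': "F = ?C" using FC by simp
  \<comment> \<open>A vertex inside \<open>C\<close> would carry an edge running through the face.\<close>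
  have "C \<inter> \<rho> ` V = {}"
  proof (rule ccontr)
    assume "C \<inter> \<rho> ` V \<noteq> {}"
    then obtain v where v: "v \<in> V" "\<rho> v \<in> C" by blast
    then obtain w where w: "{v, w} \<in> E" using deg by blast
    have "((\<lambda>t. \<rho> v + of_real t * (\<rho> w - \<rho> v)) \<longlongrightarrow> \<rho> v + of_real 0 * (\<rho> w - \<rho> v)) (at_right (0::real))"
      by (intro tendsto_intros)
    then have "\<forall>\<^sub>F t in at_right (0::real). \<rho> v + of_real t * (\<rho> w - \<rho> v) \<in> C"
      using v \<open>open C\<close> by (intro topological_tendstoD) auto
    moreover have "\<forall>\<^sub>F t in at_right (0::real). t < 1" "\<forall>\<^sub>F t in at_right (0::real). 0 < t" 
      by (auto simp: eventually_at_right_less intro: order_tendstoD[OF tendsto_ident_at])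
    ultimately have "\<forall>\<^sub>F t in at_right (0::real). 0 < t \<and> t < 1 \<and> \<rho> v + of_real t * (\<rho> w - \<rho> v) \<in> C"
      by eventually_elim simp
    then obtain t where t: "0 < t" "t < 1" "\<rho> v + of_real t * (\<rho> w - \<rho> v) \<in> C"
      using eventually_happens'[of "at_right (0::real)"] by force
    define z where "z = \<rho> v + of_real t * (\<rho> w - \<rho> v)"
    have "z = (1 - t) *\<^sub>R \<rho> v + t *\<^sub>R \<rho> w" by (simp add: z_def scaleR_conv_of_real algebra_simps)
    then have zo: "z \<in> open_segment (\<rho> v) (\<rho> w)" using t edgeD(4)[OF w] by (auto simp: in_segment)
    then have zd: "z \<in> drawing V E \<rho>" using edge_in_drawing[OF w] by (auto simp: open_segment_def)
    have "z \<notin> \<rho> ` V"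
    proof
      assume "z \<in> \<rho> ` V"
      then obtain u where u: "u \<in> V" "z = \<rho> u" by blast
      then have "u \<noteq> v" "u \<noteq> w" using zo by (auto simp: open_segment_def)
      then show False using vert[OF u(1) w] zo u edgeD(5)[OF w] by (auto simp: open_segment_def)
    qed
    then have "z \<in> F" using FC' t by (auto simp: z_def)
    then show False using zd \<open>F \<subseteq> - drawing V E \<rho>\<close> by blast
  qed
  then have "F = C" using FC' by blast
  then show ?thesis using C by simp
qed

end

section \<open>Simple closed polygons and their turning number\<close>

lemma sum_periodic:
  fixes g :: "nat \<Rightarrow> 'a::ab_group_add"
  assumes "\<And>k. g (k + n) = g k"
  shows "(\<Sum>k<n. g (m + k)) = (\<Sum>k<n. g k)"
proof (induction m)
  case (Suc m)
  have "(\<Sum>k<n. g (Suc m + k)) + g m = (\<Sum>k<Suc n. g (m + k))"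
    by (simp add: sum.lessThan_Suc_shift del: sum.lessThan_Suc)
  also have "\<dots> = (\<Sum>k<n. g (m + k)) + g m"
    using assms[of m] by (simp add: add.commute)
  finally show ?case using Suc by simp
qed simp

text \<open>Logarithms of a common value differ by multiples of \<open>2 * pi * \<i>\<close>, so a continuous one cannot jump.\<close>

lemma log_constant:
  assumes "continuous_on S h" "connected S" "\<And>x. x \<in> S \<Longrightarrow> exp (h x) = (c::complex)" "x \<in> S" "y \<in> S"
  shows "h x = h y"
proof -
  have "h constant_on S"
  proof (rule continuous_discrete_range_constant[OF assms(2,1)])
    fix x assume x: "x \<in> S"
    have "2 * pi \<le> norm (h y - h x)" if "y \<in> S" "h y \<noteq> h x" for y
    proof -
      have "exp (h y) = exp (h x)" using assms(3) x that by simp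
      then obtain n :: int where n: "h y = h x + (of_int (2 * n) * pi) * \<i>" by (auto simp: exp_eq)
      then have "n \<noteq> 0" using that by auto
      then have "1 \<le> \<bar>real_of_int n\<bar>" by linarith
      moreover have "norm (h y - h x) = 2 * \<bar>real_of_int n\<bar> * pi"
        using n by (simp add: norm_mult)
      ultimately show ?thesis by simp
    qed
    then show "\<exists>e>0. \<forall>y. y \<in> S \<and> h y \<noteq> h x \<longrightarrow> e \<le> norm (h y - h x)"
      by (intro exI[of _ "2 * pi"]) auto
  qed
  then show ?thesis using assms(4,5) by (auto simp: constant_on_def)
qed

text \<open>While a path stays in the slit plane, any continuous logarithm along it changes by as much as the principal
one; the factor \<open>c\<close> allows the plane to be slit along any ray.\<close>

lemma log_change:
  fixes g \<theta> :: "real \<Rightarrow> complex"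
  assumes "a \<le> b" "continuous_on {a..b} g" "continuous_on {a..b} \<theta>"
    "\<And>x. x \<in> {a..b} \<Longrightarrow> exp (\<theta> x) = c * g x" "\<And>x. x \<in> {a..b} \<Longrightarrow> g x \<notin> \<real>\<^sub>\<le>\<^sub>0"
  shows "\<theta> b - \<theta> a = Ln (g b) - Ln (g a)"
proof -
  have cont: "continuous_on {a..b} (\<lambda>x. \<theta> x - Ln (g x))"
    using assms by (intro continuous_intros) auto
  have c: "exp (\<theta> x - Ln (g x)) = c" if "x \<in> {a..b}" for x
  proof -
    have "g x \<noteq> 0" using assms(5)[OF that] by auto
    then show ?thesis using assms(4)[OF that] by (simp add: exp_diff)
  qed
  have "\<theta> b - Ln (g b) = \<theta> a - Ln (g a)"
    by (rule log_constant[OF cont connected_Icc c]) (use assms(1) in auto)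
  then show ?thesis by (simp add: algebra_simps)
qed

lemma Arg_upper:
  assumes "0 < Im z \<or> Im z = 0 \<and> 0 < Re z"
  shows "0 \<le> Arg z" "Arg z < pi"
proof -
  have "0 \<le> Arg z \<and> Arg z < pi"
  proof (cases "0 < Im z")
    case True
    then show ?thesis using Arg_lt_pi[of z] by simp
  next
    case False
    then have "z = of_real (Re z)" "0 < Re z" using assms by (simp_all add: complex_eq_iff)
    then show ?thesis using Arg_of_real[of "Re z"] by simp
  qed
  then show "0 \<le> Arg z" "Arg z < pi" by simp_all
qed

lemma polar_Arg: "z = of_real (norm z) * cis (Arg z)"
  by (metis rcis_cmod_Arg rcis_def)

text \<open>Closed polygons as periodic sequences of vertices, which makes indices beyond one period
meaningful.\<close>

locale closed_polygon =
  fixes P :: "nat \<Rightarrow> complex" and n :: nat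
  assumes n3: "3 \<le> n"
    and period: "\<And>k. P (k + n) = P k"
    and inj_P: "inj_on P {..<n}"
    and sep: "\<And>j k. j < n \<Longrightarrow> k < n \<Longrightarrow> j \<noteq> k \<Longrightarrow>
      closed_segment (P j) (P (Suc j)) \<inter> closed_segment (P k) (P (Suc k)) \<subseteq> {P j, P (Suc j)} \<inter> {P k, P (Suc k)}"
begin

definition d :: "nat \<Rightarrow> complex" where "d k = P (Suc k) - P k"

lemma P_mod: "P (k mod n) = P k"
proof -
  have "P (j + m * n) = P j" for j m
  proof (induction m)
    case (Suc m)
    have "j + Suc m * n = (j + m * n) + n" by simp
    then show ?case using Suc period by metis
  qed simp
  from this[of "k mod n" "k div n"] show ?thesis by (simp add: mult.commute)
qed

lemma P_Suc_mod: "P (Suc (k mod n)) = P (Suc k)"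
  using P_mod[of "Suc (k mod n)"] P_mod[of "Suc k"] by (simp add: mod_Suc_eq)

lemma d_mod: "d (k mod n) = d k"
  by (simp add: d_def P_mod P_Suc_mod)

lemma P_eq_iff: "P j = P k \<longleftrightarrow> j mod n = k mod n"
  using inj_P n3 by (metis P_mod inj_on_eq_iff lessThan_iff mod_less_divisor not_numeral_le_zero neq0_conv)

lemma mod_Suc_ne: "Suc k mod n \<noteq> k mod n"
  using n3 by (simp add: mod_Suc)

lemma d_nz: "d k \<noteq> 0"
  using P_eq_iff[of "Suc k" k] mod_Suc_ne by (simp add: d_def)

lemma edge_point: "P m + y *\<^sub>R d m = (1 - y) *\<^sub>R P m + y *\<^sub>R P (Suc m)"
  by (simp add: d_def algebra_simps)

text \<open>The parametrization that runs through the \<open>k\<close>-th edge during \<open>{k..k + 1}\<close>. Writing it with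
clamped coefficients makes its continuity evident; it covers two periods, because the secants
considered below start in the first and may end in the second.\<close>

definition \<gamma> :: "real \<Rightarrow> complex" where
  "\<gamma> x = P 0 + (\<Sum>k<2 * n. max 0 (min 1 (x - real k)) *\<^sub>R d k)"

lemma \<gamma>_at:
  assumes "m < 2 * n" "0 \<le> y" "y \<le> 1"
  shows "\<gamma> (real m + y) = P m + y *\<^sub>R d m"
proof -
  let ?c = "\<lambda>k. max 0 (min 1 (real m + y - real k)) *\<^sub>R d k"
  have "(\<Sum>k<2 * n. ?c k) = (\<Sum>k<Suc m. ?c k)"
    using assms by (intro sum.mono_neutral_right) auto
  also have "\<dots> = (\<Sum>k<m. d k) + y *\<^sub>R d m"
  proof -
    have "(\<Sum>k<m. ?c k) = (\<Sum>k<m. d k)" using assms by (intro sum.cong) auto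
    then show ?thesis using assms by simp
  qed
  also have "(\<Sum>k<m. d k) = P m - P 0"
    by (simp add: d_def sum_lessThan_telescope)
  finally show ?thesis by (simp add: \<gamma>_def)
qed

lemma \<gamma>_nat: "m < 2 * n \<Longrightarrow> \<gamma> (real m) = P m"
  using \<gamma>_at[of m 0] by simp

lemma continuous_\<gamma>: "continuous_on S \<gamma>"
  unfolding \<gamma>_def by (intro continuous_intros)

lemma floor_split:
  assumes "0 \<le> x" "x < 2 * real n"
  obtains m y where "m < 2 * n" "0 \<le> y" "y < 1" "x = real m + y"
proof
  show "0 \<le> frac x" "frac x < 1" by (simp_all add: frac_lt_1)
  show "x = real (nat \<lfloor>x\<rfloor>) + frac x" using assms by (simp add: frac_def)
  show "nat \<lfloor>x\<rfloor> < 2 * n" using assms by linarith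
qed

text \<open>Two points of different edges can coincide only in a common vertex, which is the starting point
of both because the fractional parts are less than \<open>1\<close>.\<close>

lemma \<gamma>_eq:
  assumes "0 \<le> s" "s < 2 * real n" "0 \<le> t" "t < 2 * real n" "\<gamma> s = \<gamma> t"
  shows "s = t \<or> s = t + n \<or> t = s + n"
proof -
  obtain j y where j: "j < 2 * n" "0 \<le> y" "y < 1" "s = real j + y" using floor_split assms by blast
  obtain k z where k: "k < 2 * n" "0 \<le> z" "z < 1" "t = real k + z" using floor_split assms by blast
  have eq: "P j + y *\<^sub>R d j = P k + z *\<^sub>R d k"
    using assms(5) j k \<gamma>_at[of j y] \<gamma>_at[of k z] by simp
  have on_seg: "P i + x *\<^sub>R d i \<in> closed_segment (P i) (P (Suc i))" if "0 \<le> x" "x < 1" for i x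
    using that less_imp_le[OF that(2)] edge_point[of i x] unfolding closed_segment_def by blast
  have not_end: "P i + x *\<^sub>R d i \<noteq> P (Suc i)" if "x < 1" for i x
  proof
    assume "P i + x *\<^sub>R d i = P (Suc i)"
    then have "x *\<^sub>R d i = 1 *\<^sub>R d i" by (simp add: d_def add.commute eq_diff_eq)
    then show False using that d_nz[of i] unfolding scaleR_cancel_right by simp
  qed
  have mods: "j mod n = k mod n"
  proof (rule ccontr)
    assume ne: "j mod n \<noteq> k mod n"
    have "P j + y *\<^sub>R d j \<in> {P j, P (Suc j)} \<inter> {P k, P (Suc k)}"
      using sep[of "j mod n" "k mod n"] n3 ne on_seg[OF j(2,3), of j] on_seg[OF k(2,3), of k] eq
      by (auto simp: P_mod P_Suc_mod)
    then have "P j + y *\<^sub>R d j = P j" "P k + z *\<^sub>R d k = P k"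
      using not_end[OF j(3), of j] not_end[OF k(3), of k] eq by auto
    then show False using eq ne P_eq_iff by metis
  qed
  then have "P j = P k" "d j = d k" using P_eq_iff d_mod by metis+
  then have "y = z" using eq d_nz[of k] by simp
  have "j div n < 2" "k div n < 2" using j k by (simp_all add: less_mult_imp_div_less)
  then have "j = k \<or> j = k + n \<or> k = j + n"
    using mods div_mult_mod_eq[of j n] div_mult_mod_eq[of k n]
    by (cases "j div n"; cases "k div n") (auto simp: less_Suc_eq numeral_2_eq_2)
  then show ?thesis using j k \<open>y = z\<close> by auto
qed

definition boundary :: "complex set" where
  "boundary = (\<Union>k<n. closed_segment (P k) (P (Suc k)))"

lemma \<gamma>_image: "\<gamma> ` {0..real n} = boundary"
proof
  show "\<gamma> ` {0..real n} \<subseteq> boundary"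
  proof
    fix w assume "w \<in> \<gamma> ` {0..real n}"
    then obtain x :: real where x: "0 \<le> x" "x \<le> real n" "w = \<gamma> x" by auto
    obtain m y where m: "m < 2 * n" "0 \<le> y" "y < 1" "x = real m + y"
      using floor_split[of x] x n3 by auto
    have "w = (1 - y) *\<^sub>R P m + y *\<^sub>R P (Suc m)" using \<gamma>_at[of m y] m x by (simp add: edge_point)
    then have "w \<in> closed_segment (P m) (P (Suc m))" using m by (auto simp: closed_segment_def)
    then have "w \<in> closed_segment (P (m mod n)) (P (Suc (m mod n)))" by (simp add: P_mod P_Suc_mod)
    then show "w \<in> boundary" using n3 by (force simp: boundary_def)
  qed
  show "boundary \<subseteq> \<gamma> ` {0..real n}"
  proof
    fix w assume "w \<in> boundary"
    then obtain k u where k: "k < n" "0 \<le> u" "u \<le> 1" "w = (1 - u) *\<^sub>R P k + u *\<^sub>R P (Suc k)"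
      by (auto simp: boundary_def closed_segment_def)
    then have "w = \<gamma> (real k + u)" using \<gamma>_at[of k u] by (simp add: edge_point)
    then show "w \<in> \<gamma> ` {0..real n}" using k by auto
  qed
qed

lemma Jordan_polygon:
  "inside boundary \<noteq> {}" "connected (inside boundary)" "open (inside boundary)" "bounded (inside boundary)"
  "outside boundary \<noteq> {}" "connected (outside boundary)" "open (outside boundary)" "\<not> bounded (outside boundary)"
  "inside boundary \<inter> outside boundary = {}" "inside boundary \<union> outside boundary = - boundary"
  "frontier (inside boundary) = boundary" "frontier (outside boundary) = boundary"
proof -
  define g where "g x = \<gamma> (real n * x)" for x
  have img: "path_image g = boundary"
  proof -
    have "(\<lambda>x. real n * x) ` {0..1} = {0..real n}"
      using n3 by (auto simp: image_mult_atLeastAtMost)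
    then show ?thesis using \<gamma>_image unfolding path_image_def g_def by (metis image_image)
  qed
  have "simple_path g" unfolding simple_path_def loop_free_def
  proof (intro conjI ballI impI)
    show "path g" unfolding path_def g_def
      by (intro continuous_on_compose2[OF continuous_\<gamma>[of UNIV]] continuous_intros) auto
    fix x y :: real assume xy: "x \<in> {0..1}" "y \<in> {0..1}" "g x = g y"
    have b: "0 \<le> real n * u \<and> real n * u \<le> real n" if "u \<in> {0..1}" for u using that by (auto simp: mult_left_le)
    have "real n * x = real n * y \<or> real n * x = real n * y + n \<or> real n * y = real n * x + n"
      using b[OF xy(1)] b[OF xy(2)] n3 xy(3) by (intro \<gamma>_eq) (auto simp: g_def)
    moreover have "real n * a = real n * b + n \<longleftrightarrow> a = b + 1" for a b
    proof -
      have "real n * b + n = real n * (b + 1)" by (simp add: distrib_left)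
      then show ?thesis using n3 by simp
    qed
    ultimately show "x = y \<or> x = 0 \<and> y = 1 \<or> x = 1 \<and> y = 0" using xy(1,2) n3 by auto
  qed
  moreover have "pathfinish g = pathstart g"
    using \<gamma>_nat[of n] \<gamma>_nat[of 0] period[of 0] n3 by (simp add: pathfinish_def pathstart_def g_def)
  ultimately show
    "inside boundary \<noteq> {}" "connected (inside boundary)" "open (inside boundary)" "bounded (inside boundary)"
    "outside boundary \<noteq> {}" "connected (outside boundary)" "open (outside boundary)" "\<not> bounded (outside boundary)"
    "inside boundary \<inter> outside boundary = {}" "inside boundary \<union> outside boundary = - boundary"
    "frontier (inside boundary) = boundary" "frontier (outside boundary) = boundary"
    using Jordan_inside_outside[of g] img by auto
qed

lemma components_polygon: "components (- boundary) = {inside boundary, outside boundary}"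
proof
  have io: "inside boundary \<in> components (- boundary)" "outside boundary \<in> components (- boundary)"
    using Jordan_polygon by (auto simp: inside_in_components outside_in_components)
  then show "{inside boundary, outside boundary} \<subseteq> components (- boundary)" by simp
  show "components (- boundary) \<subseteq> {inside boundary, outside boundary}"
  proof
    fix C assume C: "C \<in> components (- boundary)"
    then have "C \<noteq> {}" "C \<subseteq> inside boundary \<union> outside boundary"
      using in_components_nonempty[OF C] in_components_subset[OF C] Jordan_polygon(10) by simp_all
    then have "C \<inter> inside boundary \<noteq> {} \<or> C \<inter> outside boundary \<noteq> {}" by blast
    then show "C \<in> {inside boundary, outside boundary}" using io C components_eq by blast
  qed
qed

text \<open>The principal argument is the exterior angle: positive at left turns.\<close>

definition turn :: "nat \<Rightarrow> real" where "turn k = Arg (d (Suc k) / d k)"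

text \<open>If the polygon turned back on itself, two of its edges would overlap near their common vertex.\<close>

lemma no_reversal: "d (Suc k) / d k \<notin> \<real>\<^sub>\<le>\<^sub>0"
proof
  assume "d (Suc k) / d k \<in> \<real>\<^sub>\<le>\<^sub>0"
  then obtain c :: real where c: "c \<le> 0" "d (Suc k) / d k = of_real c" by (auto elim: nonpos_Reals_cases)
  define m where "m = k mod n"
  have m: "m < n" using n3 by (simp add: m_def)
  have dS: "d (Suc m) = d (Suc k)" using d_mod[of "Suc m"] d_mod[of "Suc k"] by (simp add: m_def mod_Suc_eq)
  have dm: "d m = d k" by (simp add: m_def d_mod)
  have deq: "d (Suc m) = of_real c * d m" using c(2) d_nz[of k] dS dm by (simp add: field_simps)
  then have "c < 0" using c(1) d_nz[of "Suc m"] by (cases "c = 0") auto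
  define y where "y = min (1/2) (1 / (2 * - c))"
  have y: "0 < y" "y \<le> 1/2" "y * - c \<le> 1/2" "0 < y * - c"
    using \<open>c < 0\<close> by (auto simp: y_def min_def field_simps)
  have "\<gamma> (real (Suc m) + y) = P (Suc m) + y *\<^sub>R d (Suc m)"
    using m y n3 by (intro \<gamma>_at) auto
  also have "\<dots> = P m + (1 - y * - c) *\<^sub>R d m"
  proof -
    have "y *\<^sub>R d (Suc m) = (y * c) *\<^sub>R d m" using deq by (simp add: scaleR_conv_of_real)
    moreover have "P (Suc m) = P m + d m" by (simp add: d_def)
    ultimately show ?thesis by (simp add: algebra_simps)
  qed
  also have "\<dots> = \<gamma> (real m + (1 - y * - c))"
    using m y n3 by (intro \<gamma>_at[symmetric]) auto
  finally have eq: "\<gamma> (real (Suc m) + y) = \<gamma> (real m + (1 - y * - c))" .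
  have "real (Suc m) + y = real m + (1 - y * - c) \<or> real (Suc m) + y = real m + (1 - y * - c) + n \<or>
      real m + (1 - y * - c) = real (Suc m) + y + n"
    by (rule \<gamma>_eq) (use m y n3 eq in auto)
  then show False using y n3 by auto
qed

lemma affine_not_nonpos:
  fixes q :: complex
  assumes "q \<notin> \<real>\<^sub>\<le>\<^sub>0" "0 \<le> y" "y \<le> (1::real)"
  shows "1 + y *\<^sub>R (q - 1) \<notin> \<real>\<^sub>\<le>\<^sub>0"
proof
  assume "1 + y *\<^sub>R (q - 1) \<in> \<real>\<^sub>\<le>\<^sub>0"
  then have im: "y * Im q = 0" and re: "1 - y + y * Re q \<le> 0" by (auto simp: complex_nonpos_Reals_iff algebra_simps)
  then have "y \<noteq> 0" by auto
  then have "Im q = 0" using im by simp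
  then have "0 < Re q" using assms(1) by (simp add: complex_nonpos_Reals_iff)
  then have "0 < y * Re q" using assms \<open>y \<noteq> 0\<close> by simp
  then show False using re assms(3) by linarith
qed

text \<open>Hopf's Umlaufsatz, proved with secants. The secant from \<open>\<gamma> s\<close> to \<open>\<gamma> (s + \<delta>)\<close> does not
vanish on the box \<open>0 \<le> s \<le> n\<close>, \<open>1 \<le> \<delta> \<le> n - 1\<close>, hence has a continuous logarithm \<open>\<theta>\<close>
there. On the side \<open>\<delta> = 1\<close> its total change is the sum of the turns, since the secant moves
through the cone between consecutive edges. The same change is computed along a different route
that first lengthens the secant from the lowest vertex. There the secant stays in the upper half-plane, so its
angle is known.\<close>

theorem turning_sum:
  assumes low: "\<And>k. 0 < k \<Longrightarrow> k < n \<Longrightarrow> Im (P 0) < Im (P k) \<or> Im (P 0) = Im (P k) \<and> Re (P 0) < Re (P k)"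
    and ccw: "Arg (P 1 - P 0) < Arg (P (n - 1) - P 0)"
  shows "(\<Sum>k<n. turn k) = 2 * pi"
proof -
  define D where "D = {0..real n} \<times> {1..real n - 1}"
  define f where "f = (\<lambda>(s, \<delta>). \<gamma> (s + \<delta>) - \<gamma> s)"
  have "continuous_on D f" unfolding f_def case_prod_unfold
    by (intro continuous_intros continuous_on_compose2[OF continuous_\<gamma>[of UNIV]]) auto
  moreover have "contractible D" unfolding D_def
    by (intro convex_imp_contractible convex_Times) auto
  moreover have "f z \<noteq> 0" if z: "z \<in> D" for z
  proof
    assume f0: "f z = 0"
    obtain s \<delta> where s: "z = (s, \<delta>)" "0 \<le> s" "s \<le> n" "1 \<le> \<delta>" "\<delta> \<le> real n - 1" using z by (auto simp: D_def)
    then have "\<gamma> (s + \<delta>) = \<gamma> s" using f0 by (simp add: f_def)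
    then have "s + \<delta> = s \<or> s + \<delta> = s + n \<or> s = s + \<delta> + n" by (intro \<gamma>_eq) (use s in auto)
    then show False using s by auto
  qed
  ultimately obtain \<theta> where \<theta>: "continuous_on D \<theta>" "\<And>z. z \<in> D \<Longrightarrow> f z = exp (\<theta> z)"
    using continuous_logarithm_on_contractible[of D f] by blast
  have \<theta>_path: "continuous_on T (\<lambda>x. \<theta> (u x))" if "continuous_on T u" "u ` T \<subseteq> D" for T :: "real set" and u
    using that by (intro continuous_on_compose2[OF \<theta>(1)]) auto
  have Pn: "P n = P 0" using period[of 0] by simp
  have dn: "d n = d 0" using d_mod[of n] by simp
  \<comment> \<open>On the side \<open>\<delta> = 1\<close>, the secant at \<open>s = k + x\<close> is the point dividing the way from
     \<open>d k\<close> to \<open>d (Suc k)\<close> in the ratio \<open>x : 1 - x\<close>.\<close>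
  have edge: "\<theta> (real (Suc k), 1) - \<theta> (real k, 1) = Ln (d (Suc k) / d k)" if k: "k < n" for k
  proof -
    let ?q = "d (Suc k) / d k"
    have "\<theta> (real k + 1, 1) - \<theta> (real k + 0, 1) = Ln (1 + 1 *\<^sub>R (?q - 1)) - Ln (1 + 0 *\<^sub>R (?q - 1))"
    proof (rule log_change[where c = "d k"])
      show "continuous_on {0..1} (\<lambda>x. \<theta> (real k + x, 1))"
        by (intro \<theta>_path continuous_intros) (use k n3 in \<open>auto simp: D_def\<close>)
      show "continuous_on {0..1} (\<lambda>x. 1 + x *\<^sub>R (?q - 1))" by (intro continuous_intros)
      fix x :: real assume x: "x \<in> {0..1}"
      have "exp (\<theta> (real k + x, 1)) = f (real k + x, 1)"
        using \<theta>(2)[of "(real k + x, 1)"] x k n3 by (auto simp: D_def)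
      also have "\<dots> = \<gamma> (real (Suc k) + x) - \<gamma> (real k + x)" by (simp add: f_def algebra_simps)
      also have "\<dots> = P (Suc k) + x *\<^sub>R d (Suc k) - (P k + x *\<^sub>R d k)"
        using x k n3 by (subst (1 2) \<gamma>_at) auto
      also have "\<dots> = d k * (1 + x *\<^sub>R (?q - 1))"
      proof -
        have "P (Suc k) = P k + d k" by (simp add: d_def)
        moreover have "d k * (x *\<^sub>R ?q) = x *\<^sub>R d (Suc k)" using d_nz[of k] by simp
        ultimately show ?thesis by (simp add: scaleR_conv_of_real algebra_simps)
      qed
      finally show "exp (\<theta> (real k + x, 1)) = d k * (1 + x *\<^sub>R (?q - 1))" .
      show "1 + x *\<^sub>R (?q - 1) \<notin> \<real>\<^sub>\<le>\<^sub>0" using affine_not_nonpos[OF no_reversal] x by auto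
    qed simp
    then show ?thesis by (simp add: add.commute)
  qed
  \<comment> \<open>Along \<open>s = 0\<close> the secant starts at the lowest vertex and stays in a half-plane.\<close>
  define H where "H = {z. Im (P 0) < Im z \<or> Im (P 0) = Im z \<and> Re (P 0) < Re z}"
  have convH: "convex H"
    unfolding convex_alt
  proof (intro ballI allI impI)
    fix x y :: complex and u :: real assume h: "x \<in> H" "y \<in> H" "0 \<le> u \<and> u \<le> 1"
    show "(1 - u) *\<^sub>R x + u *\<^sub>R y \<in> H"
    proof (cases "u = 0 \<or> u = 1")
      case False
      define a b where "a = x - P 0" and "b = y - P 0"
      have ab: "0 < Im a \<or> Im a = 0 \<and> 0 < Re a" "0 < Im b \<or> Im b = 0 \<and> 0 < Re b"
        using h by (auto simp: H_def a_def b_def)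
      have u: "0 < u" "0 < 1 - u" using h False by auto
      have "0 < (1 - u) * Im a + u * Im b \<or> (1 - u) * Im a + u * Im b = 0 \<and> 0 < (1 - u) * Re a + u * Re b"
        using ab u by (auto intro: add_pos_pos)
      then show ?thesis by (auto simp: H_def a_def b_def algebra_simps)
    qed (use h in auto)
  qed
  have \<gamma>H: "\<gamma> x \<in> H" if x: "1 \<le> x" "x \<le> real n - 1" for x
  proof -
    obtain m y where m: "m < 2 * n" "0 \<le> y" "y < 1" "x = real m + y" using floor_split[of x] x by auto
    have H: "P k \<in> H" if "0 < k" "k < n" for k using low[OF that] by (auto simp: H_def)
    show ?thesis
    proof (cases "y = 0")
      case True
      then show ?thesis using m x H[of m] \<gamma>_nat[of m] by auto
    next
      case False
      then have "P m \<in> H" "P (Suc m) \<in> H" using m x by (auto intro!: H)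
      then have "(1 - y) *\<^sub>R P m + y *\<^sub>R P (Suc m) \<in> H" using convH m unfolding convex_alt by auto
      then show ?thesis using \<gamma>_at[of m y] m by (simp add: edge_point)
    qed
  qed
  have base: "\<theta> (0, real n - 1) - \<theta> (0, 1) = Ln (P (n - 1) - P 0) - Ln (P 1 - P 0)"
  proof -
    have "\<theta> (0, real n - 1) - \<theta> (0, 1) = Ln (\<gamma> (real n - 1) - P 0) - Ln (\<gamma> 1 - P 0)"
    proof (rule log_change[where c = 1])
      show "continuous_on {1..real n - 1} (\<lambda>x. \<theta> (0, x))"
        by (intro \<theta>_path continuous_intros) (auto simp: D_def)
      show "continuous_on {1..real n - 1} (\<lambda>x. \<gamma> x - P 0)" by (intro continuous_intros continuous_\<gamma>)
      fix x assume x: "x \<in> {1..real n - 1}"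
      show "exp (\<theta> (0, x)) = 1 * (\<gamma> x - P 0)"
        using \<theta>(2)[of "(0, x)"] x \<gamma>_nat[of 0] n3 by (auto simp: D_def f_def)
      show "\<gamma> x - P 0 \<notin> \<real>\<^sub>\<le>\<^sub>0" using \<gamma>H[of x] x by (auto simp: H_def complex_nonpos_Reals_iff)
    qed (use n3 in auto)
    moreover have "\<gamma> (real n - 1) = P (n - 1)" "\<gamma> 1 = P 1"
      using \<gamma>_nat[of "n - 1"] \<gamma>_nat[of 1] n3 by (auto simp: of_nat_diff)
    ultimately show ?thesis by simp
  qed
  have far: "\<theta> (1, real n - 1) - \<theta> (0, real n - 1) = Ln (d n / d (n - 1))"
  proof -
    let ?q = "d n / d (n - 1)"
    have Sn: "Suc (n - 1) = n" using n3 by simp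
    have q: "?q \<notin> \<real>\<^sub>\<le>\<^sub>0" using no_reversal[of "n - 1"] Sn by simp
    have "\<theta> (1, real n - 1) - \<theta> (0, real n - 1) = Ln (1 + 1 *\<^sub>R (?q - 1)) - Ln (1 + 0 *\<^sub>R (?q - 1))"
    proof (rule log_change[where c = "- d (n - 1)"])
      show "continuous_on {0..1} (\<lambda>x. \<theta> (x, real n - 1))"
        by (intro \<theta>_path continuous_intros) (use n3 in \<open>auto simp: D_def\<close>)
      show "continuous_on {0..1} (\<lambda>x. 1 + x *\<^sub>R (?q - 1))" by (intro continuous_intros)
      fix x :: real assume x: "x \<in> {0..1}"
      have "exp (\<theta> (x, real n - 1)) = f (x, real n - 1)"
        using \<theta>(2)[of "(x, real n - 1)"] x n3 by (auto simp: D_def)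
      also have "\<dots> = \<gamma> (real (n - 1) + x) - \<gamma> (real 0 + x)" using n3 by (simp add: f_def of_nat_diff algebra_simps)
      also have "\<dots> = P (n - 1) + x *\<^sub>R d (n - 1) - (P 0 + x *\<^sub>R d 0)"
        using x n3 by (subst (1 2) \<gamma>_at) auto
      also have "\<dots> = - d (n - 1) * (1 + x *\<^sub>R (?q - 1))"
      proof -
        have "P (n - 1) - P 0 = - d (n - 1)" using Sn Pn by (simp add: d_def)
        moreover have "d (n - 1) * (x *\<^sub>R ?q) = x *\<^sub>R d 0" using d_nz[of "n - 1"] dn by simp
        ultimately show ?thesis by (simp add: scaleR_conv_of_real algebra_simps)
      qed
      finally show "exp (\<theta> (x, real n - 1)) = - d (n - 1) * (1 + x *\<^sub>R (?q - 1))" .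
      show "1 + x *\<^sub>R (?q - 1) \<notin> \<real>\<^sub>\<le>\<^sub>0" using affine_not_nonpos[OF q] x by auto
    qed simp
    then show ?thesis by simp
  qed
  \<comment> \<open>Swapping the two ends of a secant negates it, so both halves of the way contribute equally.\<close>
  have halves: "\<theta> (real n, 1) - \<theta> (1, real n - 1) = \<theta> (1, real n - 1) - \<theta> (0, 1)"
  proof -
    define p where "p u = (u, 1 + u * (real n - 2))" for u :: real
    define p' where "p' u = (1 + u * (real n - 1), real n - 1 - u * (real n - 2))" for u :: real
    have D: "p u \<in> D" "p' u \<in> D" if "u \<in> {0..1}" for u
    proof -
      define a b where "a = u * (real n - 2)" and "b = u * (real n - 1)"
      have "0 \<le> a" "a \<le> real n - 2" "0 \<le> b" "b \<le> real n - 1"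
        using that n3 mult_right_mono[of u 1 "real n - 2"] mult_right_mono[of u 1 "real n - 1"]
        by (simp_all add: a_def b_def)
      moreover have "p u = (u, 1 + a)" "p' u = (1 + b, real n - 1 - a)" by (simp_all add: p_def p'_def a_def b_def)
      ultimately show "p u \<in> D" "p' u \<in> D" using that n3 by (simp_all add: D_def)
    qed
    have "\<theta> (p' 1) - \<theta> (p 1) = \<theta> (p' 0) - \<theta> (p 0)"
    proof (rule log_constant[where h = "\<lambda>u. \<theta> (p' u) - \<theta> (p u)" and S = "{0..1}" and c = "-1"])
      have "continuous_on {0..1} p" "continuous_on {0..1} p'"
        unfolding p_def p'_def by (intro continuous_intros)+
      then show "continuous_on {0..1} (\<lambda>u. \<theta> (p' u) - \<theta> (p u))"
        using D by (intro continuous_intros \<theta>_path) auto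
      fix u :: real assume u: "u \<in> {0..1}"
      have "f (p' u) = \<gamma> (u + real n) - \<gamma> (1 + u * (real n - 1))"
        by (simp add: f_def p'_def algebra_simps)
      also have "\<gamma> (u + real n) = \<gamma> u"
        using \<gamma>_at[of n u] \<gamma>_at[of 0 u] u n3 Pn dn by (simp add: add.commute)
      finally have "f (p' u) = - f (p u)" by (simp add: f_def p_def algebra_simps)
      then have "exp (\<theta> (p' u)) = - exp (\<theta> (p u))" using \<theta>(2) D[OF u] by metis
      then show "exp (\<theta> (p' u) - \<theta> (p u)) = - 1" by (simp add: exp_diff)
    qed auto
    then show ?thesis using n3 by (simp add: p_def p'_def)
  qed
  have "(\<Sum>k<n. Ln (d (Suc k) / d k)) = \<theta> (real n, 1) - \<theta> (0, 1)"
    using sum_lessThan_telescope[of "\<lambda>k. \<theta> (real k, 1)" n] edge by simp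
  also have "\<dots> = 2 * (Ln (P (n - 1) - P 0) - Ln (P 1 - P 0) + Ln (d n / d (n - 1)))"
  proof -
    have "\<theta> (real n, 1) - \<theta> (0, 1) = 2 * (\<theta> (1, real n - 1) - \<theta> (0, 1))"
      using halves by (simp add: diff_eq_eq)
    also have "\<theta> (1, real n - 1) - \<theta> (0, 1) =
        (\<theta> (0, real n - 1) - \<theta> (0, 1)) + (\<theta> (1, real n - 1) - \<theta> (0, real n - 1))" by simp
    finally show ?thesis unfolding base far .
  qed
  finally have sum: "(\<Sum>k<n. turn k) = 2 * (Arg (P (n - 1) - P 0) - Arg (P 1 - P 0) + Arg (d n / d (n - 1)))"
    using d_nz P_eq_iff[of "n - 1" 0] P_eq_iff[of 1 0] n3
    by (simp add: turn_def Arg_eq_Im_Ln flip: Im_sum)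
  \<comment> \<open>The interior angle at the lowest vertex; the turn there is the remaining \<open>pi - \<alpha>\<close>.\<close>
  define \<alpha> where "\<alpha> = Arg (P (n - 1) - P 0) - Arg (P 1 - P 0)"
  have up: "0 \<le> Arg (P k - P 0) \<and> Arg (P k - P 0) < pi" if k: "0 < k" "k < n" for k
    using low[OF k] Arg_upper[of "P k - P 0"] by auto
  have \<alpha>: "0 < \<alpha>" "\<alpha> < pi" using ccw up[of 1] up[of "n - 1"] n3 by (auto simp: \<alpha>_def)
  have "Arg (d n / d (n - 1)) = pi - \<alpha>"
  proof (rule Arg_unique')
    let ?a = "P 1 - P 0" and ?b = "P (n - 1) - P 0"
    have a: "?a = of_real (norm ?a) * cis (Arg ?a)" and b: "?b = of_real (norm ?b) * cis (Arg ?b)"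
      by (rule polar_Arg)+
    have nz: "?a \<noteq> 0" "?b \<noteq> 0" using P_eq_iff[of "n - 1" 0] P_eq_iff[of 1 0] n3 by auto
    have "d n / d (n - 1) = - (?a / ?b)"
      using Pn dn n3 by (simp add: d_def) (metis minus_diff_eq minus_divide_right)
    also have "\<dots> = - (of_real (norm ?a / norm ?b) * cis (- \<alpha>))"
      by (subst a, subst b) (simp add: \<alpha>_def flip: cis_divide)
    also have "\<dots> = of_real (norm ?a / norm ?b) * cis (pi - \<alpha>)"
      by (simp add: complex_eq_iff)
    finally show "d n / d (n - 1) = rcis (norm ?a / norm ?b) (pi - \<alpha>)" by (simp add: rcis_def)
    show "0 < norm ?a / norm ?b" using nz by simp
  qed (use \<alpha> in auto)
  then show ?thesis using sum by (simp add: \<alpha>_def)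
qed

lemma interior_angle_turn: "ccw_angle (d (Suc k)) (- d k) = pi - turn k"
proof -
  let ?q = "d (Suc k) / d k"
  have q0: "?q \<noteq> 0" using d_nz by simp
  have "?q = of_real (norm ?q) * cis (turn k)" by (metis rcis_cmod_Arg rcis_def turn_def)
  then have dS: "d (Suc k) = of_real (norm ?q) * cis (turn k) * d k" using d_nz[of k] by (simp add: divide_eq_eq)
  have "of_real (1 / norm ?q) * cis (pi - turn k) * (of_real (norm ?q) * cis (turn k) * d k) =
      (of_real (1 / norm ?q) * of_real (norm ?q)) * (cis (pi - turn k) * cis (turn k)) * d k"
    by (simp only: mult_ac)
  also have "\<dots> = - d k" using d_nz by (simp add: cis_mult)
  finally have eq: "- d k = of_real (1 / norm ?q) * cis (pi - turn k) * d (Suc k)" using dS by simp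
  have "turn k \<noteq> pi"
    using no_reversal[of k] Arg_eq_pi[of ?q] by (auto simp: turn_def complex_nonpos_Reals_iff)
  then have "- pi < turn k" "turn k < pi"
    using mpi_less_Arg[of ?q] Arg_le_pi[of ?q] by (auto simp: turn_def)
  then show ?thesis
    using eq q0 d_nz by (intro ccw_angle_unique[of _ "1 / norm ?q"]) auto
qed

text \<open>The direction angles of the edges increase from \<open>0\<close> to \<open>2 * pi\<close> on the way around. So,
  measured from the line through the first edge, the polygon first rises and then falls back to
  \<open>0\<close>.\<close>

lemma left_of_first_edge:
  assumes pos: "\<And>k. 0 < turn k" and total: "(\<Sum>k<n. turn k) = 2 * pi" and j: "j < n"
  shows "0 \<le> side (P 0) (P 1) (P j)"
proof -
  define T where "T k = (\<Sum>i<k. turn i)" for k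
  have T_mono: "T i \<le> T k" if "i \<le> k" for i k
    unfolding T_def using that pos by (intro sum_mono2) (auto intro: less_imp_le)
  have T_bound: "0 \<le> T k" "T k < 2 * pi" if "k < n" for k
  proof -
    show "0 \<le> T k" using T_mono[of 0 k] by (simp add: T_def)
    have "T k < T (Suc k)" using pos[of k] by (simp add: T_def)
    also have "\<dots> \<le> T n" using that by (intro T_mono) auto
    finally show "T k < 2 * pi" using total by (simp add: T_def)
  qed
  have polar: "\<exists>r>0. d k / d 0 = of_real r * cis (T k)" for k
  proof (induction k)
    case 0
    show ?case using d_nz[of 0] by (intro exI[of _ 1]) (simp add: T_def)
  next
    case (Suc k)
    then obtain r where r: "0 < r" "d k / d 0 = of_real r * cis (T k)" by blast
    let ?q = "d (Suc k) / d k"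
    have "?q = of_real (norm ?q) * cis (turn k)" by (metis rcis_cmod_Arg rcis_def turn_def)
    moreover have "d (Suc k) / d 0 = ?q * (d k / d 0)" using d_nz[of k] by simp
    ultimately have "d (Suc k) / d 0 = of_real (norm ?q * r) * (cis (turn k) * cis (T k))"
      using r(2) by (metis (no_types, lifting) mult.assoc mult.commute of_real_mult)
    then show ?case using r(1) d_nz
      by (intro exI[of _ "norm ?q * r"]) (simp add: cis_mult T_def add.commute)
  qed
  define y where "y k = Im (d k / d 0)" for k
  have y: "T k \<le> pi \<Longrightarrow> 0 \<le> y k" "pi \<le> T k \<Longrightarrow> y k \<le> 0" if k: "k < n" for k
  proof -
    obtain r where r: "0 < r" "d k / d 0 = of_real r * cis (T k)" using polar by blast
    then have "y k = r * sin (T k)" by (simp add: y_def)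
    then show "T k \<le> pi \<Longrightarrow> 0 \<le> y k" "pi \<le> T k \<Longrightarrow> y k \<le> 0"
      using r(1) T_bound[OF k] sin_ge_zero[of "T k"] sin_ge_zero[of "T k - pi"]
      by (auto simp: mult_le_0_iff zero_le_mult_iff)
  qed
  have height: "side (P 0) (P 1) (P k) = (\<Sum>i<k. y i)" for k
  proof -
    have "P k - P 0 = (\<Sum>i<k. d i)" by (simp add: d_def sum_lessThan_telescope)
    then show ?thesis by (simp add: side_def y_def sum_divide_distrib d_def[of 0])
  qed
  show ?thesis
  proof (cases "\<forall>i<j. T i \<le> pi")
    case True
    then show ?thesis unfolding height using y j by (intro sum_nonneg) auto
  next
    case False
    then obtain i where i: "i < j" "pi < T i" by force
    have "(\<Sum>k<n. y k) = (\<Sum>k<j. y k) + (\<Sum>k\<in>{j..<n}. y k)"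
      using j by (simp add: lessThan_atLeast0 sum.atLeastLessThan_concat)
    moreover have "(\<Sum>k<n. y k) = 0" using height[of n] period[of 0] by (simp add: side_def)
    moreover have "(\<Sum>k\<in>{j..<n}. y k) \<le> 0"
    proof (rule sum_nonpos)
      fix k assume "k \<in> {j..<n}"
      then show "y k \<le> 0" using y(2)[of k] T_mono[of i k] i by auto
    qed
    ultimately show ?thesis unfolding height by linarith
  qed
qed

end

section \<open>Polygons given by lists\<close>

definition poly_edges :: "complex list \<Rightarrow> complex set set" where
  "poly_edges ps = {{ps ! i, cyc_succ ps i} | i. i < length ps}"

text \<open>Seen from this lowest point, ties being broken to the left, all other points lie in a half-plane
that is open apart from one of its two boundary rays.\<close>

lemma lex_min:
  fixes S :: "complex set"
  assumes "finite S" "S \<noteq> {}"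
  obtains z where "z \<in> S" "\<And>w. w \<in> S \<Longrightarrow> w \<noteq> z \<Longrightarrow> Im z < Im w \<or> Im z = Im w \<and> Re z < Re w"
proof -
  define S1 where "S1 = {z \<in> S. Im z = Min (Im ` S)}"
  have "Min (Im ` S) \<in> Im ` S" using assms by (intro Min_in) auto
  then obtain z0 where "z0 \<in> S" "Im z0 = Min (Im ` S)" by fastforce
  then have S1: "finite S1" "S1 \<noteq> {}" using assms by (auto simp: S1_def)
  have "Min (Re ` S1) \<in> Re ` S1" using S1 by (intro Min_in) auto
  then obtain z where z: "z \<in> S1" "Re z = Min (Re ` S1)" by auto
  show ?thesis
  proof (rule that)
    show "z \<in> S" using z by (simp add: S1_def)
    fix w assume w: "w \<in> S" "w \<noteq> z"
    have "Im z \<le> Im w" using z w assms by (simp add: S1_def)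
    moreover have "Re z \<le> Re w" if "Im z = Im w" using that z w S1 by (auto simp: S1_def)
    ultimately show "Im z < Im w \<or> Im z = Im w \<and> Re z < Re w"
      using w(2) by (auto simp: complex_eq_iff less_le)
  qed
qed

lemma Suc_pred_mod: "j < n \<Longrightarrow> Suc ((j + n - 1) mod n) mod n = (j::nat)"
  by (simp add: mod_Suc_eq Suc_diff_le)

lemma pred_Suc_mod: "i < n \<Longrightarrow> (Suc i mod n + n - 1) mod n = (i::nat)"
  by (auto simp: mod_Suc)

locale polygon =
  fixes ps :: "complex list"
  assumes sp: "simple_polygon ps"
begin

abbreviation n :: nat where "n \<equiv> length ps"

lemma n3: "3 \<le> n" and dist: "distinct ps"
  using sp by (auto simp: simple_polygon_def)

lemma sep: "i < n \<Longrightarrow> j < n \<Longrightarrow> i \<noteq> j \<Longrightarrow>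
  closed_segment (ps ! i) (cyc_succ ps i) \<inter> closed_segment (ps ! j) (cyc_succ ps j)
    \<subseteq> {ps ! i, cyc_succ ps i} \<inter> {ps ! j, cyc_succ ps j}"
  using sp by (auto simp: simple_polygon_def)

lemma nth_inj: "i < n \<Longrightarrow> j < n \<Longrightarrow> ps ! i = ps ! j \<longleftrightarrow> i = j"
  using dist by (simp add: nth_eq_iff_index_eq)

lemma mod_lt: "k mod n < n"
  using n3 by (intro mod_less_divisor) auto

lemma succ_mem: "cyc_succ ps i \<in> set ps"
  unfolding cyc_succ_def using mod_lt by simp

lemma succ_ne: "i < n \<Longrightarrow> cyc_succ ps i \<noteq> ps ! i"
  unfolding cyc_succ_def using n3 by (subst nth_inj) (auto simp: mod_Suc)

lemma succ_ne_pred: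
  assumes i: "i < n"
  shows "cyc_succ ps i \<noteq> cyc_pred ps i"
proof -
  have pred: "(i + n - 1) mod n = (if i = 0 then n - 1 else i - 1)"
  proof (cases "i = 0")
    case False
    then have "i + n - 1 = (i - 1) + n" by simp
    then show ?thesis using i False by (metis mod_add_self2 mod_less less_imp_diff_less)
  qed (use n3 in auto)
  have "Suc i mod n = (if Suc i = n then 0 else Suc i)" using i by auto
  then have "Suc i mod n \<noteq> (i + n - 1) mod n" unfolding pred using n3 i by (auto split: if_splits)
  then show ?thesis unfolding cyc_succ_def cyc_pred_def by (simp add: nth_inj mod_lt)
qed

text \<open>This makes the facts about faces and sides available for polygons; the vertices are their own
positions.\<close>

sublocale plane_drawing "set ps" "poly_edges ps" "\<lambda>x. x"
proof
  have seg: "edge_segment (\<lambda>x. x) {a, b} = closed_segment a b" for a b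
    by (simp add: edge_segment_def segment_convex_hull)
  show "simple_graph (set ps) (poly_edges ps)"
    unfolding simple_graph_def
  proof (intro conjI ballI)
    fix e assume "e \<in> poly_edges ps"
    then obtain i where i: "i < n" "e = {ps ! i, cyc_succ ps i}" by (auto simp: poly_edges_def)
    then show "e \<subseteq> set ps" "card e = 2" using succ_mem[of i] succ_ne[of i] by auto
  qed simp
  show "edge_segment (\<lambda>x. x) e \<inter> edge_segment (\<lambda>x. x) f \<subseteq> (\<lambda>x. x) ` (e \<inter> f)"
    if ef: "e \<in> poly_edges ps" "f \<in> poly_edges ps" "e \<noteq> f" for e f
  proof -
    obtain i where i: "i < n" "e = {ps ! i, cyc_succ ps i}" using ef(1) by (auto simp: poly_edges_def)
    obtain j where j: "j < n" "f = {ps ! j, cyc_succ ps j}" using ef(2) by (auto simp: poly_edges_def)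
    have "i \<noteq> j" using i j ef(3) by auto
    then show ?thesis using sep[OF i(1) j(1)] i j by (simp add: seg)
  qed
  show "v \<notin> edge_segment (\<lambda>x. x) e" if v: "v \<in> set ps" and e: "e \<in> poly_edges ps" and "v \<notin> e" for v e
  proof
    assume a: "v \<in> edge_segment (\<lambda>x. x) e"
    obtain j where j: "j < n" "v = ps ! j" using v by (metis in_set_conv_nth)
    obtain i where i: "i < n" "e = {ps ! i, cyc_succ ps i}" using e by (auto simp: poly_edges_def)
    have "i \<noteq> j" using i j \<open>v \<notin> e\<close> by auto
    then have "v \<in> e" using sep[OF i(1) j(1)] a i j by (auto simp: seg)
    then show False using \<open>v \<notin> e\<close> by simp
  qed
qed simp

lemma drawing_eq: "drawing (set ps) (poly_edges ps) (\<lambda>x. x) = polygon_boundary ps"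
proof -
  have "(\<Union>e\<in>poly_edges ps. edge_segment (\<lambda>x. x) e) = polygon_boundary ps"
    unfolding poly_edges_def polygon_boundary_def
    by (auto simp: edge_segment_def segment_convex_hull; blast)
  moreover have "set ps \<subseteq> polygon_boundary ps"
  proof
    fix v assume "v \<in> set ps"
    then obtain j where "j < n" "v = ps ! j" by (metis in_set_conv_nth)
    then show "v \<in> polygon_boundary ps" by (auto simp: polygon_boundary_def)
  qed
  ultimately show ?thesis by (auto simp: drawing_def)
qed

lemma edge: "i < n \<Longrightarrow> {ps ! i, cyc_succ ps i} \<in> poly_edges ps" "i < n \<Longrightarrow> {cyc_succ ps i, ps ! i} \<in> poly_edges ps"
  by (auto simp: poly_edges_def insert_commute)

lemma succ_pred: "i < n \<Longrightarrow> cyc_succ ps ((i + n - 1) mod n) = ps ! i"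
  unfolding cyc_succ_def by (subst Suc_pred_mod) auto

lemma nbrs:
  assumes j: "j < n"
  shows "{u. {ps ! j, u} \<in> poly_edges ps} = {cyc_succ ps j, cyc_pred ps j}"
proof (intro subset_antisym subsetI)
  fix u assume "u \<in> {u. {ps ! j, u} \<in> poly_edges ps}"
  then obtain i where i: "i < n" "{ps ! j, u} = {ps ! i, cyc_succ ps i}" by (auto simp: poly_edges_def)
  then consider "ps ! j = ps ! i" "u = cyc_succ ps i" | "ps ! j = cyc_succ ps i" "u = ps ! i"
    by (auto simp: doubleton_eq_iff)
  then show "u \<in> {cyc_succ ps j, cyc_pred ps j}"
  proof cases
    case 1
    then show ?thesis using nth_inj i j by auto
  next
    case 2
    then have "j = Suc i mod n" using nth_inj[OF j mod_lt, of "Suc i"] by (simp add: cyc_succ_def)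
    then have "cyc_pred ps j = ps ! i" unfolding cyc_pred_def using pred_Suc_mod[OF i(1)] by simp
    then show ?thesis using 2 by simp
  qed
next
  fix u assume "u \<in> {cyc_succ ps j, cyc_pred ps j}"
  moreover have "{ps ! j, cyc_pred ps j} \<in> poly_edges ps"
    using edge(2)[OF mod_lt, of "j + n - 1"] succ_pred[OF j] by (simp add: cyc_pred_def)
  ultimately show "u \<in> {u. {ps ! j, u} \<in> poly_edges ps}" using edge(1)[OF j] by auto
qed

lemma next_eq:
  assumes j: "j < n"
  shows "ccw_next (poly_edges ps) (\<lambda>x. x) (ps ! j) (cyc_succ ps j) = cyc_pred ps j"
    "ccw_next (poly_edges ps) (\<lambda>x. x) (ps ! j) (cyc_pred ps j) = cyc_succ ps j"
proof -
  let ?N = "{u. {ps ! j, u} \<in> poly_edges ps}"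
  have "?N \<noteq> {}" using nbrs[OF j] by simp
  then obtain ws where ws: "distinct ws" "set ws = ?N"
    "\<forall>i<length ws. ccw_next (poly_edges ps) (\<lambda>x. x) (ps ! j) (ws ! i) = cyc_succ ws i"
    by (rule rotation_list)
  have "length ws = 2"
    using distinct_card[OF ws(1)] ws(2) nbrs[OF j] succ_ne_pred[OF j] by simp
  then obtain a b where ab: "ws = [a, b]" by (auto simp: numeral_2_eq_2 length_Suc_conv)
  have "ccw_next (poly_edges ps) (\<lambda>x. x) (ps ! j) a = b" "ccw_next (poly_edges ps) (\<lambda>x. x) (ps ! j) b = a"
    using ws(3)[rule_format, of 0] ws(3)[rule_format, of 1] ab by (simp_all add: cyc_succ_def)
  moreover have "{a, b} = {cyc_succ ps j, cyc_pred ps j}" using ws(2) nbrs[OF j] ab by simp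
  ultimately show "ccw_next (poly_edges ps) (\<lambda>x. x) (ps ! j) (cyc_succ ps j) = cyc_pred ps j"
    "ccw_next (poly_edges ps) (\<lambda>x. x) (ps ! j) (cyc_pred ps j) = cyc_succ ps j"
    using ab ws(1) by (auto simp: doubleton_eq_iff)
qed

lemma vertex_angle_eq:
  "j < n \<Longrightarrow> vertex_angle (poly_edges ps) (\<lambda>x. x) (ps ! j) (cyc_succ ps j) = interior_angle ps j"
  by (simp add: vertex_angle_def interior_angle_def next_eq)

text \<open>The choice of \<open>m\<close> makes the lowest vertex, or any given edge, come first in the facts about
\<open>closed_polygon\<close>.\<close>

definition seq :: "nat \<Rightarrow> nat \<Rightarrow> complex" where "seq m k = ps ! ((m + k) mod n)"

lemma seq_succ: "cyc_succ ps ((m + k) mod n) = seq m (Suc k)"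
  by (simp add: cyc_succ_def seq_def mod_Suc_eq)

lemma seq_pred: "cyc_pred ps ((m + Suc k) mod n) = seq m k"
proof -
  have "(m + Suc k) mod n = Suc ((m + k) mod n) mod n" by (simp add: mod_Suc_eq)
  moreover have "(m + k) mod n < n" by (rule mod_lt)
  ultimately show ?thesis using pred_Suc_mod[of "(m + k) mod n" n] by (simp add: cyc_pred_def seq_def)
qed

lemma closed_polygon: "closed_polygon (seq m) n"
proof
  show "3 \<le> n" by (rule n3)
  show "seq m (k + n) = seq m k" for k by (simp add: seq_def flip: add.assoc)
  have lt: "(m + k) mod n < n" for k by (rule mod_lt)
  have inj: "j = k" if "j < n" "k < n" "(m + j) mod n = (m + k) mod n" for j k
  proof -
    have "j = k" if "j \<le> k" "k < n" "(m + k) mod n = (m + j) mod n" for j k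
    proof -
      have "n dvd (m + k) - (m + j)" using that mod_eq_dvd_iff_nat[of "m + j" "m + k" n] by simp
      then have "n dvd k - j" by simp
      then show ?thesis using that by (metis diff_is_0_eq dvd_imp_le le_antisym less_imp_diff_less not_less zero_less_iff_neq_zero)
    qed
    then show ?thesis using that by (metis nat_le_linear)
  qed
  then show "inj_on (seq m) {..<n}"
    using nth_inj[OF lt lt] by (intro inj_onI) (simp add: seq_def)
  show "closed_segment (seq m j) (seq m (Suc j)) \<inter> closed_segment (seq m k) (seq m (Suc k))
       \<subseteq> {seq m j, seq m (Suc j)} \<inter> {seq m k, seq m (Suc k)}"
    if "j < n" "k < n" "j \<noteq> k" for j k
  proof -
    have "(m + j) mod n \<noteq> (m + k) mod n" using inj that by blast
    then show ?thesis using sep[OF lt[of j] lt[of k]] unfolding seq_succ by (simp add: seq_def)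
  qed
qed

lemma boundary_eq: "closed_polygon.boundary (seq 0) n = polygon_boundary ps"
proof -
  interpret cp: closed_polygon "seq 0" n by (rule closed_polygon)
  show ?thesis unfolding cp.boundary_def polygon_boundary_def
    by (intro SUP_cong refl) (simp add: seq_def cyc_succ_def)
qed

lemmas Jordan = closed_polygon.Jordan_polygon[OF closed_polygon[of 0], unfolded boundary_eq, folded polygon_interior_def]
lemmas components_eq = closed_polygon.components_polygon[OF closed_polygon[of 0], unfolded boundary_eq, folded polygon_interior_def]

lemma faces_eq: "faces (set ps) (poly_edges ps) (\<lambda>x. x) = {polygon_interior ps, outside (polygon_boundary ps)}"
  by (simp add: faces_def drawing_eq components_eq)

text \<open>The midpoint of an edge lies in the frontier of the inside and in that of the outside. A small disc
around it consists of two half-discs and a piece of the edge, so if both half-discs were in one face, inside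
and outside would both meet that face.\<close>

lemma two_sides:
  assumes i: "i < n"
  shows "left_face (set ps) (poly_edges ps) (\<lambda>x. x) (ps ! i) (cyc_succ ps i) \<noteq>
    left_face (set ps) (poly_edges ps) (\<lambda>x. x) (cyc_succ ps i) (ps ! i)" (is "?L \<noteq> ?R")
proof
  assume LR: "?L = ?R"
  let ?a = "ps ! i" and ?b = "cyc_succ ps i"
  let ?m = "midpoint ?a ?b"
  have m: "?m \<in> open_segment ?a ?b" "?m \<in> open_segment ?b ?a"
    using midpoint_open[OF edge(1)[OF i]] by (auto simp: open_segment_commute)
  obtain r1 where r1: "0 < r1" "ball ?m r1 \<inter> drawing (set ps) (poly_edges ps) (\<lambda>x. x) \<subseteq> closed_segment ?a ?b"
     "ball ?m r1 \<inter> {z. 0 < side ?a ?b z} \<subseteq> ?L"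
    by (rule half_disc[OF edge(1)[OF i] m(1)])
  obtain r2 where r2: "0 < r2" "ball ?m r2 \<inter> drawing (set ps) (poly_edges ps) (\<lambda>x. x) \<subseteq> closed_segment ?b ?a"
     "ball ?m r2 \<inter> {z. 0 < side ?b ?a z} \<subseteq> ?R"
    by (rule half_disc[OF edge(2)[OF i] m(2)])
  have ab: "?a \<noteq> ?b" using succ_ne[OF i] by simp
  have "?m \<in> closed_segment ?a ?b" using m(1) by (simp add: open_segment_def)
  then have mb: "?m \<in> polygon_boundary ps" using i unfolding polygon_boundary_def by blast
  have meets: "G \<inter> ?L \<noteq> {}" if G: "open G" "?m \<in> frontier G" for G
  proof -
    have "?m \<in> closure G" using G by (simp add: frontier_def)
    moreover have "?m \<in> ball ?m (min r1 r2)" using r1(1) r2(1) by simp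
    ultimately have "G \<inter> ball ?m (min r1 r2) \<noteq> {}"
      using open_Int_closure_eq_empty[of "ball ?m (min r1 r2)" G] by blast
    moreover have "open (G \<inter> ball ?m (min r1 r2))" using G by auto
    ultimately obtain x where x: "x \<in> G" "x \<in> ball ?m r1" "x \<in> ball ?m r2" "side ?a ?b x \<noteq> 0"
      using open_meets_off_line[of "G \<inter> ball ?m (min r1 r2)" ?a ?b] ab by auto
    consider "0 < side ?a ?b x" | "0 < side ?b ?a x"
      using x(4) side_swap[OF ab, of x] by linarith
    then have "x \<in> ?L" using r1(3) r2(3) x LR by cases auto
    then show ?thesis using x by blast
  qed
  have "polygon_interior ps \<inter> ?L \<noteq> {}" "outside (polygon_boundary ps) \<inter> ?L \<noteq> {}"
    using meets[OF Jordan(3)] meets[OF Jordan(7)] mb Jordan(11,12) by simp_all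
  moreover have "?L \<in> {polygon_interior ps, outside (polygon_boundary ps)}"
    using left_face(1)[OF edge(1)[OF i]] faces_eq by simp
  ultimately show False using Jordan(9) by auto
qed

lemma left_face_interior:
  assumes "ccw_polygon ps" "i < n"
  shows "left_face (set ps) (poly_edges ps) (\<lambda>x. x) (ps ! i) (cyc_succ ps i) = polygon_interior ps"
  using assms faces_eq by (intro left_face_unique[OF edge(1)]) (auto simp: ccw_polygon_def)

lemma interior_angle_seq: "interior_angle ps ((m + Suc k) mod n) = pi - closed_polygon.turn (seq m) k"
proof -
  interpret cp: closed_polygon "seq m" n by (rule closed_polygon)
  have "interior_angle ps ((m + Suc k) mod n) = ccw_angle (cp.d (Suc k)) (- cp.d k)"
    unfolding interior_angle_def seq_pred unfolding seq_succ cp.d_def by (simp add: seq_def)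
  then show ?thesis by (simp add: cp.interior_angle_turn)
qed

lemma sum_interior_angles_turn:
  "(\<Sum>i<n. interior_angle ps i) = real n * pi - (\<Sum>k<n. closed_polygon.turn (seq m) k)"
proof -
  have "(\<Sum>i<n. interior_angle ps i) = (\<Sum>k<n. interior_angle ps (k mod n))" by (rule sum.cong) auto
  also have "\<dots> = (\<Sum>k<n. interior_angle ps ((Suc m + k) mod n))"
    by (rule sum_periodic[symmetric]) simp
  also have "\<dots> = (\<Sum>k<n. pi - closed_polygon.turn (seq m) k)"
    using interior_angle_seq[of m] by simp
  finally show ?thesis by (simp add: sum_subtractf)
qed

text \<open>By the turning number of the polygon. Its assumption on the two edges at the lowest vertex
is where the counterclockwise listing enters: the interior lies on the left, and nothing below the
lowest vertex is interior.\<close>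

theorem interior_angle_sum:
  assumes ccw: "ccw_polygon ps"
  shows "(\<Sum>i<n. interior_angle ps i) = (real n - 2) * pi"
proof -
  have "set ps \<noteq> {}" using n3 by auto
  then obtain z where z: "z \<in> set ps"
    "\<And>w. w \<in> set ps \<Longrightarrow> w \<noteq> z \<Longrightarrow> Im z < Im w \<or> Im z = Im w \<and> Re z < Re w"
    using lex_min[of "set ps"] by (metis finite_set)
  then obtain m where m: "m < n" "ps ! m = z" by (metis in_set_conv_nth)
  interpret cp: closed_polygon "seq m" n by (rule closed_polygon)
  have P0: "seq m 0 = ps ! m" using m by (simp add: seq_def)
  have P1: "seq m 1 = cyc_succ ps m" using seq_succ[of m 0] m by simp
  have "m + Suc (n - 1) = m + n" using n3 by simp
  then have "(m + Suc (n - 1)) mod n = m" using m by (metis mod_add_self2 mod_less)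
  then have Pn: "seq m (n - 1) = cyc_pred ps m" using seq_pred[of m "n - 1"] by simp
  have low: "Im (seq m 0) < Im (seq m k) \<or> Im (seq m 0) = Im (seq m k) \<and> Re (seq m 0) < Re (seq m k)"
    if k: "0 < k" "k < n" for k
  proof -
    have "seq m k \<noteq> z" using cp.P_eq_iff[of k 0] k P0 m by simp
    moreover have "seq m k \<in> set ps" by (simp add: seq_def mod_lt)
    ultimately show ?thesis using z(2) P0 m by simp
  qed
  let ?a = "cyc_succ ps m - ps ! m" and ?b = "cyc_pred ps m - ps ! m"
  have ab: "0 < Im ?a \<or> Im ?a = 0 \<and> 0 < Re ?a" "0 < Im ?b \<or> Im ?b = 0 \<and> 0 < Re ?b"
    using low[of 1] low[of "n - 1"] n3 unfolding P0 P1 Pn by auto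
  then have up: "0 \<le> Arg ?a" "Arg ?a < pi" "0 \<le> Arg ?b" "Arg ?b < pi"
    using Arg_upper[of ?a] Arg_upper[of ?b] by blast+
  have nz: "?a \<noteq> 0" "?b \<noteq> 0" using ab by auto
  have "Arg ?a < Arg ?b"
  proof (rule ccontr)
    assume not: "\<not> Arg ?a < Arg ?b"
    \<comment> \<open>Otherwise the interior sector at the lowest vertex contains the direction straight down, and
       the ray in this direction avoids the polygon: it would be an unbounded set of interior points.\<close>
    have a: "?a = of_real (norm ?a) * cis (Arg ?a)" and b: "?b = of_real (norm ?b) * cis (Arg ?b)"
      by (rule polar_Arg)+
    have "of_real (norm ?b / norm ?a) * cis (2 * pi + (Arg ?b - Arg ?a)) * (of_real (norm ?a) * cis (Arg ?a)) =
        (of_real (norm ?b / norm ?a) * of_real (norm ?a)) * (cis (2 * pi + (Arg ?b - Arg ?a)) * cis (Arg ?a))"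
      by (simp only: mult_ac)
    also have "\<dots> = of_real (norm ?b) * cis (2 * pi + Arg ?b)"
      using nz by (simp add: cis_mult)
    also have "cis (2 * pi + Arg ?b) = cis (Arg ?b)" by (simp add: cis_2pi flip: cis_mult)
    finally have "?b = of_real (norm ?b / norm ?a) * cis (2 * pi + (Arg ?b - Arg ?a)) * ?a"
      using a b by simp
    then have angle: "interior_angle ps m = 2 * pi + (Arg ?b - Arg ?a)"
      unfolding interior_angle_def using nz up not
      by (intro ccw_angle_unique[of _ "norm ?b / norm ?a"]) auto
    obtain r where r: "0 < r" "\<forall>s \<phi>. 0 < s \<and> s < r \<and> 0 < \<phi> \<and> \<phi> < interior_angle ps m \<longrightarrow>
        ps ! m + of_real s * cis \<phi> * ?a \<in> polygon_interior ps"
      using sector[OF edge(1)[OF m(1)]] vertex_angle_eq[OF m(1)] left_face_interior[OF ccw m(1)]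
      by (metis (no_types, lifting))
    define \<phi> where "\<phi> = 3 / 2 * pi - Arg ?a"
    define x0 where "x0 = r / 2 * norm ?a"
    have "0 < r / 2 \<and> r / 2 < r \<and> 0 < \<phi> \<and> \<phi> < interior_angle ps m"
      using up r(1) unfolding \<phi>_def angle by auto
    then have "ps ! m + of_real (r / 2) * cis \<phi> * ?a \<in> polygon_interior ps"
      using r(2) by blast
    moreover have "of_real (r / 2) * cis \<phi> * ?a = - \<i> * of_real x0"
    proof -
      have "of_real (r / 2) * cis \<phi> * (of_real (norm ?a) * cis (Arg ?a)) = of_real x0 * (cis \<phi> * cis (Arg ?a))"
        by (simp add: x0_def mult_ac)
      also have "cis \<phi> * cis (Arg ?a) = cis (pi + pi / 2)" by (simp add: cis_mult \<phi>_def)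
      also have "\<dots> = - \<i>" by (subst cis_mult[symmetric]) (simp add: cis_pi_half)
      finally show ?thesis using a by simp
    qed
    ultimately have x0: "ps ! m - \<i> * of_real x0 \<in> polygon_interior ps" "0 < x0"
      using r(1) nz by (simp_all add: x0_def)
    define R where "R = (\<lambda>x. ps ! m - \<i> * of_real x) ` {0<..}"
    have "connected R" unfolding R_def by (intro connected_continuous_image continuous_intros) auto
    have above: "Im (ps ! m) \<le> Im w" if w: "w \<in> polygon_boundary ps" for w
    proof -
      obtain i u where i: "i < n" "0 \<le> u" "u \<le> 1" "w = (1 - u) *\<^sub>R (ps ! i) + u *\<^sub>R cyc_succ ps i"
        using w by (auto simp: polygon_boundary_def closed_segment_def)
      have ge: "Im (ps ! m) \<le> Im v" if "v \<in> set ps" for v using z(2)[OF that] m by (cases "v = z") auto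
      have "(1 - u) * Im (ps ! m) + u * Im (ps ! m) \<le> (1 - u) * Im (ps ! i) + u * Im (cyc_succ ps i)"
        using ge[of "ps ! i"] ge[OF succ_mem, of i] i by (intro add_mono mult_left_mono) auto
      also have "\<dots> = Im w" using i(4) by simp
      finally show ?thesis by (simp flip: distrib_right)
    qed
    have "R \<inter> polygon_boundary ps = {}" using above by (force simp: R_def)
    moreover have "R \<inter> polygon_interior ps \<noteq> {}" using x0 by (auto simp: R_def)
    ultimately have "R \<subseteq> polygon_interior ps"
      using face_absorbs[of "polygon_interior ps" R] \<open>connected R\<close> faces_eq drawing_eq by auto
    then have "bounded R" using Jordan(4) bounded_subset by blast
    then obtain B where B: "\<And>w. w \<in> R \<Longrightarrow> norm w \<le> B" by (auto simp: bounded_iff)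
    define x where "x = \<bar>B\<bar> + norm (ps ! m) + 1"
    have "0 < x" by (simp add: x_def add_nonneg_pos)
    then have "norm (ps ! m - \<i> * of_real x) \<le> B" by (intro B) (auto simp: R_def)
    moreover have "x - norm (ps ! m) \<le> norm (ps ! m - \<i> * of_real x)"
      using norm_triangle_ineq2[of "\<i> * of_real x" "ps ! m"] \<open>0 < x\<close> by (simp add: norm_mult norm_minus_commute)
    ultimately show False by (simp add: x_def)
  qed
  then have "(\<Sum>k<n. cp.turn k) = 2 * pi"
    using cp.turning_sum[OF low] P0 P1 Pn by simp
  then show ?thesis using sum_interior_angles_turn[of m] by (simp add: algebra_simps)
qed

text \<open>The region is the intersection of the left half-planes of the edges. By \<open>left_of_first_edge\<close> it is contained in
each of them. Conversely, a segment from an interior point to a point outside leaves the region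
through some edge and thus crosses the line of that edge from left to right.\<close>

theorem convex_region:
  assumes ccw: "ccw_polygon ps" and convex_angles: "\<And>i. i < n \<Longrightarrow> interior_angle ps i < pi"
  shows "convex (polygon_region ps)"
proof -
  have left: "0 \<le> side (ps ! m) (cyc_succ ps m) v" if m: "m < n" and v: "v \<in> set ps" for m v
  proof -
    interpret cp: closed_polygon "seq m" n by (rule closed_polygon)
    have pos: "0 < cp.turn k" for k using interior_angle_seq[of m k] convex_angles[OF mod_lt, of "m + Suc k"] by simp
    have total: "(\<Sum>k<n. cp.turn k) = 2 * pi"
      using sum_interior_angles_turn[of m] interior_angle_sum[OF ccw] by (simp add: algebra_simps)
    obtain j where j: "j < n" "v = ps ! j" using v by (metis in_set_conv_nth)
    define k where "k = (j + (n - m)) mod n"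
    have "(m + k) mod n = (m + (j + (n - m))) mod n" by (simp add: k_def mod_add_right_eq)
    also have "m + (j + (n - m)) = j + n" using m by simp
    finally have "seq m k = v" using j by (simp add: seq_def)
    moreover have "k < n" by (simp add: k_def mod_lt)
    moreover have "seq m 0 = ps ! m" "seq m 1 = cyc_succ ps m" using m seq_succ[of m 0] by (simp_all add: seq_def)
    ultimately show ?thesis using cp.left_of_first_edge[OF pos total, of k] by simp
  qed
  define H where "H m = {z. 0 \<le> side (ps ! m) (cyc_succ ps m) z}" for m
  define K where "K = (\<Inter>m<n. H m)"
  have affine: "side a b ((1 - u) *\<^sub>R x + u *\<^sub>R y) = (1 - u) * side a b x + u * side a b y" for a b x y :: complex and u
  proof -
    have "((1 - u) *\<^sub>R x + u *\<^sub>R y - a) / (b - a) = (1 - u) *\<^sub>R ((x - a) / (b - a)) + u *\<^sub>R ((y - a) / (b - a))"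
      by (simp add: scaleR_conv_of_real add_divide_distrib diff_divide_distrib algebra_simps)
    then show ?thesis by (simp add: side_def)
  qed
  have "convex (H m)" for m unfolding convex_alt H_def by (auto simp: affine)
  then have "convex K" unfolding K_def by (intro convex_INT) auto
  have bK: "polygon_boundary ps \<subseteq> K"
  proof
    fix w assume "w \<in> polygon_boundary ps"
    then obtain i where i: "i < n" "w \<in> closed_segment (ps ! i) (cyc_succ ps i)" by (auto simp: polygon_boundary_def)
    have "ps ! i \<in> K" "cyc_succ ps i \<in> K" using left i succ_mem by (auto simp: K_def H_def)
    then show "w \<in> K" using i \<open>convex K\<close> closed_segment_subset by blast
  qed
  have iH: "polygon_interior ps \<subseteq> H m" if m: "m < n" for m
  proof -
    let ?a = "ps ! m" and ?b = "cyc_succ ps m"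
    have ab: "?a \<noteq> ?b" using succ_ne[OF m] by simp
    have "polygon_interior ps \<subseteq> H m - polygon_boundary ps"
      unfolding polygon_interior_def
    proof (rule inside_subset)
      have neg: "- H m = {z. 0 < side ?b ?a z}" using side_swap[OF ab] by (auto simp: H_def)
      then show "connected (- H m)" using convex_side convex_connected by metis
      show "\<not> bounded (- H m)"
      proof
        assume "bounded (- H m)"
        then obtain B where B: "\<And>z. z \<in> - H m \<Longrightarrow> norm z \<le> B" by (auto simp: bounded_iff)
        define x where "x = (\<bar>B\<bar> + norm ?b + 1) / norm (?a - ?b)"
        have "0 < x" using ab by (simp add: x_def add_nonneg_pos)
        moreover have "side ?b ?a (?b + of_real x * \<i> * (?a - ?b)) = x"
          using side_add[of ?b ?a ?b x] ab by (simp add: side_def)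
        ultimately have "norm (?b + of_real x * \<i> * (?a - ?b)) \<le> B" using neg by (intro B) simp
        moreover have "norm (of_real x * \<i> * (?a - ?b)) = \<bar>B\<bar> + norm ?b + 1"
        proof -
          have "norm (of_real x * \<i> * (?a - ?b)) = x * norm (?a - ?b)" using \<open>0 < x\<close> by (simp add: norm_mult)
          then show ?thesis using ab by (simp add: x_def)
        qed
        ultimately show False
          using norm_diff_ineq[of "of_real x * \<i> * (?a - ?b)" ?b] by (simp add: add.commute)
      qed
      show "H m - polygon_boundary ps \<union> - H m = - polygon_boundary ps"
        using bK m by (auto simp: K_def)
    qed
    then show ?thesis by blast
  qed
  have pos: "0 < side (ps ! m) (cyc_succ ps m) y" if m: "m < n" and y: "y \<in> polygon_interior ps" for m y
  proof -
    let ?a = "ps ! m" and ?b = "cyc_succ ps m"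
    have ab: "?a \<noteq> ?b" using succ_ne[OF m] by simp
    have "((\<lambda>t. y + of_real t * \<i> * (?a - ?b)) \<longlongrightarrow> y + of_real 0 * \<i> * (?a - ?b)) (at_right (0::real))"
      by (intro tendsto_intros)
    then have "\<forall>\<^sub>F t in at_right (0::real). y + of_real t * \<i> * (?a - ?b) \<in> polygon_interior ps"
      using y Jordan(3) by (intro topological_tendstoD) auto
    moreover have "\<forall>\<^sub>F t in at_right (0::real). 0 < t" by (simp add: eventually_at_right_less)
    ultimately have "\<forall>\<^sub>F t in at_right (0::real). 0 < t \<and> y + of_real t * \<i> * (?a - ?b) \<in> polygon_interior ps"
      by eventually_elim simp
    then obtain t where t: "0 < t" "y + of_real t * \<i> * (?a - ?b) \<in> polygon_interior ps"
      using eventually_happens'[of "at_right (0::real)"] by force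
    then have "0 \<le> side ?a ?b (y + of_real (- t) * \<i> * (?b - ?a))"
      using iH[OF m] by (auto simp: H_def algebra_simps)
    then show ?thesis using side_add[OF ab, of y "- t"] t by simp
  qed
  have "polygon_region ps = K"
  proof
    show "polygon_region ps \<subseteq> K" using bK iH by (auto simp: polygon_region_def K_def)
    show "K \<subseteq> polygon_region ps"
    proof (rule ccontr)
      assume "\<not> K \<subseteq> polygon_region ps"
      then obtain x where x: "x \<in> K" "x \<notin> polygon_boundary ps" "x \<notin> polygon_interior ps"
        by (auto simp: polygon_region_def)
      obtain y where y: "y \<in> polygon_interior ps" using Jordan(1) by blast
      have "closed_segment y x \<inter> frontier (polygon_interior ps) \<noteq> {}"
        using x y by (intro connected_Int_frontier) auto
      then obtain w where w: "w \<in> closed_segment y x" "w \<in> polygon_boundary ps" using Jordan(11) by auto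
      then obtain m where m: "m < n" "w \<in> closed_segment (ps ! m) (cyc_succ ps m)"
        by (auto simp: polygon_boundary_def)
      obtain u where u: "0 \<le> u" "u \<le> 1" "w = (1 - u) *\<^sub>R y + u *\<^sub>R x" using w by (auto simp: closed_segment_def)
      have "u \<noteq> 1" using u x w by auto
      have "0 = (1 - u) * side (ps ! m) (cyc_succ ps m) y + u * side (ps ! m) (cyc_succ ps m) x"
        using side_segment[OF m(2)] succ_ne[OF m(1)] u(3) by (simp add: affine)
      moreover have "0 < (1 - u) * side (ps ! m) (cyc_succ ps m) y" using pos[OF m(1) y] u \<open>u \<noteq> 1\<close> by simp
      moreover have "0 \<le> u * side (ps ! m) (cyc_succ ps m) x" using x(1) m u by (auto simp: K_def H_def)
      ultimately show False by linarith
    qed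
  qed
  then show ?thesis using \<open>convex K\<close> by simp
qed

end

section \<open>Cycles in plane drawings\<close>

lemma cyc_succ_map: "i < length xs \<Longrightarrow> cyc_succ (map f xs) i = f (cyc_succ xs i)"
  unfolding cyc_succ_def length_map by (rule nth_map, rule mod_less_divisor) auto

lemma cyc_pred_map: "i < length xs \<Longrightarrow> cyc_pred (map f xs) i = f (cyc_pred xs i)"
  unfolding cyc_pred_def length_map by (rule nth_map, rule mod_less_divisor) auto

lemma cyc_rev:
  assumes k: "k < length xs"
  shows "cyc_succ (rev xs) k = cyc_pred xs (length xs - Suc k)"
    "cyc_pred (rev xs) k = cyc_succ xs (length xs - Suc k)"
proof -
  let ?n = "length xs"
  have n: "0 < ?n" using k by auto
  have "cyc_succ (rev xs) k = xs ! (?n - Suc (Suc k mod ?n))"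
    unfolding cyc_succ_def using n by (simp add: rev_nth)
  also have "?n - Suc (Suc k mod ?n) = (?n - Suc k + ?n - 1) mod ?n"
  proof (cases "Suc k = ?n")
    case False
    then have "?n - Suc k + ?n - 1 = (?n - Suc (Suc k)) + ?n" using k by simp
    then show ?thesis using k False by (metis Suc_lessI diff_Suc_less mod_add_self2 mod_less n)
  qed (use n in simp)
  finally show "cyc_succ (rev xs) k = cyc_pred xs (?n - Suc k)" by (simp add: cyc_pred_def)
  have "cyc_pred (rev xs) k = xs ! (?n - Suc ((k + ?n - 1) mod ?n))"
    unfolding cyc_pred_def using n by (simp add: rev_nth)
  also have "?n - Suc ((k + ?n - 1) mod ?n) = Suc (?n - Suc k) mod ?n"
  proof (cases "k = 0")
    case False
    then have "k + ?n - 1 = (k - 1) + ?n" by simp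
    then have "(k + ?n - 1) mod ?n = k - 1" using k by (metis less_imp_diff_less mod_add_self2 mod_less)
    then show ?thesis using k False by auto
  qed (use n in auto)
  finally show "cyc_pred (rev xs) k = cyc_succ xs (?n - Suc k)" by (simp add: cyc_succ_def)
qed

lemma cyc_pred_succ: "k < length xs \<Longrightarrow> cyc_pred xs (Suc k mod length xs) = xs ! k"
  unfolding cyc_pred_def by (subst pred_Suc_mod) auto

lemma cyc_succ_pred:
  assumes "k < length xs"
  shows "cyc_succ xs ((k + length xs - 1) mod length xs) = xs ! k"
  unfolding cyc_succ_def by (subst Suc_pred_mod) (use assms in auto)

text \<open>A walk that returns to an earlier vertex is cut back to the first visit.\<close>

lemma distinct_walk:
  assumes "(x, y) \<in> R\<^sup>*" "x \<in> A" "R \<subseteq> A \<times> A"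
  obtains xs where "xs \<noteq> []" "hd xs = x" "last xs = y" "distinct xs" "set xs \<subseteq> A"
    "successively (\<lambda>a b. (a, b) \<in> R) xs"
proof -
  have "\<exists>xs. xs \<noteq> [] \<and> hd xs = x \<and> last xs = y \<and> distinct xs \<and> set xs \<subseteq> A \<and> successively (\<lambda>a b. (a, b) \<in> R) xs"
    using assms(1)
  proof (induction rule: rtrancl_induct)
    case base
    show ?case by (intro exI[of _ "[x]"]) (use assms in auto)
  next
    case (step y z)
    then obtain xs where xs: "xs \<noteq> []" "hd xs = x" "last xs = y" "distinct xs" "set xs \<subseteq> A"
      "successively (\<lambda>a b. (a, b) \<in> R) xs" by blast
    show ?case
    proof (cases "z \<in> set xs")
      case True
      then obtain as bs where "xs = as @ z # bs" by (auto simp: in_set_conv_decomp)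
      then have s: "xs = (as @ [z]) @ bs" by simp
      show ?thesis
      proof (intro exI[of _ "as @ [z]"] conjI)
        show "hd (as @ [z]) = x" using xs(2) s by (cases as) auto
        show "distinct (as @ [z])" "set (as @ [z]) \<subseteq> A" using xs(4,5) s by auto
        show "successively (\<lambda>a b. (a, b) \<in> R) (as @ [z])"
          using xs(6) unfolding s successively_append_iff by blast
      qed auto
    next
      case False
      then show ?thesis using xs step(2) assms(3)
        by (intro exI[of _ "xs @ [z]"]) (auto simp: successively_append_iff)
    qed
  qed
  then show ?thesis using that by blast
qed

context plane_drawing begin

lemma cycle_simple_polygon:
  assumes "distinct vs" "3 \<le> length vs" "\<And>i. i < length vs \<Longrightarrow> {vs ! i, cyc_succ vs i} \<in> E"
  shows "simple_polygon (map \<rho> vs)"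
  unfolding simple_polygon_def
proof (intro conjI allI impI)
  let ?n = "length vs"
  show "3 \<le> length (map \<rho> vs)" using assms by simp
  have "set vs \<subseteq> V" using assms(3) edgeD(1) by (metis in_set_conv_nth subsetI)
  then show "distinct (map \<rho> vs)" using assms(1) inj by (simp add: distinct_map inj_on_subset)
  fix i j assume "i < length (map \<rho> vs)" "j < length (map \<rho> vs)" "i \<noteq> j"
  then have i: "i < ?n" and j: "j < ?n" and ij: "i \<noteq> j" by auto
  have "{vs ! i, cyc_succ vs i} \<noteq> {vs ! j, cyc_succ vs j}"
  proof
    assume "{vs ! i, cyc_succ vs i} = {vs ! j, cyc_succ vs j}"
    then have "vs ! i = cyc_succ vs j" "cyc_succ vs i = vs ! j"
      using ij i j assms(1) by (auto simp: doubleton_eq_iff nth_eq_iff_index_eq)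
    moreover have "Suc i mod ?n < ?n" "Suc j mod ?n < ?n" using assms(2) by (auto intro!: mod_less_divisor)
    ultimately have "i = Suc j mod ?n" "Suc i mod ?n = j"
      using i j assms(1) by (auto simp: cyc_succ_def nth_eq_iff_index_eq)
    then show False using i j assms(2) by (auto simp: mod_Suc split: if_splits)
  qed
  then have "closed_segment (\<rho> (vs ! i)) (\<rho> (cyc_succ vs i)) \<inter> closed_segment (\<rho> (vs ! j)) (\<rho> (cyc_succ vs j))
      \<subseteq> \<rho> ` ({vs ! i, cyc_succ vs i} \<inter> {vs ! j, cyc_succ vs j})"
    using cross[OF assms(3)[OF i] assms(3)[OF j]] edgeD(5)[OF assms(3)[OF i]] edgeD(5)[OF assms(3)[OF j]] by simp
  also have "\<dots> \<subseteq> {\<rho> (vs ! i), \<rho> (cyc_succ vs i)} \<inter> {\<rho> (vs ! j), \<rho> (cyc_succ vs j)}" by auto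
  finally show "closed_segment (map \<rho> vs ! i) (cyc_succ (map \<rho> vs) i) \<inter>
      closed_segment (map \<rho> vs ! j) (cyc_succ (map \<rho> vs) j)
      \<subseteq> {map \<rho> vs ! i, cyc_succ (map \<rho> vs) i} \<inter> {map \<rho> vs ! j, cyc_succ (map \<rho> vs) j}"
    using i j by (simp add: cyc_succ_map)
qed

lemma polygon_boundary_in_drawing:
  assumes "\<And>i. i < length vs \<Longrightarrow> {vs ! i, cyc_succ vs i} \<in> E"
  shows "polygon_boundary (map \<rho> vs) \<subseteq> drawing V E \<rho>"
  unfolding polygon_boundary_def using edge_in_drawing[OF assms] by (auto simp: cyc_succ_map)

text \<open>Deleting \<open>v\<close> leaves a path from \<open>w\<close> to \<open>w'\<close>, which closes up through \<open>v\<close> to a simple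
  polygon. At \<open>v\<close> the left side of \<open>v \<rightarrow> w'\<close> continues to the right side of \<open>v \<rightarrow> w\<close>. A face on the left
  of both edges would thus lie on both sides of the polygon.\<close>

lemma one_angle_per_face:
  assumes "two_connected V E" and e: "{v, w} \<in> E" "{v, w'} \<in> E"
    and same: "left_face V E \<rho> v w = left_face V E \<rho> v w'"
  shows "w = w'"
proof (rule ccontr)
  assume ne: "w \<noteq> w'"
  let ?A = "V - {v}"
  let ?R = "{(x, y). x \<in> ?A \<and> y \<in> ?A \<and> {x, y} \<in> E}"
  have "{v} \<subseteq> V \<and> card {v} < 2" using edgeD(1)[OF e(1)] by simp
  then have "graph_connected ?A E" using assms(1) unfolding two_connected_def by blast
  moreover have wA: "w \<in> ?A" "w' \<in> ?A" using edgeD[OF e(1)] edgeD[OF e(2)] by auto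
  ultimately have "(w, w') \<in> ?R\<^sup>*" by (simp add: graph_connected_def)
  then obtain xs where xs: "xs \<noteq> []" "hd xs = w" "last xs = w'" "distinct xs" "set xs \<subseteq> ?A"
    "successively (\<lambda>a b. (a, b) \<in> ?R) xs"
    using distinct_walk[of w w' ?R ?A] wA(1) by blast
  define vs where "vs = v # xs"
  have len: "2 \<le> length xs"
  proof (rule ccontr)
    assume "\<not> 2 \<le> length xs"
    then have "length xs \<le> 1" by simp
    then obtain u where "xs = [u]" using xs(1) by (cases xs) auto
    then show False using xs(2,3) ne by auto
  qed
  have edges: "{vs ! i, cyc_succ vs i} \<in> E" if i: "i < length vs" for i
  proof -
    consider "i = 0" | "Suc i = length vs" | k where "i = Suc k" "Suc k < length xs"
      using i by (cases i) (auto simp: vs_def, fastforce)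
    then show ?thesis
    proof cases
      case 1
      then show ?thesis using xs(1,2) e(1) by (simp add: cyc_succ_def vs_def hd_conv_nth)
    next
      case 2
      then have "vs ! i = w'" "cyc_succ vs i = v"
        using xs(1,3) by (auto simp: cyc_succ_def vs_def last_conv_nth nth_Cons')
      then show ?thesis using e(2) by (simp add: insert_commute)
    next
      case 3
      then have "(xs ! k, xs ! Suc k) \<in> ?R" using xs(6) by (auto simp: successively_conv_nth)
      then show ?thesis using 3 by (simp add: cyc_succ_def vs_def)
    qed
  qed
  have dist: "distinct vs" using xs(4,5) by (auto simp: vs_def)
  define ps where "ps = map \<rho> vs"
  interpret p: polygon ps
    using cycle_simple_polygon[OF dist _ edges] len by unfold_locales (simp add: ps_def vs_def)
  have n: "0 < length ps" by (simp add: ps_def vs_def)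
  have at0: "ps ! 0 = \<rho> v" "cyc_succ ps 0 = \<rho> w" "cyc_pred ps 0 = \<rho> w'"
    using xs(1-3) len by (auto simp: ps_def vs_def cyc_succ_def cyc_pred_def hd_conv_nth last_conv_nth nth_Cons')
  let ?F = "left_face V E \<rho> v w"
  have F: "?F \<in> faces V E \<rho>" using left_face(1)[OF e(1)] .
  have "polygon_boundary ps \<subseteq> drawing V E \<rho>" unfolding ps_def by (rule polygon_boundary_in_drawing[OF edges])
  then have "?F \<subseteq> - polygon_boundary ps" using face_disjoint[OF F] by blast
  moreover have "connected ?F" "?F \<noteq> {}"
    using F in_components_connected[of ?F] in_components_nonempty[of ?F] unfolding faces_def by auto
  ultimately obtain K where "K \<in> components (- polygon_boundary ps)" "?F \<subseteq> K"
    using exists_component_superset[of ?F "- polygon_boundary ps"] by blast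
  then have K: "K \<in> faces (set ps) (poly_edges ps) (\<lambda>x. x)" by (simp add: faces_def p.drawing_eq)
  let ?l = "left_face (set ps) (poly_edges ps) (\<lambda>x. x)"
  have pe: "{ps ! 0, cyc_succ ps 0} \<in> poly_edges ps" "{ps ! 0, cyc_pred ps 0} \<in> poly_edges ps"
    using p.nbrs[OF n] by auto
  have "on_left (\<rho> v) (\<rho> w) K" "on_left (\<rho> v) (\<rho> w') K"
    using left_face(2)[OF e(1)] left_face(2)[OF e(2)] same on_left_mono \<open>?F \<subseteq> K\<close> by auto
  then have l: "?l (ps ! 0) (cyc_succ ps 0) = K" "?l (ps ! 0) (cyc_pred ps 0) = K"
    using p.left_face_unique[OF pe(1) K] p.left_face_unique[OF pe(2) K] at0 by simp_all
  have "?l (cyc_succ ps 0) (ps ! 0) = K"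
    using p.corner[OF pe(2)] p.next_eq(2)[OF n] l(2) by simp
  then show False using p.two_sides[OF n] l(1) by simp
qed

end

lemma noncrossing_plane_drawing: "noncrossing_framework V E \<rho> \<Longrightarrow> plane_drawing V E \<rho>"
  by unfold_locales (auto simp: noncrossing_framework_def)

section \<open>Angles of a face and of its reciprocal vertex\<close>

lemma ccw_angle_of_real_mult:
  assumes "s \<noteq> 0" "t \<noteq> 0"
  shows "ccw_angle (of_real s * a) (of_real t * b) = (if s * t < 0 then ccw_angle a (- b) else ccw_angle a b)"
proof -
  have 1: "of_real s * a = of_real \<bar>s\<bar> * (if s < 0 then - a else a)" "of_real t * b = of_real \<bar>t\<bar> * (if t < 0 then - b else b)" by auto
  have "ccw_angle (of_real s * a) (of_real t * b) = ccw_angle (if s < 0 then - a else a) (if t < 0 then - b else b)"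
    unfolding 1 using assms by (intro ccw_angle_scale) auto
  also have "\<dots> = (if s * t < 0 then ccw_angle a (- b) else ccw_angle a b)"
    using assms ccw_angle_minus_minus[of a b] ccw_angle_minus_minus[of a "- b"] by (auto simp: mult_less_0_iff)
  finally show ?thesis .
qed

text \<open>Here \<open>b\<close> is the direction of the edge entering a corner, \<open>a\<close> that of the edge leaving it, and \<open>t\<close>, \<open>s\<close> are
their stresses, so that \<^term>\<open>ccw_angle a (- b)\<close> is the angle of the face. Opposite signs flip one of
the two directions.\<close>

lemma reversed_angle:
  assumes "a \<noteq> 0" "b \<noteq> 0" "s \<noteq> 0" "t \<noteq> 0"
  shows "ccw_angle (of_real s * a) (of_real t * b) = ccw_angle a (- b) +
    (if s * t < 0 then 0 else if ccw_angle a (- b) \<le> pi then pi else - pi)"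
  using ccw_angle_minus_right[of a "- b"] assms by (auto simp: ccw_angle_of_real_mult)

text \<open>With the orientation of the reciprocal unchanged, the angle of the reciprocal is at least the exterior angle of the
face; flipping one direction makes it strictly larger.\<close>

lemma same_angle:
  assumes "a \<noteq> 0" "b \<noteq> 0" "s \<noteq> 0" "t \<noteq> 0"
  shows "pi - ccw_angle a (- b) \<le> ccw_angle (of_real t * b) (of_real s * a)"
    "s * t < 0 \<Longrightarrow> pi - ccw_angle a (- b) < ccw_angle (of_real t * b) (of_real s * a)"
proof -
  have pos: "0 < ccw_angle (of_real t * b) (of_real s * a)" by (rule ccw_angle_range)
  have "pi - ccw_angle a (- b) \<le> ccw_angle (of_real t * b) (of_real s * a) \<and>
    (s * t < 0 \<longrightarrow> pi - ccw_angle a (- b) < ccw_angle (of_real t * b) (of_real s * a))"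
  proof (cases "ccw_angle a (- b) < pi")
    case False
    then show ?thesis using pos by linarith
  next
    case True
    have "ccw_angle (- b) a = 2 * pi - ccw_angle a (- b)"
      using True assms pi_gt_zero by (intro ccw_angle_swap) (auto simp: less_trans)
    then have c: "ccw_angle b (- a) = 2 * pi - ccw_angle a (- b)" using ccw_angle_minus_minus[of b "- a"] by simp
    have "ccw_angle a b = ccw_angle a (- b) + pi" using ccw_angle_minus_right[of a "- b"] assms True by simp
    then have "ccw_angle b a = pi - ccw_angle a (- b)" using ccw_angle_swap[of a b] assms True by simp
    then show ?thesis using c ccw_angle_of_real_mult[OF assms(4,3), of b a] pi_gt_zero
      by (auto simp: mult.commute[of t s])
  qed
  then show "pi - ccw_angle a (- b) \<le> ccw_angle (of_real t * b) (of_real s * a)"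
    "s * t < 0 \<Longrightarrow> pi - ccw_angle a (- b) < ccw_angle (of_real t * b) (of_real s * a)" by auto
qed

section \<open>Face boundaries and reciprocal vertices\<close>

locale reciprocal_pair =
  fixes V :: "'v set" and E :: "'v set set" and \<rho> :: "'v \<Rightarrow> complex"
    and \<omega> :: "'v set \<Rightarrow> real" and \<rho>' :: "complex set \<Rightarrow> complex"
  assumes framework: "noncrossing_framework V E \<rho>"
    and two_conn: "two_connected V E"
    and stress: "self_stress V E \<rho> \<omega>"
    and nonzero: "\<And>e. e \<in> E \<Longrightarrow> \<omega> e \<noteq> 0"
    and recip: "reciprocal V E \<rho> \<omega> \<rho>'"
    and recip_noncrossing: "noncrossing_reciprocal V E \<rho> \<rho>'"
begin

sublocale G: plane_drawing V E \<rho>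
  using framework by (rule noncrossing_plane_drawing)

abbreviation left :: "'v \<Rightarrow> 'v \<Rightarrow> complex set" where "left \<equiv> left_face V E \<rho>"
abbreviation V' :: "complex set set" where "V' \<equiv> faces V E \<rho>"
abbreviation E' :: "complex set set set" where "E' \<equiv> dual_edge V E \<rho> ` E"

text \<open>The reciprocal is a plane drawing too, so edges at its vertices have a rotation order.\<close>

sublocale D: plane_drawing V' E' \<rho>'
  using recip_noncrossing noncrossing_plane_drawing unfolding noncrossing_reciprocal_def by blast

lemma dual_inj: "inj_on (dual_edge V E \<rho>) E"
  using recip_noncrossing unfolding noncrossing_reciprocal_def by blast

lemma dual_edge_eq: "dual_edge V E \<rho> {a, b} = {left a b, left b a}"
  unfolding dual_edge_def by (auto simp: doubleton_eq_iff)

lemma reciprocal_dir: "{a, b} \<in> E \<Longrightarrow> \<rho>' (left b a) - \<rho>' (left a b) = - (of_real (\<omega> {a, b}) * (\<rho> b - \<rho> a))"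
  using recip unfolding reciprocal_def scaleR_conv_of_real by (metis minus_diff_eq)

lemma left_ne: "{a, b} \<in> E \<Longrightarrow> left a b \<noteq> left b a"
  using D.edgeD(3)[of "left a b" "left b a"] dual_edge_eq[of a b] by (metis imageI)

lemma degree: "v \<in> V \<Longrightarrow> \<exists>w. {v, w} \<in> E"
proof -
  assume v: "v \<in> V"
  have "card V > 2" "graph_connected (V - {}) E" using two_conn unfolding two_connected_def by auto
  moreover obtain u where "u \<in> V" "u \<noteq> v"
  proof -
    have "V \<noteq> {v}" using \<open>card V > 2\<close> by auto
    then show ?thesis using that v by blast
  qed
  ultimately have "(v, u) \<in> {(x, y). x \<in> V \<and> y \<in> V \<and> {x, y} \<in> E}\<^sup>*" using v by (simp add: graph_connected_def)
  then show ?thesis using \<open>u \<noteq> v\<close> by (cases rule: converse_rtranclE) auto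
qed

definition same_orientation :: bool where
  "same_orientation \<longleftrightarrow>
    (\<forall>F\<in>V'. map_prod (dual_edge V E \<rho>) (dual_edge V E \<rho>) ` face_cycle V E \<rho> F = vertex_cycle E' \<rho>' F)"

definition reversed_orientation :: bool where
  "reversed_orientation \<longleftrightarrow>
    (\<forall>F\<in>V'. map_prod (dual_edge V E \<rho>) (dual_edge V E \<rho>) ` face_cycle V E \<rho> F = (vertex_cycle E' \<rho>' F)\<inverse>)"

lemma orientation: "same_orientation \<or> reversed_orientation"
  using recip_noncrossing
  unfolding noncrossing_reciprocal_def dual_embedding_same_def dual_embedding_reversed_def
    same_orientation_def reversed_orientation_def Let_def by blast

definition dirn :: "'v list \<Rightarrow> nat \<Rightarrow> complex" where
  "dirn vs k = \<rho> (cyc_succ vs k) - \<rho> (vs ! k)"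

text \<open>Up to sign, the direction of the reciprocal edge dual to the \<open>k\<close>-th boundary edge.\<close>

definition stress_dirn :: "'v list \<Rightarrow> nat \<Rightarrow> complex" where
  "stress_dirn vs k = of_real (\<omega> {vs ! k, cyc_succ vs k}) * dirn vs k"

lemma has_dart:
  assumes F: "F \<in> V'"
  obtains a b where "{a, b} \<in> E" "left a b = F"
proof -
  have "\<exists>a b. {a, b} \<in> E \<and> left a b = F"
  proof (rule ccontr)
    assume no: "\<nexists>a b. {a, b} \<in> E \<and> left a b = F"
    define W where "W = \<Union>{closed_segment (\<rho> a) (\<rho> b) | a b. {a, b} \<in> E \<and> left a b = F}"
    have "W = {}" using no by (auto simp: W_def)
    moreover have "F \<in> components (- W)" unfolding W_def by (rule G.face_component_of_boundary[OF F degree])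
    ultimately have "F = UNIV" by simp
    then have "drawing V E \<rho> = {}" using G.face_disjoint[OF F] by simp
    moreover have "V \<noteq> {}" using two_conn by (auto simp: two_connected_def)
    ultimately show False by (auto simp: drawing_def)
  qed
  then show ?thesis using that by blast
qed

text \<open>The dual graph has no parallel edges, so a directed edge is determined by the faces on its two
sides.\<close>

lemma dart_unique:
  assumes "{a, b} \<in> E" "{c, d} \<in> E" "left a b = left c d" "left b a = left d c"
  shows "a = c \<and> b = d"
proof -
  have "{a, b} = {c, d}"
    using inj_onD[OF dual_inj, of "{a, b}" "{c, d}"] assms by (simp add: dual_edge_eq)
  then show ?thesis using left_ne[OF assms(1)] assms(3) by (auto simp: doubleton_eq_iff)
qed

text \<open>The directed edges with \<open>F\<close> on their left correspond to the edges at the reciprocal vertex of \<open>F\<close>,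
  and those form a single cycle. The correspondence of the cycles turns this into a closed walk along
  the boundary of \<open>F\<close>; its vertices are distinct because \<open>F\<close> has only one angle at each of them.
  The two sums are the full turn around the reciprocal vertex.\<close>

lemma face_walk:
  assumes F: "F \<in> V'"
  obtains vs where "boundary_cycle V E \<rho> F vs"
    "same_orientation \<Longrightarrow> (\<Sum>k<length vs. ccw_angle (stress_dirn vs k) (stress_dirn vs (Suc k mod length vs))) = 2 * pi"
    "\<not> same_orientation \<Longrightarrow> (\<Sum>k<length vs. ccw_angle (stress_dirn vs (Suc k mod length vs)) (stress_dirn vs k)) = 2 * pi"
proof -
  define N where "N = {H. {F, H} \<in> E'}"
  have dart_nbr: "left b a \<in> N" if "{a, b} \<in> E" "left a b = F" for a b
    using that dual_edge_eq[of a b] by (auto simp: N_def intro!: image_eqI[of _ _ "{a, b}"])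
  obtain a0 b0 where "{a0, b0} \<in> E" "left a0 b0 = F" using has_dart[OF F] by blast
  then have "N \<noteq> {}" using dart_nbr by blast
  then obtain Gs where Gs: "distinct Gs" "set Gs = N"
    "\<forall>i<length Gs. ccw_next E' \<rho>' F (Gs ! i) = cyc_succ Gs i"
    "(\<Sum>H\<in>N. vertex_angle E' \<rho>' F H) = 2 * pi"
    by (rule D.rotation_list[of F, folded N_def])
  have "\<exists>ab. {fst ab, snd ab} \<in> E \<and> left (fst ab) (snd ab) = F \<and> left (snd ab) (fst ab) = H" if H: "H \<in> N" for H
  proof -
    obtain e where e: "e \<in> E" "{F, H} = dual_edge V E \<rho> e" using H by (auto simp: N_def)
    then obtain a b where ab: "e = {a, b}"
      using G.simple unfolding simple_graph_def card_2_iff by blast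
    then have "{a, b} \<in> E" "{b, a} \<in> E" "{F, H} = {left a b, left b a}" using e by (auto simp: dual_edge_eq insert_commute)
    then consider "left a b = F \<and> left b a = H" | "left b a = F \<and> left a b = H" by (auto simp: doubleton_eq_iff)
    then show ?thesis
      using \<open>{a, b} \<in> E\<close> \<open>{b, a} \<in> E\<close> by cases (metis fst_conv snd_conv)+
  qed
  then obtain ab where ab: "\<And>H. H \<in> N \<Longrightarrow> {fst (ab H), snd (ab H)} \<in> E \<and>
      left (fst (ab H)) (snd (ab H)) = F \<and> left (snd (ab H)) (fst (ab H)) = H" by metis
  define a where "a H = fst (ab H)" for H
  define b where "b H = snd (ab H)" for H
  have dart: "{a H, b H} \<in> E" "left (a H) (b H) = F" "left (b H) (a H) = H" if "H \<in> N" for H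
    using ab[OF that] by (simp_all add: a_def b_def)
  have dart_eq: "c = a (left e c) \<and> e = b (left e c)" if "{c, e} \<in> E" "left c e = F" for c e
    using dart_unique[OF that(1) dart(1)[OF dart_nbr[OF that]]] dart[OF dart_nbr[OF that]] that by simp
  \<comment> \<open>A pair in the face cycle has the form \<open>{i, j}\<close>, \<open>{j, k}\<close> with \<open>F\<close> in the angle at \<open>j\<close>, so both
     edges have \<open>F\<close> on the left when traversed from \<open>i\<close> over \<open>j\<close> to \<open>k\<close>.\<close>
  have consecutive: "b H = a H'"
    if H: "H \<in> N" and H': "H' \<in> N"
      and HH: "({F, H}, {F, H'}) \<in> map_prod (dual_edge V E \<rho>) (dual_edge V E \<rho>) ` face_cycle V E \<rho> F" for H H'
  proof -
    obtain i j k where ijk: "{i, j} \<in> E" "{j, k} \<in> E" "left i j = F" "ccw_next E \<rho> j k = i"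
      "{F, H} = dual_edge V E \<rho> {i, j}" "{F, H'} = dual_edge V E \<rho> {j, k}"
      using HH by (auto simp: face_cycle_def)
    have "left j k = F" using G.corner[OF ijk(2)] ijk(3,4) by simp
    moreover have "left j i = H" using ijk(3,5) left_ne[OF ijk(1)] by (auto simp: dual_edge_eq doubleton_eq_iff)
    moreover have "left k j = H'" using \<open>left j k = F\<close> ijk(6) left_ne[OF ijk(2)] by (auto simp: dual_edge_eq doubleton_eq_iff)
    ultimately have "j = b H" "j = a H'" using dart_eq[OF ijk(1,3)] dart_eq[OF ijk(2)] by simp_all
    then show ?thesis by simp
  qed
  have vc: "({F, Gs ! k}, {F, cyc_succ Gs k}) \<in> vertex_cycle E' \<rho>' F" if k: "k < length Gs" for k
  proof -
    have "Gs ! k \<in> N" using k Gs(2) nth_mem by blast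
    then have "{F, Gs ! k} \<in> E'" unfolding N_def by (rule CollectD)
    moreover have "ccw_next E' \<rho>' F (Gs ! k) = cyc_succ Gs k" using Gs(3) k by blast
    ultimately show ?thesis unfolding vertex_cycle_def by blast
  qed
  have succ_N: "cyc_succ Hs k \<in> N" if "set Hs = N" "k < length Hs" for Hs k
    using that unfolding cyc_succ_def by (metis nth_mem mod_less_divisor gr_implies_not0 neq0_conv)
  \<comment> \<open>The neighbours in the order of the boundary walk of \<open>F\<close>.\<close>
  define Hs where "Hs = (if same_orientation then Gs else rev Gs)"
  have Hs: "distinct Hs" "set Hs = N" "length Hs = length Gs" using Gs by (auto simp: Hs_def)
  have step: "b (Hs ! k) = a (cyc_succ Hs k) \<and>
      (if same_orientation then ccw_next E' \<rho>' F (Hs ! k) = cyc_succ Hs k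
       else ccw_next E' \<rho>' F (cyc_succ Hs k) = Hs ! k)" if k: "k < length Hs" for k
  proof (cases same_orientation)
    case True
    then have "Hs = Gs" by (simp add: Hs_def)
    moreover have "b (Gs ! k) = a (cyc_succ Gs k)"
      using True F vc k Hs(3) Gs(2) succ_N[OF Gs(2)] unfolding same_orientation_def
      by (intro consecutive) auto
    ultimately show ?thesis using True Gs(3) k by simp
  next
    case False
    then have rev: "Hs = rev Gs" by (simp add: Hs_def)
    define j where "j = (length Gs - Suc k + length Gs - 1) mod length Gs"
    have kj: "k < length Gs" "j < length Gs" using k Hs(3) by (auto simp: j_def intro!: mod_less_divisor)
    have "cyc_succ Hs k = Gs ! j" unfolding rev cyc_rev(1)[OF kj(1)] by (simp add: cyc_pred_def j_def)
    moreover have "Hs ! k = cyc_succ Gs j"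
      unfolding rev j_def by (subst cyc_succ_pred) (use kj in \<open>auto simp: rev_nth\<close>)
    moreover have "b (cyc_succ Gs j) = a (Gs ! j)"
    proof (rule consecutive)
      have "reversed_orientation" using False orientation by simp
      then show "({F, cyc_succ Gs j}, {F, Gs ! j}) \<in> map_prod (dual_edge V E \<rho>) (dual_edge V E \<rho>) ` face_cycle V E \<rho> F"
        using F vc[OF kj(2)] unfolding reversed_orientation_def by simp
    qed (use succ_N[OF Gs(2) kj(2)] kj Gs(2) in auto)
    ultimately show ?thesis using False Gs(3) kj by simp
  qed
  define vs where "vs = map a Hs"
  have len: "length vs = length Hs" by (simp add: vs_def)
  have at: "vs ! k = a (Hs ! k)" "cyc_succ vs k = b (Hs ! k)" if "k < length Hs" for k
    using that step[OF that] by (simp_all add: vs_def cyc_succ_map)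
  have memN: "Hs ! k \<in> N" if "k < length Hs" for k using that Hs(2) nth_mem by blast
  have darts: "{(i, j). {i, j} \<in> E \<and> left i j = F} = {(vs ! k, cyc_succ vs k) | k. k < length vs}"
  proof (intro subset_antisym subsetI)
    fix x assume "x \<in> {(i, j). {i, j} \<in> E \<and> left i j = F}"
    then obtain i j where ij: "x = (i, j)" "{i, j} \<in> E" "left i j = F" by blast
    then obtain k where "k < length Hs" "Hs ! k = left j i" using dart_nbr Hs(2) by (metis in_set_conv_nth)
    then show "x \<in> {(vs ! k, cyc_succ vs k) | k. k < length vs}"
      using at[of k] dart_eq[OF ij(2,3)] ij(1) len by auto
  next
    fix x assume "x \<in> {(vs ! k, cyc_succ vs k) | k. k < length vs}"
    then obtain k where "k < length Hs" "x = (a (Hs ! k), b (Hs ! k))" using at len by auto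
    then show "x \<in> {(i, j). {i, j} \<in> E \<and> left i j = F}" using dart memN by auto
  qed
  have "inj_on a N"
  proof (rule inj_onI)
    fix H H' assume H: "H \<in> N" "H' \<in> N" "a H = a H'"
    then have "b H = b H'"
      using G.one_angle_per_face[OF two_conn, of "a H" "b H" "b H'"] dart by metis
    then show "H = H'" using dart(3) H by metis
  qed
  then have dist: "distinct vs" using Hs by (simp add: vs_def distinct_map)
  have "3 \<le> length vs"
  proof (rule ccontr)
    assume "\<not> 3 \<le> length vs"
    moreover have "length vs \<noteq> 0" using \<open>N \<noteq> {}\<close> Hs(2) len by auto
    ultimately consider "length Hs = 1" | "length Hs = 2" using len by linarith
    then show False
    proof cases
      case 1
      then show False using step[of 0] dart(1)[OF memN[of 0]] G.edgeD(3) by (fastforce simp: cyc_succ_def)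
    next
      case 2
      then have "b (Hs ! 0) = a (Hs ! 1)" "b (Hs ! 1) = a (Hs ! 0)"
        using step[of 0] step[of 1] by (simp_all add: cyc_succ_def)
      then show False using dart[OF memN[of 0]] dart[OF memN[of 1]] left_ne[of "a (Hs ! 0)" "b (Hs ! 0)"] 2 by auto
    qed
  qed
  then have bc: "boundary_cycle V E \<rho> F vs" unfolding boundary_cycle_def using dist darts by simp
  have dir: "\<rho>' (Hs ! k) - \<rho>' F = - stress_dirn vs k" if k: "k < length Hs" for k
    using reciprocal_dir[OF dart(1)[OF memN[OF k]]] dart[OF memN[OF k]] at[OF k]
    by (simp add: stress_dirn_def dirn_def)
  have succ_idx: "cyc_succ Hs k = Hs ! (Suc k mod length Hs)" "Suc k mod length Hs < length Hs" if "k < length Hs" for k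
    using that by (auto simp: cyc_succ_def intro!: mod_less_divisor)
  have "(\<Sum>k<length vs. ccw_angle (stress_dirn vs k) (stress_dirn vs (Suc k mod length vs))) = 2 * pi" if s: same_orientation
  proof -
    have "2 * pi = (\<Sum>k<length Hs. vertex_angle E' \<rho>' F (Hs ! k))"
      using sum.reindex_bij_betw[OF bij_betw_nth[OF Hs(1) refl refl], of "vertex_angle E' \<rho>' F"] Hs(2) Gs(4)
      by (simp add: lessThan_atLeast0)
    also have "\<dots> = (\<Sum>k<length Hs. ccw_angle (stress_dirn vs k) (stress_dirn vs (Suc k mod length vs)))"
    proof (rule sum.cong)
      fix k assume "k \<in> {..<length Hs}"
      then have k: "k < length Hs" by simp
      show "vertex_angle E' \<rho>' F (Hs ! k) = ccw_angle (stress_dirn vs k) (stress_dirn vs (Suc k mod length vs))"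
        using step[OF k] s dir[OF k] dir[OF succ_idx(2)[OF k]] succ_idx(1)[OF k] len
        by (simp add: vertex_angle_def ccw_angle_minus_minus)
    qed simp
    finally show ?thesis using len by simp
  qed
  moreover have "(\<Sum>k<length vs. ccw_angle (stress_dirn vs (Suc k mod length vs)) (stress_dirn vs k)) = 2 * pi" if s: "\<not> same_orientation"
  proof -
    have "2 * pi = (\<Sum>k<length Hs. vertex_angle E' \<rho>' F (Hs ! k))"
      using sum.reindex_bij_betw[OF bij_betw_nth[OF Hs(1) refl refl], of "vertex_angle E' \<rho>' F"] Hs(2) Gs(4)
      by (simp add: lessThan_atLeast0)
    also have "\<dots> = (\<Sum>k<length Hs. vertex_angle E' \<rho>' F (Hs ! (k mod length Hs)))"
      by (rule sum.cong) auto
    also have "\<dots> = (\<Sum>k<length Hs. vertex_angle E' \<rho>' F (Hs ! ((1 + k) mod length Hs)))"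
      by (rule sum_periodic[symmetric]) simp
    also have "\<dots> = (\<Sum>k<length Hs. ccw_angle (stress_dirn vs (Suc k mod length vs)) (stress_dirn vs k))"
    proof (rule sum.cong)
      fix k assume "k \<in> {..<length Hs}"
      then have k: "k < length Hs" by simp
      show "vertex_angle E' \<rho>' F (Hs ! ((1 + k) mod length Hs)) = ccw_angle (stress_dirn vs (Suc k mod length vs)) (stress_dirn vs k)"
        using step[OF k] s dir[OF k] dir[OF succ_idx(2)[OF k]] succ_idx(1)[OF k] len
        by (simp add: vertex_angle_def ccw_angle_minus_minus)
    qed simp
    finally show ?thesis using len by simp
  qed
  ultimately show ?thesis using that[OF bc] by blast
qed

end

section \<open>Counting corners and sign changes\<close>

lemma polygon_boundary_rev: "polygon_boundary (rev xs) = polygon_boundary xs"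
proof -
  have "polygon_boundary (rev xs) \<subseteq> polygon_boundary xs" for xs
    unfolding polygon_boundary_def
  proof (rule UN_least)
    fix k assume "k \<in> {..<length (rev xs)}"
    then have k: "k < length xs" by simp
    define j where "j = length xs - Suc k"
    define i where "i = (j + length xs - 1) mod length xs"
    have j: "j < length xs" and i: "i < length xs" using k by (auto simp: i_def j_def intro!: mod_less_divisor)
    have "rev xs ! k = cyc_succ xs i" using k cyc_succ_pred[OF j] by (simp add: rev_nth i_def j_def)
    moreover have "cyc_succ (rev xs) k = xs ! i" unfolding cyc_rev(1)[OF k] by (simp add: cyc_pred_def i_def j_def)
    ultimately have "closed_segment (rev xs ! k) (cyc_succ (rev xs) k) = closed_segment (xs ! i) (cyc_succ xs i)"
      by (simp add: closed_segment_commute)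
    also have "\<dots> \<subseteq> (\<Union>i<length xs. closed_segment (xs ! i) (cyc_succ xs i))"
      using i by (intro UN_upper) simp
    finally show "closed_segment (rev xs ! k) (cyc_succ (rev xs) k) \<subseteq>
        (\<Union>i<length xs. closed_segment (xs ! i) (cyc_succ xs i))" .
  qed
  from this[of xs] this[of "rev xs"] show ?thesis by simp
qed

lemma sum_balance:
  fixes n :: nat and x :: real
  assumes "S \<subseteq> {..<n}" "C \<subseteq> {..<n}"
  shows "(\<Sum>k<n. if k \<in> S then 0 else if k \<in> C then x else - x) =
    (real (card (C - S)) - real (card ({..<n} - C - S))) * x"
proof -
  have "(\<Sum>k<n. if k \<in> S then 0 else if k \<in> C then x else - x) =
      (\<Sum>k<n. (if k \<in> C - S then x else 0) - (if k \<in> {..<n} - C - S then x else 0))"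
    by (rule sum.cong) auto
  also have "\<dots> = (\<Sum>k\<in>{..<n} \<inter> (C - S). x) - (\<Sum>k\<in>{..<n} \<inter> ({..<n} - C - S). x)"
    by (simp only: sum_subtractf sum.inter_restrict finite_lessThan)
  also have "{..<n} \<inter> (C - S) = C - S" using assms by auto
  also have "{..<n} \<inter> ({..<n} - C - S) = {..<n} - C - S" by auto
  finally show ?thesis by (simp add: algebra_simps)
qed

lemma card_split:
  assumes "S \<subseteq> {..<n}" "C \<subseteq> {..<n}"
  shows "card C = card (C - S) + card (S \<inter> C)" "card S = card (S \<inter> C) + card (S - C)"
    "n = card (C - S) + card (S \<inter> C) + card ({..<n} - C - S) + card (S - C)"
proof -
  have fin: "finite S" "finite C" using assms finite_subset by auto
  show C: "card C = card (C - S) + card (S \<inter> C)" using card_Int_Diff[OF fin(2), of S] by (simp add: Int_commute)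
  show "card S = card (S \<inter> C) + card (S - C)" using card_Int_Diff[OF fin(1), of C] .
  have "n = card ({..<n} \<inter> C) + card ({..<n} - C)" using card_Int_Diff[of "{..<n}" C] by simp
  also have "{..<n} \<inter> C = C" using assms by auto
  also have "card ({..<n} - C) = card (({..<n} - C) \<inter> S) + card ({..<n} - C - S)" by (rule card_Int_Diff) simp
  also have "({..<n} - C) \<inter> S = S - C" using assms by auto
  finally show "n = card (C - S) + card (S \<inter> C) + card ({..<n} - C - S) + card (S - C)" using C by simp
qed

lemma shift_sum:
  fixes g :: "nat \<Rightarrow> nat \<Rightarrow> real"
  assumes "0 < n"
  shows "(\<Sum>k<n. g (Suc k mod n) k) = (\<Sum>k<n. g k ((k + n - 1) mod n))"
proof -
  define h where "h k = g (k mod n) ((k + n - 1) mod n)" for k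
  have per: "h (k + n) = h k" for k
  proof -
    have "k + n + n - 1 = (k + n - 1) + n" using assms by simp
    then show ?thesis by (simp add: h_def)
  qed
  have "(\<Sum>k<n. g (Suc k mod n) k) = (\<Sum>k<n. h (1 + k))" by (rule sum.cong) (auto simp: h_def)
  also have "\<dots> = (\<Sum>k<n. h k)" by (rule sum_periodic) (rule per)
  also have "\<dots> = (\<Sum>k<n. g k ((k + n - 1) mod n))" by (rule sum.cong) (auto simp: h_def)
  finally show ?thesis .
qed

text \<open>Around a cycle, a change of a two-valued function must be undone by a second change.\<close>

lemma cyclic_constant:
  fixes \<sigma> :: "nat \<Rightarrow> bool"
  assumes one: "\<And>i j. i < m \<Longrightarrow> j < m \<Longrightarrow> \<sigma> i \<noteq> \<sigma> (Suc i mod m) \<Longrightarrow> \<sigma> j \<noteq> \<sigma> (Suc j mod m) \<Longrightarrow> i = j"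
    and "i < m" "j < m"
  shows "\<sigma> i = \<sigma> j"
proof -
  have m: "0 < m" using assms by simp
  have "\<exists>i0<m. \<forall>i<m. i \<noteq> i0 \<longrightarrow> \<sigma> i = \<sigma> (Suc i mod m)"
  proof (cases "\<exists>i0<m. \<sigma> i0 \<noteq> \<sigma> (Suc i0 mod m)")
    case True
    then show ?thesis using one by blast
  next
    case False
    then show ?thesis using m by blast
  qed
  then obtain i0 where i0: "i0 < m" "\<And>i. i < m \<Longrightarrow> i \<noteq> i0 \<Longrightarrow> \<sigma> i = \<sigma> (Suc i mod m)" by blast
  have const: "\<sigma> ((Suc i0 + k) mod m) = \<sigma> (Suc i0 mod m)" if "k < m" for k
    using that
  proof (induction k)
    case (Suc k)
    have "(Suc i0 + k) mod m \<noteq> i0"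
    proof
      assume "(Suc i0 + k) mod m = i0"
      then have "(Suc i0 + k) mod m = i0 mod m" using i0(1) by simp
      then have "m dvd (Suc i0 + k) - i0" using mod_eq_dvd_iff_nat[of i0 "Suc i0 + k" m] by simp
      then have "m dvd Suc k" by simp
      then show False using Suc.prems by (auto dest: dvd_imp_le)
    qed
    then have "\<sigma> ((Suc i0 + k) mod m) = \<sigma> (Suc ((Suc i0 + k) mod m) mod m)" using m by (intro i0(2)) auto
    also have "Suc ((Suc i0 + k) mod m) mod m = (Suc i0 + Suc k) mod m" by (simp add: mod_Suc_eq)
    finally show ?case using Suc by simp
  qed simp
  have "\<sigma> i = \<sigma> (Suc i0 mod m)" if "i < m" for i
  proof -
    define k where "k = (i + (m - Suc i0)) mod m"
    have "(Suc i0 + k) mod m = (Suc i0 + (i + (m - Suc i0))) mod m" by (simp add: k_def mod_add_right_eq del: add_Suc)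
    also have "Suc i0 + (i + (m - Suc i0)) = i + m" using i0(1) by simp
    finally have "(Suc i0 + k) mod m = i" using that by simp
    then show ?thesis using const[of k] m by (simp add: k_def)
  qed
  then show ?thesis using assms by blast
qed

text \<open>The non-corners alone contribute at least \<open>(n - card (corners ps)) * pi\<close> to the angle sum
\<open>(n - 2) * pi\<close>, and the corners a positive amount.\<close>

lemma (in polygon) three_corners: "ccw_polygon ps \<Longrightarrow> 3 \<le> card (corners ps)"
proof -
  assume ccw: "ccw_polygon ps"
  have C: "corners ps \<subseteq> {..<n}" by (auto simp: corners_def)
  have "(\<Sum>k<n. if k \<in> corners ps then 0 else pi) < (\<Sum>k<n. interior_angle ps k)"
  proof (rule sum_strict_mono)
    show "(if k \<in> corners ps then 0 else pi) < interior_angle ps k" if "k \<in> {..<n}" for k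
      using that ccw_angle_range(1) by (auto simp: corners_def interior_angle_def)
    have "0 < n" using n3 by linarith
    then show "{..<n} \<noteq> {}" by (simp add: lessThan_empty_iff)
  qed simp
  moreover have "(\<Sum>k<n. if k \<in> corners ps then 0 else pi) = (real n - card (corners ps)) * pi"
  proof -
    have "(\<Sum>k<n. if k \<in> corners ps then 0 else pi) = (\<Sum>k<n. pi - (if k \<in> corners ps then pi else 0))"
      by (rule sum.cong) auto
    also have "\<dots> = real n * pi - (\<Sum>k\<in>{..<n} \<inter> corners ps. pi)"
      by (simp only: sum_subtractf sum.inter_restrict finite_lessThan) simp
    also have "{..<n} \<inter> corners ps = corners ps" using C by auto
    finally show ?thesis by (simp add: algebra_simps)
  qed
  ultimately have "(real n - card (corners ps)) * pi < (real n - 2) * pi" using interior_angle_sum[OF ccw] by simp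
  then have "2 < real (card (corners ps))" by simp
  then show ?thesis by simp
qed

text \<open>A full angle would put both neighbours of a vertex on one ray.\<close>

lemma (in polygon) interior_angle_less: "k < n \<Longrightarrow> interior_angle ps k < 2 * pi"
proof (rule ccontr)
  assume k: "k < n" and "\<not> interior_angle ps k < 2 * pi"
  then have full: "interior_angle ps k = 2 * pi" using ccw_angle_range(2) by (auto simp: interior_angle_def antisym)
  have e: "{ps ! k, cyc_succ ps k} \<in> poly_edges ps" "{ps ! k, cyc_pred ps k} \<in> poly_edges ps" using nbrs[OF k] by auto
  then have "cyc_succ ps k - ps ! k \<noteq> 0" "cyc_pred ps k - ps ! k \<noteq> 0" using edgeD(3)[OF e(1)] edgeD(3)[OF e(2)] by auto
  then obtain r where "0 < r" "cyc_pred ps k - ps ! k = of_real r * (cyc_succ ps k - ps ! k)"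
    using ccw_angle_full_ray full unfolding interior_angle_def by metis
  then have "cyc_succ ps k = cyc_pred ps k" using distinct_rays[OF e] by blast
  then show False using succ_ne_pred[OF k] by simp
qed

context reciprocal_pair begin

lemma face_edges:
  assumes "boundary_cycle V E \<rho> F vs" "k < length vs"
  shows "{vs ! k, cyc_succ vs k} \<in> E" "left (vs ! k) (cyc_succ vs k) = F"
    "{cyc_pred vs k, vs ! k} \<in> E" "left (cyc_pred vs k) (vs ! k) = F"
proof -
  have *: "{vs ! k, cyc_succ vs k} \<in> E \<and> left (vs ! k) (cyc_succ vs k) = F" if "k < length vs" for k
  proof -
    have "(vs ! k, cyc_succ vs k) \<in> {(i, j). {i, j} \<in> E \<and> left i j = F}"
      using assms(1) that unfolding boundary_cycle_def by auto
    then show ?thesis by simp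
  qed
  then show "{vs ! k, cyc_succ vs k} \<in> E" "left (vs ! k) (cyc_succ vs k) = F" using assms(2) by auto
  let ?p = "(k + length vs - 1) mod length vs"
  have "?p < length vs" using assms(2) by (intro mod_less_divisor) auto
  then show "{cyc_pred vs k, vs ! k} \<in> E" "left (cyc_pred vs k) (vs ! k) = F"
    using *[of ?p] cyc_succ_pred[OF assms(2)] by (simp_all add: cyc_pred_def)
qed

lemma face_polygon:
  assumes F: "F \<in> V'" and bc: "boundary_cycle V E \<rho> F vs"
  shows "simple_polygon (map \<rho> vs)" "simple_polygon (map \<rho> (rev vs))"
    "F \<in> {polygon_interior (map \<rho> vs), outside (polygon_boundary (map \<rho> vs))}"
proof -
  have vs: "distinct vs" "3 \<le> length vs" using bc by (auto simp: boundary_cycle_def)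
  show sp: "simple_polygon (map \<rho> vs)"
    by (rule G.cycle_simple_polygon[OF vs face_edges(1)[OF bc]])
  show "simple_polygon (map \<rho> (rev vs))"
  proof (rule G.cycle_simple_polygon)
    fix i assume i: "i < length (rev vs)"
    then have j: "length vs - Suc i < length vs" by simp
    show "{rev vs ! i, cyc_succ (rev vs) i} \<in> E"
      using face_edges(3)[OF bc j] cyc_rev(1)[of i vs] i by (simp add: rev_nth insert_commute)
  qed (use vs in auto)
  interpret p: polygon "map \<rho> vs" by unfold_locales (rule sp)
  have "\<Union>{closed_segment (\<rho> a) (\<rho> b) | a b. {a, b} \<in> E \<and> left a b = F} = polygon_boundary (map \<rho> vs)" (is "?W = _")
  proof
    show "?W \<subseteq> polygon_boundary (map \<rho> vs)"
    proof
      fix x assume "x \<in> ?W"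
      then obtain a b where ab: "(a, b) \<in> {(i, j). {i, j} \<in> E \<and> left i j = F}" "x \<in> closed_segment (\<rho> a) (\<rho> b)" by blast
      then obtain k where "k < length vs" "a = vs ! k" "b = cyc_succ vs k"
        using bc unfolding boundary_cycle_def by auto
      then show "x \<in> polygon_boundary (map \<rho> vs)"
        using ab(2) by (auto simp: polygon_boundary_def cyc_succ_map)
    qed
    show "polygon_boundary (map \<rho> vs) \<subseteq> ?W"
    proof
      fix x assume "x \<in> polygon_boundary (map \<rho> vs)"
      then obtain k where k: "k < length vs" "x \<in> closed_segment (\<rho> (vs ! k)) (\<rho> (cyc_succ vs k))"
        by (auto simp: polygon_boundary_def cyc_succ_map)
      then show "x \<in> ?W" using face_edges(1,2)[OF bc k(1)] by blast
    qed
  qed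
  then have "F \<in> components (- polygon_boundary (map \<rho> vs))"
    using G.face_component_of_boundary[OF F degree] by simp
  then show "F \<in> {polygon_interior (map \<rho> vs), outside (polygon_boundary (map \<rho> vs))}"
    using p.components_eq by simp
qed

lemma bounded_face_polygon:
  assumes F: "F \<in> V'" and bc: "boundary_cycle V E \<rho> F vs" and "bounded F"
  shows "F = polygon_interior (map \<rho> vs)" "ccw_polygon (map \<rho> vs)"
proof -
  interpret p: polygon "map \<rho> vs" by unfold_locales (rule face_polygon(1)[OF F bc])
  show eq: "F = polygon_interior (map \<rho> vs)" using face_polygon(3)[OF F bc] p.Jordan(8) assms(3) by auto
  show "ccw_polygon (map \<rho> vs)" unfolding ccw_polygon_def
  proof (intro conjI allI impI)
    show "simple_polygon (map \<rho> vs)" by (rule face_polygon(1)[OF F bc])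
    fix i assume "i < length (map \<rho> vs)"
    then show "on_left (map \<rho> vs ! i) (cyc_succ (map \<rho> vs) i) (polygon_interior (map \<rho> vs))"
      using face_edges(2)[OF bc, of i] G.left_face(2)[OF face_edges(1)[OF bc, of i]] eq by (simp add: cyc_succ_map)
  qed
qed

text \<open>The boundary of the outer face runs clockwise around the complement. The face on the other side of
each edge is contained in the inside of the polygon, which puts the inside on the left of the
reversed list.\<close>

lemma unbounded_face_polygon:
  assumes F: "F \<in> V'" and bc: "boundary_cycle V E \<rho> F vs" and "\<not> bounded F"
  shows "- F = polygon_region (map \<rho> (rev vs))" "ccw_polygon (map \<rho> (rev vs))"
proof -
  interpret p: polygon "map \<rho> vs" by unfold_locales (rule face_polygon(1)[OF F bc])
  have eq: "F = outside (polygon_boundary (map \<rho> vs))" using face_polygon(3)[OF F bc] p.Jordan(4) assms(3) by auto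
  have bd: "polygon_boundary (map \<rho> (rev vs)) = polygon_boundary (map \<rho> vs)"
    using polygon_boundary_rev[of "map \<rho> vs"] by (simp add: rev_map)
  have int: "polygon_interior (map \<rho> (rev vs)) = polygon_interior (map \<rho> vs)"
    by (simp add: polygon_interior_def bd)
  show "- F = polygon_region (map \<rho> (rev vs))"
    unfolding polygon_region_def int bd eq using outside_inside[of "polygon_boundary (map \<rho> vs)"]
    by (simp add: polygon_interior_def)
  show "ccw_polygon (map \<rho> (rev vs))" unfolding ccw_polygon_def
  proof (intro conjI allI impI)
    show "simple_polygon (map \<rho> (rev vs))" by (rule face_polygon(2)[OF F bc])
    fix i assume i: "i < length (map \<rho> (rev vs))"
    define j where "j = length vs - Suc i"
    have j: "j < length vs" using i by (simp add: j_def)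
    have e: "{cyc_pred vs j, vs ! j} \<in> E" "{vs ! j, cyc_pred vs j} \<in> E" "left (cyc_pred vs j) (vs ! j) = F"
      using face_edges(3,4)[OF bc j] by (auto simp: insert_commute)
    define H where "H = left (vs ! j) (cyc_pred vs j)"
    have H: "H \<in> V'" using G.left_face(1)[OF e(2)] by (simp add: H_def)
    have "H \<noteq> F" using left_ne[OF e(1)] e(3) by (simp add: H_def)
    then have "H \<inter> F = {}" using G.face_eq[OF H F] by blast
    moreover have "polygon_boundary (map \<rho> vs) \<subseteq> drawing V E \<rho>"
      by (rule G.polygon_boundary_in_drawing[OF face_edges(1)[OF bc]])
    then have "H \<subseteq> - polygon_boundary (map \<rho> vs)" using G.face_disjoint[OF H] by blast
    ultimately have "H \<subseteq> polygon_interior (map \<rho> vs)" using p.Jordan(10) eq by blast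
    then have "on_left (\<rho> (vs ! j)) (\<rho> (cyc_pred vs j)) (polygon_interior (map \<rho> vs))"
      using G.left_face(2)[OF e(2)] on_left_mono unfolding H_def by blast
    then show "on_left (map \<rho> (rev vs) ! i) (cyc_succ (map \<rho> (rev vs)) i) (polygon_interior (map \<rho> (rev vs)))"
      using i by (simp add: int cyc_succ_map cyc_rev j_def rev_nth)
  qed
qed

text \<open>Here \<open>p\<close> is the index of the edge that enters vertex \<open>k\<close>; the edge leaving it has index \<open>k\<close>.\<close>

lemma sign_change_angles:
  assumes bc: "boundary_cycle V E \<rho> F vs" and k: "k < length vs"
  defines "p \<equiv> (k + length vs - 1) mod length vs"
  shows "ccw_angle (stress_dirn vs k) (stress_dirn vs p) = interior_angle (map \<rho> vs) k +
      (if k \<in> sign_changes \<omega> vs then 0 else if k \<in> corners (map \<rho> vs) then pi else - pi)"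
    and "pi - interior_angle (map \<rho> vs) k \<le> ccw_angle (stress_dirn vs p) (stress_dirn vs k)"
    and "k \<in> sign_changes \<omega> vs \<Longrightarrow>
      pi - interior_angle (map \<rho> vs) k < ccw_angle (stress_dirn vs p) (stress_dirn vs k)"
proof -
  have p: "vs ! p = cyc_pred vs k" "cyc_succ vs p = vs ! k"
    using cyc_succ_pred[OF k] by (simp_all add: p_def cyc_pred_def)
  note e = face_edges(1,3)[OF bc k]
  define s where "s = \<omega> {vs ! k, cyc_succ vs k}"
  define t where "t = \<omega> {cyc_pred vs k, vs ! k}"
  have nz: "dirn vs k \<noteq> 0" "dirn vs p \<noteq> 0" "s \<noteq> 0" "t \<noteq> 0"
    using e G.edgeD(4)[OF e(1)] G.edgeD(4)[OF e(2)] nonzero by (auto simp: dirn_def p s_def t_def)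
  have sd: "stress_dirn vs k = of_real s * dirn vs k" "stress_dirn vs p = of_real t * dirn vs p"
    by (simp_all add: stress_dirn_def s_def t_def p)
  have S: "k \<in> sign_changes \<omega> vs \<longleftrightarrow> s * t < 0" using k by (simp add: sign_changes_def s_def t_def mult.commute)
  have ang: "interior_angle (map \<rho> vs) k = ccw_angle (dirn vs k) (- dirn vs p)"
    using k by (simp add: interior_angle_def dirn_def p cyc_succ_map cyc_pred_map)
  have C: "k \<in> corners (map \<rho> vs) \<longleftrightarrow> ccw_angle (dirn vs k) (- dirn vs p) \<le> pi"
    using k by (simp add: corners_def ang)
  show "ccw_angle (stress_dirn vs k) (stress_dirn vs p) = interior_angle (map \<rho> vs) k +
      (if k \<in> sign_changes \<omega> vs then 0 else if k \<in> corners (map \<rho> vs) then pi else - pi)"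
    unfolding sd S C ang by (rule reversed_angle[OF nz])
  show "pi - interior_angle (map \<rho> vs) k \<le> ccw_angle (stress_dirn vs p) (stress_dirn vs k)"
    "k \<in> sign_changes \<omega> vs \<Longrightarrow>
      pi - interior_angle (map \<rho> vs) k < ccw_angle (stress_dirn vs p) (stress_dirn vs k)"
    unfolding sd S ang using same_angle[OF nz] by blast+
qed

text \<open>The exterior angles of a bounded face already add up to the \<open>2 * pi\<close> available at the
reciprocal vertex, so no vertex may contribute more than its exterior angle.\<close>

lemma no_sign_change_same:
  assumes same_orientation and F: "F \<in> V'" and "bounded F"
    and e: "{v, w} \<in> E" "left v w = F"
  shows "0 < \<omega> {v, w} * \<omega> {v, ccw_next E \<rho> v w}"
proof -
  obtain vs where bc: "boundary_cycle V E \<rho> F vs"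
    and sum: "same_orientation \<Longrightarrow> (\<Sum>k<length vs. ccw_angle (stress_dirn vs k) (stress_dirn vs (Suc k mod length vs))) = 2 * pi"
    using face_walk[OF F] by metis
  let ?n = "length vs" and ?p = "\<lambda>k. (k + length vs - 1) mod length vs"
  have n: "3 \<le> ?n" and dist: "distinct vs" using bc by (auto simp: boundary_cycle_def)
  interpret p: polygon "map \<rho> vs" by unfold_locales (rule face_polygon(1)[OF F bc])
  have total: "(\<Sum>k<?n. ccw_angle (stress_dirn vs (?p k)) (stress_dirn vs k)) = 2 * pi"
  proof -
    have "0 < ?n" using n by linarith
    from shift_sum[OF this, of "\<lambda>i j. ccw_angle (stress_dirn vs j) (stress_dirn vs i)"] show ?thesis
      using sum[OF assms(1)] by simp
  qed
  have angles: "(\<Sum>k<?n. pi - interior_angle (map \<rho> vs) k) = 2 * pi"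
    using p.interior_angle_sum[OF bounded_face_polygon(2)[OF F bc assms(3)]]
    by (simp add: sum_subtractf algebra_simps)
  have none: "k \<notin> sign_changes \<omega> vs" if k: "k < ?n" for k
  proof
    assume "k \<in> sign_changes \<omega> vs"
    then have "(\<Sum>k<?n. pi - interior_angle (map \<rho> vs) k) <
        (\<Sum>k<?n. ccw_angle (stress_dirn vs (?p k)) (stress_dirn vs k))"
      using sign_change_angles(2,3)[OF bc] k by (intro sum_strict_mono_ex1) auto
    then show False using total angles by simp
  qed
  let ?u = "ccw_next E \<rho> v w"
  have u: "{?u, v} \<in> E" "left ?u v = F" using G.ccw_next_min(1)[OF e(1)] G.corner[OF e(1)] e(2) by (auto simp: insert_commute)
  obtain k where k: "k < ?n" "v = vs ! k" "w = cyc_succ vs k" using bc e unfolding boundary_cycle_def by blast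
  obtain j where j: "j < ?n" "?u = vs ! j" "v = cyc_succ vs j" using bc u unfolding boundary_cycle_def by blast
  have "Suc j mod ?n < ?n" using n by (intro mod_less_divisor) auto
  then have "k = Suc j mod ?n" using k(1,2) j(3) dist by (simp add: cyc_succ_def nth_eq_iff_index_eq)
  then have "cyc_pred vs k = ?u" using cyc_pred_succ[OF j(1)] j(2) by simp
  then have "\<not> \<omega> {?u, v} * \<omega> {v, w} < 0" using none[OF k(1)] k by (simp add: sign_changes_def)
  moreover have "\<omega> {?u, v} \<noteq> 0" "\<omega> {v, w} \<noteq> 0" using nonzero u e by auto
  ultimately have "0 < \<omega> {?u, v} * \<omega> {v, w}" by (simp add: not_less less_le)
  then show ?thesis by (simp add: insert_commute mult.commute)
qed

text \<open>Around an extreme vertex the stress cannot change sign within a bounded face, and at most one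
  of the angles there belongs to the outer face. A single change around a cycle is impossible, so
  all edges have the same sign. But these edges point into a half-plane, and then they cannot be in
  equilibrium.\<close>

lemma not_same: "\<not> same_orientation"
proof
  assume same: same_orientation
  have "V \<noteq> {}" using two_conn by (auto simp: two_connected_def)
  then have "\<rho> ` V \<noteq> {}" "finite (\<rho> ` V)" using G.finite_V by auto
  then obtain z where z: "z \<in> \<rho> ` V"
    "\<And>w. w \<in> \<rho> ` V \<Longrightarrow> w \<noteq> z \<Longrightarrow> Im z < Im w \<or> Im z = Im w \<and> Re z < Re w"
    using lex_min[of "\<rho> ` V"] by metis
  then obtain v where v: "v \<in> V" "z = \<rho> v" by blast
  let ?N = "{u. {v, u} \<in> E}"
  have "?N \<noteq> {}" using degree[OF v(1)] by blast
  then obtain ws where ws: "distinct ws" "set ws = ?N"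
    "\<forall>i<length ws. ccw_next E \<rho> v (ws ! i) = cyc_succ ws i"
    "(\<Sum>w\<in>?N. vertex_angle E \<rho> v w) = 2 * pi"
    by (rule G.rotation_list)
  have edge: "{v, ws ! i} \<in> E" if "i < length ws" for i using ws(2) that nth_mem by blast
  define \<sigma> where "\<sigma> i = (0 < \<omega> {v, ws ! i})" for i
  have const: "\<sigma> i = \<sigma> j" if ij: "i < length ws" "j < length ws" for i j
  proof (rule cyclic_constant[where m = "length ws", OF _ ij])
    have unb: "\<not> bounded (left v (ws ! i))" if i: "i < length ws" and ch: "\<sigma> i \<noteq> \<sigma> (Suc i mod length ws)" for i
    proof
      assume b: "bounded (left v (ws ! i))"
      have "0 < \<omega> {v, ws ! i} * \<omega> {v, ccw_next E \<rho> v (ws ! i)}"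
        by (rule no_sign_change_same[OF same G.left_face(1)[OF edge[OF i]] b edge[OF i] refl])
      then have "0 < \<omega> {v, ws ! i} * \<omega> {v, ws ! (Suc i mod length ws)}" using ws(3) i by (simp add: cyc_succ_def)
      then show False using ch by (auto simp: \<sigma>_def zero_less_mult_iff)
    qed
    fix i j assume i: "i < length ws" "\<sigma> i \<noteq> \<sigma> (Suc i mod length ws)" and j: "j < length ws" "\<sigma> j \<noteq> \<sigma> (Suc j mod length ws)"
    have "bounded (- (- drawing V E \<rho>))" using G.compact_drawing compact_imp_bounded by simp
    then have "left v (ws ! i) = left v (ws ! j)"
      using cobounded_unique_unbounded_components[of "- drawing V E \<rho>" "left v (ws ! j)" "left v (ws ! i)"]
        unb[OF i] unb[OF j] G.left_face(1)[OF edge[OF i(1)]] G.left_face(1)[OF edge[OF j(1)]]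
      by (simp add: faces_def)
    then have "ws ! i = ws ! j" using G.one_angle_per_face[OF two_conn edge[OF i(1)] edge[OF j(1)]] by simp
    then show "i = j" using ws(1) i j by (simp add: nth_eq_iff_index_eq)
  qed
  \<comment> \<open>The common sign of the stresses at \<open>v\<close>.\<close>
  obtain s :: real where s: "s = 1 \<or> s = - 1" "\<And>u. u \<in> ?N \<Longrightarrow> 0 < s * \<omega> {v, u}"
  proof -
    obtain u0 where u0: "u0 \<in> ?N" using \<open>?N \<noteq> {}\<close> by blast
    have all: "(0 < \<omega> {v, u}) = (0 < \<omega> {v, u0})" if "u \<in> ?N" for u
      using const that u0 ws(2) unfolding \<sigma>_def by (metis in_set_conv_nth)
    have nz: "\<omega> {v, u} \<noteq> 0" if "u \<in> ?N" for u using that nonzero by auto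
    show ?thesis
    proof (cases "0 < \<omega> {v, u0}")
      case True
      then show ?thesis using that[of 1] all by simp
    next
      case False
      then have "0 < - 1 * \<omega> {v, u}" if "u \<in> ?N" for u using all[OF that] nz[OF that] by simp
      then show ?thesis using that[of "-1"] by blast
    qed
  qed
  define D where "D u = \<rho> u - \<rho> v" for u
  have up: "0 < Im (D u) \<or> Im (D u) = 0 \<and> 0 < Re (D u)" if "u \<in> ?N" for u
  proof -
    have "u \<in> V" "\<rho> u \<noteq> \<rho> v" using that G.edgeD[of v u] by auto
    then show ?thesis using z(2)[of "\<rho> u"] v by (auto simp: D_def)
  qed
  have "(\<Sum>u\<in>?N. \<omega> {v, u} *\<^sub>R (\<rho> v - \<rho> u)) = 0" using stress v unfolding self_stress_def by blast
  moreover have "(\<Sum>u\<in>?N. (s * \<omega> {v, u}) *\<^sub>R D u) = (- s) *\<^sub>R (\<Sum>u\<in>?N. \<omega> {v, u} *\<^sub>R (\<rho> v - \<rho> u))"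
    unfolding scaleR_sum_right by (rule sum.cong) (simp_all add: D_def algebra_simps)
  ultimately have eq: "(\<Sum>u\<in>?N. (s * \<omega> {v, u}) *\<^sub>R D u) = 0" by simp
  have fin: "finite ?N" by (rule G.finite_nbrs)
  have Im0: "(\<Sum>u\<in>?N. s * \<omega> {v, u} * Im (D u)) = 0" and Re0: "(\<Sum>u\<in>?N. s * \<omega> {v, u} * Re (D u)) = 0"
    using arg_cong[OF eq, of Im] arg_cong[OF eq, of Re] by simp_all
  have nonneg: "0 \<le> s * \<omega> {v, u} * Im (D u)" if "u \<in> ?N" for u
    using s(2)[OF that] up[OF that] by (intro mult_nonneg_nonneg[of "s * \<omega> {v, u}"]) auto
  have "s * \<omega> {v, u} * Im (D u) = 0" if "u \<in> ?N" for u
    using sum_nonneg_eq_0_iff[of ?N "\<lambda>u. s * \<omega> {v, u} * Im (D u)"] fin nonneg Im0 that by blast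
  then have "Im (D u) = 0" if "u \<in> ?N" for u using s(2)[OF that] that by fastforce
  then have "0 < s * \<omega> {v, u} * Re (D u)" if "u \<in> ?N" for u
    using s(2)[OF that] up[OF that] that by (intro mult_pos_pos[of "s * \<omega> {v, u}"]) auto
  then have "0 < (\<Sum>u\<in>?N. s * \<omega> {v, u} * Re (D u))" using fin \<open>?N \<noteq> {}\<close> by (intro sum_pos) auto
  then show False using Re0 by simp
qed

text \<open>The full turn at the reciprocal vertex of \<open>F\<close>, with its terms sorted by corner or reflex vertex
and by sign change.\<close>

lemma face_balance:
  assumes F: "F \<in> V'"
  obtains vs where "boundary_cycle V E \<rho> F vs"
    "(\<Sum>k<length vs. interior_angle (map \<rho> vs) k) +
      (real (card (corners (map \<rho> vs) - sign_changes \<omega> vs)) -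
       real (card ({..<length vs} - corners (map \<rho> vs) - sign_changes \<omega> vs))) * pi = 2 * pi"
proof -
  obtain vs where bc: "boundary_cycle V E \<rho> F vs"
    and sum: "(\<Sum>k<length vs. ccw_angle (stress_dirn vs (Suc k mod length vs)) (stress_dirn vs k)) = 2 * pi"
    using face_walk[OF F] not_same by metis
  let ?n = "length vs" and ?S = "sign_changes \<omega> vs" and ?C = "corners (map \<rho> vs)"
  have n: "0 < ?n" using bc by (auto simp: boundary_cycle_def)
  have "2 * pi = (\<Sum>k<?n. ccw_angle (stress_dirn vs k) (stress_dirn vs ((k + ?n - 1) mod ?n)))"
    using sum shift_sum[OF n, of "\<lambda>i j. ccw_angle (stress_dirn vs i) (stress_dirn vs j)"] by simp
  also have "\<dots> = (\<Sum>k<?n. interior_angle (map \<rho> vs) k + (if k \<in> ?S then 0 else if k \<in> ?C then pi else - pi))"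
    by (intro sum.cong refl sign_change_angles(1)[OF bc]) simp
  also have "\<dots> = (\<Sum>k<?n. interior_angle (map \<rho> vs) k) +
      (real (card (?C - ?S)) - real (card ({..<?n} - ?C - ?S))) * pi"
    unfolding sum.distrib by (subst sum_balance) (auto simp: sign_changes_def corners_def)
  finally show ?thesis using that[OF bc] by simp
qed

text \<open>With the angle sum \<open>(n - 2) * pi\<close> the balance becomes \<open>2 c\<^sub>0 + c\<^sub>1 + r\<^sub>1 = 4\<close>, where \<open>c\<close> counts corners, \<open>r\<close> reflex vertices, and the index tells
whether the sign changes. At least three corners leave three solutions.\<close>

lemma interior_face:
  assumes F: "F \<in> V'" and b: "bounded F"
  shows "interior_face_condition V E \<rho> \<omega> F"
proof -
  obtain vs where bc: "boundary_cycle V E \<rho> F vs"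
    and bal: "(\<Sum>k<length vs. interior_angle (map \<rho> vs) k) +
      (real (card (corners (map \<rho> vs) - sign_changes \<omega> vs)) -
       real (card ({..<length vs} - corners (map \<rho> vs) - sign_changes \<omega> vs))) * pi = 2 * pi"
    by (rule face_balance[OF F])
  let ?ps = "map \<rho> vs"
  let ?n = "length vs" and ?S = "sign_changes \<omega> vs" and ?C = "corners (map \<rho> vs)"
  interpret p: polygon ?ps by unfold_locales (rule face_polygon(1)[OF F bc])
  have ccw: "ccw_polygon ?ps" and eq: "F = polygon_interior ?ps" using bounded_face_polygon[OF F bc b] by auto
  have sub: "?S \<subseteq> {..<?n}" "?C \<subseteq> {..<?n}" by (auto simp: sign_changes_def corners_def)
  have "((real ?n - 2) + (real (card (?C - ?S)) - real (card ({..<?n} - ?C - ?S)))) * pi = 2 * pi"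
    using bal p.interior_angle_sum[OF ccw] by (simp add: distrib_right)
  then have "(real ?n - 2) + (real (card (?C - ?S)) - real (card ({..<?n} - ?C - ?S))) = 2" by simp
  then have "?n + card (?C - ?S) = 4 + card ({..<?n} - ?C - ?S)" by linarith
  moreover note cs = card_split[OF sub]
  ultimately have key: "2 * card (?C - ?S) + card (?S \<inter> ?C) + card (?S - ?C) = 4" by linarith
  have C3: "3 \<le> card ?C" using p.three_corners[OF ccw] .
  have no_reflex: "?S \<subseteq> ?C" if "card (?S - ?C) = 0"
    using that finite_subset[OF sub(1)] by auto
  have cases: "card ?C = 3 \<and> card ?S = 2 \<and> ?S \<subseteq> ?C \<or> card ?C = 3 \<and> card ?S = 4 \<and> card (?S \<inter> ?C) = 3 \<or>
      card ?C = 4 \<and> card ?S = 4 \<and> ?S \<subseteq> ?C"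
  proof -
    consider "card (?C - ?S) = 0" "card (?S - ?C) = 0" | "card (?C - ?S) = 0" "card (?S - ?C) = 1" | "card (?C - ?S) = 1" "card (?S - ?C) = 0"
      using key C3 cs by linarith
    then show ?thesis using no_reflex key cs by cases auto
  qed
  show ?thesis unfolding interior_face_condition_def Let_def pseudo_polygon_def
    by (intro exI[of _ vs] conjI bc eq) (use cases ccw in blast)
qed

text \<open>Measured from outside, the angles add up to \<open>(n + 2) * pi\<close>, and the balance forces every vertex to
be reflex and without sign change.\<close>

lemma exterior_face:
  assumes F: "F \<in> V'" and b: "\<not> bounded F"
  shows "exterior_face_condition V E \<rho> \<omega> F"
proof -
  obtain vs where bc: "boundary_cycle V E \<rho> F vs"
    and bal: "(\<Sum>k<length vs. interior_angle (map \<rho> vs) k) +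
      (real (card (corners (map \<rho> vs) - sign_changes \<omega> vs)) -
       real (card ({..<length vs} - corners (map \<rho> vs) - sign_changes \<omega> vs))) * pi = 2 * pi"
    by (rule face_balance[OF F])
  let ?ps = "map \<rho> vs" and ?qs = "map \<rho> (rev vs)"
  let ?n = "length vs" and ?S = "sign_changes \<omega> vs" and ?C = "corners (map \<rho> vs)"
  interpret p: polygon ?ps by unfold_locales (rule face_polygon(1)[OF F bc])
  interpret q: polygon ?qs by unfold_locales (rule face_polygon(2)[OF F bc])
  have ccw: "ccw_polygon ?qs" and eq: "- F = polygon_region ?qs" using unbounded_face_polygon[OF F bc b] by auto
  have rev_angle: "interior_angle ?qs k = 2 * pi - interior_angle ?ps (?n - Suc k)" if k: "k < ?n" for k
  proof -
    have j: "?n - Suc k < ?n" using k by simp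
    have e: "{?ps ! (?n - Suc k), cyc_succ ?ps (?n - Suc k)} \<in> poly_edges ?ps"
       "{?ps ! (?n - Suc k), cyc_pred ?ps (?n - Suc k)} \<in> poly_edges ?ps" using p.nbrs[of "?n - Suc k"] j by auto
    have "interior_angle ?qs k = ccw_angle (cyc_pred ?ps (?n - Suc k) - ?ps ! (?n - Suc k)) (cyc_succ ?ps (?n - Suc k) - ?ps ! (?n - Suc k))"
      using k by (simp add: interior_angle_def rev_map[symmetric] cyc_rev rev_nth)
    also have "\<dots> = 2 * pi - interior_angle ?ps (?n - Suc k)"
      unfolding interior_angle_def
      using p.edgeD(3)[OF e(1)] p.edgeD(3)[OF e(2)] p.interior_angle_less[of "?n - Suc k"] j
      by (intro ccw_angle_swap) (auto simp: interior_angle_def)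
    finally show ?thesis .
  qed
  have "(real ?n - 2) * pi = (\<Sum>k<?n. interior_angle ?qs k)" using q.interior_angle_sum[OF ccw] by simp
  also have "\<dots> = (\<Sum>k<?n. 2 * pi - interior_angle ?ps (?n - Suc k))" using rev_angle by simp
  also have "\<dots> = (\<Sum>k<?n. 2 * pi - interior_angle ?ps k)" by (rule sum.nat_diff_reindex)
  also have "\<dots> = real ?n * (2 * pi) - (\<Sum>k<?n. interior_angle ?ps k)" by (simp add: sum_subtractf)
  finally have "(\<Sum>k<?n. interior_angle ?ps k) = (real ?n + 2) * pi" by (simp add: algebra_simps)
  then have "((real ?n + 2) + (real (card (?C - ?S)) - real (card ({..<?n} - ?C - ?S)))) * pi = 2 * pi"
    using bal by (simp add: distrib_right)
  then have "(real ?n + 2) + (real (card (?C - ?S)) - real (card ({..<?n} - ?C - ?S))) = 2" by simp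
  then have "?n + card (?C - ?S) = card ({..<?n} - ?C - ?S)" by linarith
  moreover have sub: "?S \<subseteq> {..<?n}" "?C \<subseteq> {..<?n}" by (auto simp: sign_changes_def corners_def)
  moreover note cs = card_split[OF sub]
  ultimately have "card ?C = 0" "card ?S = 0" by linarith+
  then have none: "?C = {}" "?S = {}" using sub finite_subset by (metis card_0_eq finite_lessThan)+
  have "interior_angle ?qs k < pi" if k: "k < length ?qs" for k
  proof -
    have "?n - Suc k \<notin> ?C" "?n - Suc k < ?n" using none k by auto
    then show ?thesis using rev_angle[of k] k by (simp add: corners_def)
  qed
  then have "strictly_convex_polygon ?qs"
    unfolding strictly_convex_polygon_def using ccw q.convex_region[OF ccw] by blast
  moreover have "sign_changes \<omega> (rev vs) = {}"
  proof (rule ccontr)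
    assume "sign_changes \<omega> (rev vs) \<noteq> {}"
    then obtain k where k: "k < ?n" "\<omega> {cyc_pred (rev vs) k, rev vs ! k} * \<omega> {rev vs ! k, cyc_succ (rev vs) k} < 0"
      by (auto simp: sign_changes_def)
    then have "?n - Suc k \<in> ?S"
      by (simp add: sign_changes_def cyc_rev rev_nth insert_commute mult.commute)
    then show False using none by simp
  qed
  ultimately show ?thesis unfolding exterior_face_condition_def
    by (intro exI[of _ "rev vs"]) (simp add: bc eq)
qed

end

theorem theorem3:
  fixes V :: "'v set" and E :: "'v set set" and \<rho> :: "'v \<Rightarrow> complex"
    and \<omega> :: "'v set \<Rightarrow> real" and \<rho>' :: "complex set \<Rightarrow> complex"
  assumes "noncrossing_framework V E \<rho>"
    and "two_connected V E"
    and "self_stress V E \<rho> \<omega>"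
    and "\<forall>e\<in>E. \<omega> e \<noteq> 0"
    and "reciprocal V E \<rho> \<omega> \<rho>'"
    and "noncrossing_reciprocal V E \<rho> \<rho>'"
  shows "(\<forall>F\<in>faces V E \<rho>. \<not> bounded F \<longrightarrow> exterior_face_condition V E \<rho> \<omega> F) \<and>
         (\<forall>F\<in>faces V E \<rho>. bounded F \<longrightarrow> interior_face_condition V E \<rho> \<omega> F)"
proof -
  interpret reciprocal_pair V E \<rho> \<omega> \<rho>' by unfold_locales (use assms in auto)
  show ?thesis using interior_face exterior_face by blast
qed

end
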